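(* Let $D$ be a $2$-dimensional regular local ring and let $V$ be a minimal valuation overring of $D$. Then there exists a subset $\mathcal{U}$ of $Q(D)$ such that $V$ is a localization of $C=\bigcap_{\alpha\in\mathcal{U}}\alpha$. In particular, if $V$ is not a DVR, then $C$ is not an almost Krull domain.
   Context: $Q(D)$ denotes the set of all $2$-dimensional regular local rings $\alpha$ with $D\subseteq\alpha\subseteq F$, $F$ the quotient field of $D$. A valuation overring of $D$ is a valuation ring $V$ with $D\subseteq V\subseteq F$; it is minimal if it is minimal with respect to inclusion among valuation overrings of $D$. An integral domain $C$ is an almost Krull domain if $C_P$ is a Krull domain for every prime ideal $P$ of $C$. *)

theory Defs
  imports Main
begin

text \<open>All rings are subrings of an ambient field of type 'a; the quotient field of a
subring A is the set of fractions a/b with a, b in A and b nonzero.\<close>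

definition subring :: "'a::field set \<Rightarrow> bool" where
  "subring A \<longleftrightarrow> 0 \<in> A \<and> 1 \<in> A \<and> (\<forall>x\<in>A. \<forall>y\<in>A. x + y \<in> A \<and> x - y \<in> A \<and> x * y \<in> A)"

definition qf :: "'a::field set \<Rightarrow> 'a set" where
  "qf A = {a * inverse b | a b. a \<in> A \<and> b \<in> A \<and> b \<noteq> 0}"

definition is_ideal :: "'a::field set \<Rightarrow> 'a set \<Rightarrow> bool" where
  "is_ideal A I \<longleftrightarrow> I \<subseteq> A \<and> 0 \<in> I \<and> (\<forall>x\<in>I. \<forall>y\<in>I. x + y \<in> I) \<and> (\<forall>a\<in>A. \<forall>x\<in>I. a * x \<in> I)"

definition prime_ideal :: "'a::field set \<Rightarrow> 'a set \<Rightarrow> bool" where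
  "prime_ideal A P \<longleftrightarrow> is_ideal A P \<and> P \<noteq> A \<and> (\<forall>x\<in>A. \<forall>y\<in>A. x * y \<in> P \<longrightarrow> x \<in> P \<or> y \<in> P)"

definition maximal_ideal :: "'a::field set \<Rightarrow> 'a set \<Rightarrow> bool" where
  "maximal_ideal A M \<longleftrightarrow> is_ideal A M \<and> M \<noteq> A \<and> (\<forall>J. is_ideal A J \<and> M \<subseteq> J \<longrightarrow> J = M \<or> J = A)"

definition ideal_gen :: "'a::field set \<Rightarrow> 'a set \<Rightarrow> 'a set" where
  "ideal_gen A G = {(\<Sum>g\<in>G. c g * g) | c. \<forall>g\<in>G. c g \<in> A}"

definition noetherian :: "'a::field set \<Rightarrow> bool" where
  "noetherian A \<longleftrightarrow> (\<forall>I. is_ideal A I \<longrightarrow> (\<exists>G. finite G \<and> G \<subseteq> I \<and> I = ideal_gen A G))"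

definition local_ring :: "'a::field set \<Rightarrow> bool" where
  "local_ring A \<longleftrightarrow> subring A \<and> (\<exists>!M. maximal_ideal A M)"

definition has_prime_chain :: "'a::field set \<Rightarrow> nat \<Rightarrow> bool" where
  "has_prime_chain A n \<longleftrightarrow> (\<exists>P :: nat \<Rightarrow> 'a set.
      (\<forall>i\<le>n. prime_ideal A (P i)) \<and> (\<forall>i<n. P i \<subset> P (Suc i)))"

definition krull_dim_eq :: "'a::field set \<Rightarrow> nat \<Rightarrow> bool" where
  "krull_dim_eq A n \<longleftrightarrow> has_prime_chain A n \<and> \<not> has_prime_chain A (Suc n)"

definition regular_local_2 :: "'a::field set \<Rightarrow> bool" where
  "regular_local_2 A \<longleftrightarrow> local_ring A \<and> noetherian A \<and> krull_dim_eq A 2 \<and>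
     (\<forall>M. maximal_ideal A M \<longrightarrow> (\<exists>x y. M = ideal_gen A {x, y}))"

definition Qset :: "'a::field set \<Rightarrow> 'a set set" where
  "Qset D = {\<alpha>. D \<subseteq> \<alpha> \<and> \<alpha> \<subseteq> qf D \<and> regular_local_2 \<alpha>}"

definition valuation_ring_of :: "'a::field set \<Rightarrow> 'a set \<Rightarrow> bool" where
  "valuation_ring_of K V \<longleftrightarrow> subring V \<and> V \<subseteq> K \<and>
     (\<forall>x\<in>K. x \<noteq> 0 \<longrightarrow> x \<in> V \<or> inverse x \<in> V)"

definition valuation_overring :: "'a::field set \<Rightarrow> 'a set \<Rightarrow> bool" where
  "valuation_overring D V \<longleftrightarrow> D \<subseteq> V \<and> valuation_ring_of (qf D) V"

definition minimal_valuation_overring :: "'a::field set \<Rightarrow> 'a set \<Rightarrow> bool" where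
  "minimal_valuation_overring D V \<longleftrightarrow> valuation_overring D V \<and>
     (\<forall>W. valuation_overring D W \<and> W \<subseteq> V \<longrightarrow> W = V)"

definition DVR_of :: "'a::field set \<Rightarrow> 'a set \<Rightarrow> bool" where
  "DVR_of K V \<longleftrightarrow> valuation_ring_of K V \<and> noetherian V \<and>
     (\<exists>x\<in>V. x \<noteq> 0 \<and> inverse x \<notin> V)"

definition is_DVR :: "'a::field set \<Rightarrow> bool" where
  "is_DVR V \<longleftrightarrow> DVR_of (qf V) V"

definition krull_domain :: "'a::field set \<Rightarrow> bool" where
  "krull_domain A \<longleftrightarrow> subring A \<and> (\<exists>\<V>. (\<forall>V\<in>\<V>. DVR_of (qf A) V) \<and>
      A = qf A \<inter> \<Inter>\<V> \<and>
      (\<forall>x\<in>A. x \<noteq> 0 \<longrightarrow> finite {V\<in>\<V>. inverse x \<notin> V}))"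

definition loc_prime :: "'a::field set \<Rightarrow> 'a set \<Rightarrow> 'a set" where
  "loc_prime C P = {c * inverse s | c s. c \<in> C \<and> s \<in> C \<and> s \<notin> P}"

definition almost_krull :: "'a::field set \<Rightarrow> bool" where
  "almost_krull C \<longleftrightarrow> subring C \<and> (\<forall>P. prime_ideal C P \<longrightarrow> krull_domain (loc_prime C P))"

definition mult_closed :: "'a::field set \<Rightarrow> 'a set \<Rightarrow> bool" where
  "mult_closed C S \<longleftrightarrow> S \<subseteq> C \<and> 1 \<in> S \<and> 0 \<notin> S \<and> (\<forall>s\<in>S. \<forall>t\<in>S. s * t \<in> S)"

definition is_localization_of :: "'a::field set \<Rightarrow> 'a set \<Rightarrow> bool" where
  "is_localization_of C V \<longleftrightarrow> (\<exists>S. mult_closed C S \<and> V = {c * inverse s | c s. c \<in> C \<and> s \<in> S})"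

end

theory Submission
  imports Defs "HOL-Computational_Algebra.Polynomial"
begin

text \<open>Since $V$ is minimal, it dominates $D$ and its residue field is algebraic over that of $D$, so
  there is an infinite sequence $D = E_0 \subset E_1 \subset \dots$ of local quadratic transforms along
  $V$, and $V$ is its union (Abhyankar). Choose \<open>w\<close> in the maximal ideal of $V$ some power of which is
  divisible in $V$ by any given nonzero element. Inductively, rings $\alpha_1, \dots, \alpha_k$ in
  $Q(D)$ have been chosen with \<open>1/w\<close> in each of their maximal ideals. For $f = c/b \in V$ the element
  $s = z/(1+z)$ with $z = b/w^n$ is then a unit of $V$ with $s, sf \in \alpha_1 \cap \dots \cap
  \alpha_k$. Take \<open>n\<close> so large that $w, s, sf \in E_n$, replace \<open>w\<close> by a power of \<open>w\<close> divided by a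
  multiple in $D$ of a prime of $E_n$ that does not divide \<open>w\<close>, and let $\alpha_{k+1}$ be a regular
  local ring dominating $E_n$ with the new \<open>1/w\<close> in its maximal ideal. Letting \<open>f\<close> run through the
  generators $y_k/x_k$ of the $E_k$ makes $V$ a localization of the intersection $C$ of all the
  $\alpha_k$, while $C \subseteq V$ because $\alpha_k$ dominates $E_n$ for arbitrarily large \<open>n\<close>.\<close>

section \<open>Subrings and ideals\<close>

text \<open>Two demands on the family conflict. The denominators need \<open>1/w\<close> in the
  maximal ideal of every ring chosen so far, while keeping $C$ inside $V$ needs rings dominating
  $E_n$ for large \<open>n\<close>. But \<open>w\<close> lies in $E_n$ for large \<open>n\<close>,
  and a ring containing \<open>w\<close> cannot have \<open>1/w\<close> in its maximal ideal, so
  \<open>w\<close> must change with every new ring. The new \<open>1/w\<close> has to stay in the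
  maximal ideals of the old rings, which contain $D$ but perhaps not the chosen prime
  \<open>q\<close> of $E_n$; hence the division by a multiple of \<open>q\<close> that lies in $D$.
  For the new ring the \<open>q\<close>-adic valuation decides: \<open>w\<close> has value 0 there
  and the new \<open>1/w\<close> has positive value. The union theorem is proved here as well, by
  following the multiplicities of the numerator and the denominator of a fraction. For this the
  rings $E_n$ are handled through an elementary description by two parameters that can be
  transported explicitly along a quadratic transform. The statement on almost Krull domains follows
  because the localization is at a prime ideal of $C$, and a valuation ring with a nonzero nonunit
  that is a Krull domain is a DVR.\<close>

lemma subring_zero: "subring A \<Longrightarrow> 0 \<in> A"
  and subring_one: "subring A \<Longrightarrow> 1 \<in> A"
  and subring_add: "subring A \<Longrightarrow> a \<in> A \<Longrightarrow> b \<in> A \<Longrightarrow> a + b \<in> A"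
  and subring_diff: "subring A \<Longrightarrow> a \<in> A \<Longrightarrow> b \<in> A \<Longrightarrow> a - b \<in> A"
  and subring_mult: "subring A \<Longrightarrow> a \<in> A \<Longrightarrow> b \<in> A \<Longrightarrow> a * b \<in> A"
  by (auto simp: subring_def)

lemma subring_uminus: "subring A \<Longrightarrow> a \<in> A \<Longrightarrow> - a \<in> A"
  using subring_diff[of A 0 a] subring_zero by auto

lemma subring_power: "subring A \<Longrightarrow> a \<in> A \<Longrightarrow> a ^ n \<in> A"
  by (induction n) (auto intro: subring_one subring_mult)

lemmas subring_closed = subring_zero subring_one subring_add subring_diff subring_mult
  subring_uminus subring_power

lemma subring_fractions:
  assumes A: "subring A" and S: "S \<subseteq> A" "1 \<in> S" "0 \<notin> S" "\<And>s r. s \<in> S \<Longrightarrow> r \<in> S \<Longrightarrow> s * r \<in> S"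
  shows "subring {c * inverse s | c s. c \<in> A \<and> s \<in> S}" (is "subring ?L")
    and "A \<subseteq> {c * inverse s | c s. c \<in> A \<and> s \<in> S}"
proof -
  note cl = subring_closed[OF A]
  have LI: "c * inverse s \<in> ?L" if "c \<in> A" "s \<in> S" for c s using that by blast
  show sub: "A \<subseteq> ?L" using LI[OF _ S(2)] by auto
  show "subring ?L"
    unfolding subring_def
  proof (intro conjI ballI)
    show "0 \<in> ?L" "1 \<in> ?L" using sub cl(1,2) by blast+
    fix a b assume "a \<in> ?L" "b \<in> ?L"
    then obtain c s d r where *: "c \<in> A" "s \<in> S" "d \<in> A" "r \<in> S"
      and ab: "a = c * inverse s" "b = d * inverse r" by blast
    have nz: "s \<noteq> 0" "r \<noteq> 0" using * S(3) by auto
    have eq: "a + b = (c * r + d * s) * inverse (s * r)" "a - b = (c * r - d * s) * inverse (s * r)"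
      "a * b = (c * d) * inverse (s * r)"
      using nz unfolding ab by (simp_all add: divide_simps)
    have mem: "c * r + d * s \<in> A" "c * r - d * s \<in> A" "c * d \<in> A"
      using * S(1) by (simp_all add: cl subset_iff)
    show "a + b \<in> ?L" "a - b \<in> ?L" "a * b \<in> ?L"
      unfolding eq by (rule LI[OF _ S(4)[OF *(2,4)]], rule mem)+
  qed
qed

lemma is_ideal_uminus:
  assumes "subring A" "is_ideal A I" "a \<in> I"
  shows "- a \<in> I"
proof -
  have "(- 1) * a \<in> I"
    using assms subring_uminus[OF assms(1) subring_one[OF assms(1)]] unfolding is_ideal_def by blast
  then show ?thesis by simp
qed

lemma is_ideal_zero: "is_ideal A I \<Longrightarrow> 0 \<in> I"
  and is_ideal_add: "is_ideal A I \<Longrightarrow> a \<in> I \<Longrightarrow> b \<in> I \<Longrightarrow> a + b \<in> I"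
  and is_ideal_mult: "is_ideal A I \<Longrightarrow> c \<in> A \<Longrightarrow> a \<in> I \<Longrightarrow> c * a \<in> I"
  and is_ideal_subset: "is_ideal A I \<Longrightarrow> I \<subseteq> A"
  by (auto simp: is_ideal_def)

lemma is_ideal_mult2: "is_ideal A I \<Longrightarrow> c \<in> A \<Longrightarrow> a \<in> I \<Longrightarrow> a * c \<in> I"
  using is_ideal_mult[of A I c a] by (simp add: mult.commute)

lemma is_ideal_diff: "subring A \<Longrightarrow> is_ideal A I \<Longrightarrow> a \<in> I \<Longrightarrow> b \<in> I \<Longrightarrow> a - b \<in> I"
  using is_ideal_add[of A I a "- b"] is_ideal_uminus[of A I b] by simp

lemma is_ideal_INT:
  assumes "\<And>k. is_ideal A (J k)"
  shows "is_ideal A (\<Inter>k. J k)"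
  unfolding is_ideal_def
proof (intro conjI ballI)
  show "(\<Inter>k. J k) \<subseteq> A" using is_ideal_subset[OF assms] by auto
qed (auto intro: is_ideal_zero[OF assms] is_ideal_add[OF assms] is_ideal_mult[OF assms])

lemma is_ideal_eq_ring: "is_ideal A I \<Longrightarrow> 1 \<in> I \<Longrightarrow> I = A"
  using is_ideal_mult2[of A I _ 1] is_ideal_subset[of A I] by auto

lemma prime_ideal_one: "prime_ideal A P \<Longrightarrow> 1 \<notin> P"
  using is_ideal_eq_ring unfolding prime_ideal_def by blast

lemma prime_ideal_ideal: "prime_ideal A P \<Longrightarrow> is_ideal A P"
  by (simp add: prime_ideal_def)

lemma prime_ideal_cases: "prime_ideal A P \<Longrightarrow> a \<in> A \<Longrightarrow> b \<in> A \<Longrightarrow> a * b \<in> P \<Longrightarrow> a \<in> P \<or> b \<in> P"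
  by (simp add: prime_ideal_def)

lemma prime_ideal_power:
  assumes "subring A" "prime_ideal A P" "a \<in> A" "a ^ n \<in> P"
  shows "a \<in> P"
  using assms(4)
proof (induction n)
  case 0
  then show ?case using prime_ideal_one[OF assms(2)] by simp
next
  case (Suc n)
  then show ?case
    using prime_ideal_cases[OF assms(2,3) subring_power[OF assms(1,3)]] by auto
qed

lemma subring_loc_prime:
  assumes C: "subring C" and P: "prime_ideal C P"
  shows "subring (loc_prime C P)" and "C \<subseteq> loc_prime C P"
proof -
  have "loc_prime C P = {c * inverse s | c s. c \<in> C \<and> s \<in> C - P}" by (auto simp: loc_prime_def)
  moreover have "s * r \<in> C - P" if "s \<in> C - P" "r \<in> C - P" for s r
    using that subring_mult[OF C] prime_ideal_cases[OF P] by blast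
  ultimately show "subring (loc_prime C P)" "C \<subseteq> loc_prime C P"
    using subring_fractions[OF C, of "C - P"] subring_one[OF C] prime_ideal_one[OF P]
      is_ideal_zero[OF prime_ideal_ideal[OF P]] by auto
qed

text \<open>Serves for \<open>D + mv V\<close> and \<open>D[t] + mv V\<close>, the intermediate
  rings on which the minimality of \<open>V\<close> is tested.\<close>

lemma subring_add_ideal:
  assumes V: "subring V" and A: "subring A" "A \<subseteq> V" and I: "is_ideal V I"
  shows "subring {a + v | a v. a \<in> A \<and> v \<in> I}" (is "subring ?B")
    and "A \<subseteq> {a + v | a v. a \<in> A \<and> v \<in> I}" "I \<subseteq> {a + v | a v. a \<in> A \<and> v \<in> I}"
    and "{a + v | a v. a \<in> A \<and> v \<in> I} \<subseteq> V"
proof -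
  have BI: "a + v \<in> ?B" if "a \<in> A" "v \<in> I" for a v using that by blast
  show AB: "A \<subseteq> ?B" using BI[OF _ is_ideal_zero[OF I]] by auto
  show "I \<subseteq> ?B" using BI[OF subring_zero[OF A(1)]] by auto
  show "?B \<subseteq> V" using A(2) is_ideal_subset[OF I] subring_add[OF V] by auto
  show "subring ?B"
    unfolding subring_def
  proof (intro conjI ballI)
    show "0 \<in> ?B" "1 \<in> ?B" using AB subring_closed(1,2)[OF A(1)] by blast+
    fix p q assume "p \<in> ?B" "q \<in> ?B"
    then obtain d v e w where *: "d \<in> A" "v \<in> I" "e \<in> A" "w \<in> I" and pq: "p = d + v" "q = e + w"
      by blast
    have eq: "p + q = (d + e) + (v + w)" "p - q = (d - e) + (v - w)"
      "p * q = (d * e) + (d * w + e * v + v * w)"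
      unfolding pq by (simp_all add: algebra_simps)
    have mem: "v + w \<in> I" "v - w \<in> I" "d * w + e * v + v * w \<in> I"
      using * A(2) is_ideal_add[OF I] is_ideal_diff[OF V I]
        is_ideal_mult[OF I] is_ideal_subset[OF I] by (auto simp: subset_iff)
    show "p + q \<in> ?B" "p - q \<in> ?B" "p * q \<in> ?B"
      unfolding eq by (rule BI, rule subring_closed(3-5)[OF A(1) *(1,3)], rule mem)+
  qed
qed

section \<open>Principal and two-generator ideals\<close>

definition lin :: "'a::field set \<Rightarrow> 'a \<Rightarrow> 'a \<Rightarrow> 'a set" where
  "lin D x y = {a * x + b * y | a b. a \<in> D \<and> b \<in> D}"

definition princ :: "'a::field set \<Rightarrow> 'a \<Rightarrow> 'a set" where
  "princ D g = {g * d | d. d \<in> D}"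

lemma princI: "d \<in> D \<Longrightarrow> g * d \<in> princ D g"
  by (auto simp: princ_def)

lemma princE: "a \<in> princ D g \<Longrightarrow> (\<And>d. d \<in> D \<Longrightarrow> a = g * d \<Longrightarrow> R) \<Longrightarrow> R"
  by (auto simp: princ_def)

lemma linI: "a \<in> D \<Longrightarrow> b \<in> D \<Longrightarrow> a * x + b * y \<in> lin D x y"
  by (auto simp: lin_def)

lemma linE: "m \<in> lin D x y \<Longrightarrow> (\<And>a b. a \<in> D \<Longrightarrow> b \<in> D \<Longrightarrow> m = a * x + b * y \<Longrightarrow> R) \<Longrightarrow> R"
  by (auto simp: lin_def)

lemma lin_commute: "lin D x y = lin D y x"
  unfolding lin_def by (metis (no_types, opaque_lifting) add.commute)

lemma is_ideal_princ:
  assumes "subring D" "g \<in> D"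
  shows "is_ideal D (princ D g)"
  unfolding is_ideal_def
proof (intro conjI ballI)
  show "princ D g \<subseteq> D"
    using assms by (auto simp: princ_def subring_mult)
  show "0 \<in> princ D g" using princI[OF subring_zero[OF assms(1)], of g] by simp
  show "a + b \<in> princ D g" if ab: "a \<in> princ D g" "b \<in> princ D g" for a b
  proof -
    from ab obtain d e where de: "d \<in> D" "e \<in> D" and eq: "a = g * d" "b = g * e"
      by (auto elim!: princE)
    have "g * (d + e) \<in> princ D g" using de assms by (intro princI subring_add)
    then show ?thesis using eq by (simp add: algebra_simps)
  qed
  show "c * a \<in> princ D g" if "c \<in> D" "a \<in> princ D g" for a c
    using that princI[of "c * _" D g] subring_mult[OF assms(1)]
    by (elim princE) (metis mult.left_commute)
qed

lemma is_ideal_lin: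
  assumes "subring D" "x \<in> D" "y \<in> D"
  shows "is_ideal D (lin D x y)"
  unfolding is_ideal_def
proof (intro conjI ballI)
  show "lin D x y \<subseteq> D"
    using assms by (auto simp: lin_def intro!: subring_closed)
  show "0 \<in> lin D x y" using linI[of 0 D 0 x y] subring_zero[OF assms(1)] by simp
  show "a + b \<in> lin D x y" if "a \<in> lin D x y" "b \<in> lin D x y" for a b
  proof -
    from that obtain p q r s where "p \<in> D" "q \<in> D" "r \<in> D" "s \<in> D"
      and eq: "a = p * x + q * y" "b = r * x + s * y"
      by (auto elim!: linE)
    then have "(p + r) * x + (q + s) * y \<in> lin D x y" using assms by (intro linI subring_add)
    then show ?thesis using eq by (simp add: algebra_simps)
  qed
  show "c * a \<in> lin D x y" if "c \<in> D" "a \<in> lin D x y" for a c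
  proof -
    from that obtain p q where "p \<in> D" "q \<in> D" and eq: "a = p * x + q * y"
      by (auto elim!: linE)
    then have "(c * p) * x + (c * q) * y \<in> lin D x y"
      using assms that by (intro linI subring_mult)
    then show ?thesis using eq by (simp add: algebra_simps)
  qed
qed

lemma lin_gens:
  assumes "subring D"
  shows "x \<in> lin D x y" "y \<in> lin D x y"
  using linI[of 1 D 0 x y] linI[of 0 D 1 x y] assms subring_zero subring_one by auto

lemma self_in_princ: "subring D \<Longrightarrow> g \<in> princ D g"
  using princI[of 1 D g] subring_one by auto

lemma ideal_gen_empty: "ideal_gen D {} = {0}"
  by (auto simp: ideal_gen_def)

lemma ideal_gen_insert:
  assumes "finite G" "g \<notin> G"
  shows "ideal_gen D (insert g G) = {i + a * g | i a. i \<in> ideal_gen D G \<and> a \<in> D}"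
proof (intro equalityI subsetI)
  fix z assume "z \<in> ideal_gen D (insert g G)"
  then obtain c where c: "\<forall>h\<in>insert g G. c h \<in> D" and z: "z = (\<Sum>h\<in>insert g G. c h * h)"
    by (auto simp: ideal_gen_def)
  have "z = (\<Sum>h\<in>G. c h * h) + c g * g" using z assms by simp
  moreover have "(\<Sum>h\<in>G. c h * h) \<in> ideal_gen D G" using c by (auto simp: ideal_gen_def)
  ultimately show "z \<in> {i + a * g | i a. i \<in> ideal_gen D G \<and> a \<in> D}" using c by blast
next
  fix z assume "z \<in> {i + a * g | i a. i \<in> ideal_gen D G \<and> a \<in> D}"
  then obtain c a where c: "\<forall>h\<in>G. c h \<in> D" "a \<in> D" and z: "z = (\<Sum>h\<in>G. c h * h) + a * g"
    by (auto simp: ideal_gen_def)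
  define c' where "c' = c(g := a)"
  have "(\<Sum>h\<in>G. c' h * h) = (\<Sum>h\<in>G. c h * h)"
    using assms by (intro sum.cong) (auto simp: c'_def)
  then have "z = (\<Sum>h\<in>insert g G. c' h * h)" using z assms by (simp add: c'_def)
  moreover have "\<forall>h\<in>insert g G. c' h \<in> D" using c by (auto simp: c'_def)
  ultimately show "z \<in> ideal_gen D (insert g G)" unfolding ideal_gen_def by blast
qed

lemma is_ideal_insert:
  assumes "subring D" "is_ideal D I" "g \<in> D"
  shows "is_ideal D {i + a * g | i a. i \<in> I \<and> a \<in> D}"
  unfolding is_ideal_def
proof (intro conjI ballI)
  show "{i + a * g | i a. i \<in> I \<and> a \<in> D} \<subseteq> D"
    using assms is_ideal_subset[OF assms(2)] by (auto intro!: subring_closed)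
  have "0 = 0 + 0 * g" by simp
  then show "0 \<in> {i + a * g | i a. i \<in> I \<and> a \<in> D}"
    using is_ideal_zero[OF assms(2)] subring_zero[OF assms(1)] by blast
  show "u + v \<in> {i + a * g | i a. i \<in> I \<and> a \<in> D}"
    if "u \<in> {i + a * g | i a. i \<in> I \<and> a \<in> D}" "v \<in> {i + a * g | i a. i \<in> I \<and> a \<in> D}" for u v
  proof -
    from that obtain i a j b where *: "i \<in> I" "a \<in> D" "j \<in> I" "b \<in> D"
      and "u = i + a * g" "v = j + b * g" by blast
    then have "u + v = (i + j) + (a + b) * g" by (simp add: algebra_simps)
    then show ?thesis using * is_ideal_add[OF assms(2)] subring_add[OF assms(1)] by blast
  qed
  show "c * u \<in> {i + a * g | i a. i \<in> I \<and> a \<in> D}"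
    if "c \<in> D" "u \<in> {i + a * g | i a. i \<in> I \<and> a \<in> D}" for c u
  proof -
    from that obtain i a where *: "i \<in> I" "a \<in> D" and "u = i + a * g" by blast
    then have "c * u = c * i + (c * a) * g" by (simp add: algebra_simps)
    then show ?thesis
      using * that(1) is_ideal_mult[OF assms(2)] subring_mult[OF assms(1)] by blast
  qed
qed

lemma is_ideal_ideal_gen:
  assumes "subring D" "finite G" "G \<subseteq> D"
  shows "is_ideal D (ideal_gen D G)"
  using assms(2,3)
proof (induction G rule: finite_induct)
  case empty
  then show ?case
    using subring_zero[OF assms(1)] by (auto simp: ideal_gen_empty is_ideal_def)
next
  case (insert g G)
  then show ?case
    using is_ideal_insert[OF assms(1), of "ideal_gen D G" g] by (simp add: ideal_gen_insert)
qed

text \<open>Generators are eliminated one at a time. \<open>key\<close> carries the claim that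
  \<open>I\<close> lies in \<open>N\<close> plus the ideal of the remaining generators
  \<open>H\<close>; for the generator \<open>g\<close> to be dropped, \<open>step\<close> puts
  \<open>(1 - c * a) * g\<close> into \<open>N\<close> plus the ideal of the others, and
  \<open>1 - c * a\<close> is a unit. It is applied with \<open>N\<close> equal to 0,
  \<open>xD\<close> and \<open>gD\<close>.\<close>

lemma nakayama:
  assumes D: "subring D" and I: "is_ideal D I" and N: "is_ideal D N"
    and fg: "finite G" "G \<subseteq> I" "I = ideal_gen D G"
    and c: "c \<in> D" and unit: "\<And>a. a \<in> D \<Longrightarrow> 1 - c * a \<noteq> 0 \<and> inverse (1 - c * a) \<in> D"
    and step: "\<And>z. z \<in> I \<Longrightarrow> \<exists>n\<in>N. \<exists>i\<in>I. z = n + c * i"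
  shows "I \<subseteq> N"
proof -
  have key: "I \<subseteq> N"
    if "finite H" "H \<subseteq> I" "\<And>z. z \<in> I \<Longrightarrow> \<exists>n\<in>N. \<exists>i\<in>ideal_gen D H. z = n + i" for H
    using that
  proof (induction H rule: finite_induct)
    case empty
    then show ?case by (auto simp: ideal_gen_empty)
  next
    case (insert g H)
    have H: "is_ideal D (ideal_gen D H)"
      using insert.hyps insert.prems is_ideal_subset[OF I] by (intro is_ideal_ideal_gen[OF D]) auto
    have decomp: "\<exists>n\<in>N. \<exists>i\<in>ideal_gen D H. \<exists>a\<in>D. z = n + i + a * g" if zI: "z \<in> I" for z
    proof -
      obtain n i where n: "n \<in> N" and i: "i \<in> ideal_gen D (insert g H)" and z: "z = n + i"
        using insert.prems(2)[OF zI] by blast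
      obtain j a where "j \<in> ideal_gen D H" "a \<in> D" "i = j + a * g"
        using i insert.hyps by (auto simp: ideal_gen_insert)
      then show ?thesis using n z by (metis add.assoc)
    qed
    have gI: "g \<in> I" using insert.prems by auto
    have "\<exists>n\<in>N. \<exists>i\<in>ideal_gen D H. g = n + i"
    proof -
      obtain n i where n: "n \<in> N" and i: "i \<in> I" and g: "g = n + c * i" using step[OF gI] by blast
      obtain m j a where m: "m \<in> N" and j: "j \<in> ideal_gen D H" and a: "a \<in> D"
        and ieq: "i = m + j + a * g" using decomp[OF i] by blast
      define u where "u = inverse (1 - c * a)"
      have u: "u \<in> D" "u * (1 - c * a) = 1" using unit[OF a] by (auto simp: u_def)
      have "(1 - c * a) * g = n + c * m + c * j"
        using g ieq by (simp add: algebra_simps)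
      then have "(u * (1 - c * a)) * g = u * (n + c * m + c * j)" by (simp add: mult.assoc)
      then have "g = u * (n + c * m) + u * (c * j)" unfolding u(2) by (simp add: algebra_simps)
      moreover have "u * (n + c * m) \<in> N"
        using n m c u N by (intro is_ideal_mult[OF N] is_ideal_add[OF N])
      moreover have "u * (c * j) \<in> ideal_gen D H"
        using j c u by (intro is_ideal_mult[OF H])
      ultimately show ?thesis by blast
    qed
    then obtain n0 i0 where n0: "n0 \<in> N" and i0: "i0 \<in> ideal_gen D H" and g: "g = n0 + i0" by blast
    show ?case
    proof (rule insert.IH)
      show "H \<subseteq> I" using insert.prems by auto
      fix z assume "z \<in> I"
      then obtain n i a where *: "n \<in> N" "i \<in> ideal_gen D H" "a \<in> D" and z: "z = n + i + a * g"
        using decomp by blast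
      have "z = (n + a * n0) + (i + a * i0)" using z g by (simp add: algebra_simps)
      moreover have "n + a * n0 \<in> N" using * n0 N is_ideal_add is_ideal_mult by blast
      moreover have "i + a * i0 \<in> ideal_gen D H" using * i0 H is_ideal_add is_ideal_mult by blast
      ultimately show "\<exists>n\<in>N. \<exists>i\<in>ideal_gen D H. z = n + i" by blast
    qed
  qed
  show ?thesis
  proof (rule key[OF fg(1,2)])
    fix z assume "z \<in> I"
    then show "\<exists>n\<in>N. \<exists>i\<in>ideal_gen D G. z = n + i"
      using is_ideal_zero[OF N] fg(3) by (intro bexI[of _ 0] bexI[of _ z]) auto
  qed
qed

lemma is_ideal_Union_chain:
  assumes "\<C> \<noteq> {}" "\<And>I. I \<in> \<C> \<Longrightarrow> is_ideal D I"
    and chain: "\<And>I J. I \<in> \<C> \<Longrightarrow> J \<in> \<C> \<Longrightarrow> I \<subseteq> J \<or> J \<subseteq> I"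
  shows "is_ideal D (\<Union>\<C>)"
  unfolding is_ideal_def
proof (intro conjI ballI)
  show "\<Union>\<C> \<subseteq> D" using assms(2) is_ideal_subset by blast
  show "0 \<in> \<Union>\<C>" using assms(1,2) is_ideal_zero by blast
  show "a + b \<in> \<Union>\<C>" if "a \<in> \<Union>\<C>" "b \<in> \<Union>\<C>" for a b
  proof -
    from that obtain I J where "I \<in> \<C>" "J \<in> \<C>" "a \<in> I" "b \<in> J" by blast
    then show ?thesis using chain[of I J] assms(2) is_ideal_add by blast
  qed
  show "c * a \<in> \<Union>\<C>" if "c \<in> D" "a \<in> \<Union>\<C>" for a c
    using that assms(2) is_ideal_mult by blast
qed

lemma proper_ideal_in_maximal:
  assumes D: "subring D" and I: "is_ideal D I" "1 \<notin> I"
  shows "\<exists>M. maximal_ideal D M \<and> I \<subseteq> M"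
proof -
  define \<A> where "\<A> = {J. is_ideal D J \<and> I \<subseteq> J \<and> 1 \<notin> J}"
  have "\<exists>M\<in>\<A>. \<forall>X\<in>\<A>. M \<subseteq> X \<longrightarrow> X = M"
  proof (rule subset_Zorn_nonempty)
    show "\<A> \<noteq> {}" using I by (auto simp: \<A>_def)
    fix \<C> assume C: "\<C> \<noteq> {}" "subset.chain \<A> \<C>"
    then have sub: "\<C> \<subseteq> \<A>" by (auto simp: subset.chain_def)
    have "is_ideal D (\<Union>\<C>)"
      using C sub by (intro is_ideal_Union_chain) (auto simp: subset.chain_def \<A>_def)
    then show "\<Union>\<C> \<in> \<A>" using C(1) sub by (auto simp: \<A>_def)
  qed
  then obtain M where M: "is_ideal D M" "I \<subseteq> M" "1 \<notin> M"
    and max: "\<And>J. is_ideal D J \<Longrightarrow> I \<subseteq> J \<Longrightarrow> 1 \<notin> J \<Longrightarrow> M \<subseteq> J \<Longrightarrow> J = M"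
    by (auto simp: \<A>_def)
  have "maximal_ideal D M"
    unfolding maximal_ideal_def
    using M max is_ideal_eq_ring subring_one[OF D] by (metis order_trans)
  then show ?thesis using M by blast
qed

lemma maximal_ideal_one: "maximal_ideal D M \<Longrightarrow> 1 \<notin> M"
  using is_ideal_eq_ring unfolding maximal_ideal_def by blast

lemma local_ring_unit:
  assumes "local_ring D" "maximal_ideal D M" "d \<in> D" "d \<notin> M"
  shows "inverse d \<in> D"
proof (rule ccontr)
  assume n: "inverse d \<notin> D"
  have D: "subring D" using assms(1) by (simp add: local_ring_def)
  have "1 \<notin> princ D d"
  proof
    assume "1 \<in> princ D d"
    then obtain e where "e \<in> D" "1 = d * e" by (auto elim: princE)
    then show False using n by (metis inverse_unique)
  qed
  then obtain M' where "maximal_ideal D M'" "princ D d \<subseteq> M'"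
    using proper_ideal_in_maximal[OF D is_ideal_princ[OF D assms(3)]] by blast
  moreover have "M' = M" using assms(1,2) calculation by (auto simp: local_ring_def)
  ultimately show False using assms(4) self_in_princ[OF D] by blast
qed

lemma proper_ideal_in_maximal_local:
  assumes "local_ring D" "maximal_ideal D M" "is_ideal D I" "1 \<notin> I"
  shows "I \<subseteq> M"
  using assms proper_ideal_in_maximal[of D I] unfolding local_ring_def by blast

section \<open>Two-dimensional regular local rings through a regular system of parameters\<close>

text \<open>An elementary presentation: $x$ is a prime element, $D/xD$ is a discrete valuation ring with
  uniformizer $y$, and every prime other than $0$ and the maximal ideal is principal.\<close>

locale rlr2 =
  fixes D :: "'a::field set" and x y :: 'a
  assumes subring: "subring D"
    and xD: "x \<in> D" and yD: "y \<in> D" and x_nonzero: "x \<noteq> 0"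
    and one_notin: "1 \<notin> lin D x y"
    and unit: "d \<in> D \<Longrightarrow> d \<notin> lin D x y \<Longrightarrow> inverse d \<in> D"
    and x_prime: "a \<in> D \<Longrightarrow> b \<in> D \<Longrightarrow> a * b \<in> princ D x \<Longrightarrow> a \<in> princ D x \<or> b \<in> princ D x"
    and y_notin: "y \<notin> princ D x"
    and disc: "a \<in> D \<Longrightarrow> a \<notin> princ D x \<Longrightarrow>
      \<exists>u\<in>D. \<exists>k. \<exists>c\<in>D. u \<notin> lin D x y \<and> a = u * y ^ k + x * c"
    and separated: "a \<in> D \<Longrightarrow> a \<noteq> 0 \<Longrightarrow> \<exists>k. \<exists>b\<in>D. b \<notin> princ D x \<and> a = x ^ k * b"
    and primes: "prime_ideal D P \<Longrightarrow> P = {0} \<or> P = lin D x y \<or> (\<exists>g\<in>D. P = princ D g)"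

lemma unit_one_minus:
  assumes "subring D" "x \<in> D" "y \<in> D" "1 \<notin> lin D x y"
    and unit: "\<And>d. d \<in> D \<Longrightarrow> d \<notin> lin D x y \<Longrightarrow> inverse d \<in> D"
    and c: "c \<in> lin D x y" "a \<in> D"
  shows "1 - c * a \<noteq> 0 \<and> inverse (1 - c * a) \<in> D"
proof -
  note M = is_ideal_lin[OF assms(1-3)]
  have ca: "c * a \<in> lin D x y" using is_ideal_mult2[OF M] c by blast
  have n: "1 - c * a \<notin> lin D x y"
  proof
    assume "1 - c * a \<in> lin D x y"
    from is_ideal_add[OF M this ca] show False using assms(4) by simp
  qed
  have "1 - c * a \<in> D"
    using ca is_ideal_subset[OF M] subring_one[OF assms(1)] subring_diff[OF assms(1)] by blast
  then show ?thesis using unit n is_ideal_zero[OF M] by auto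
qed

text \<open>The ideals \<open>J k = xD + y^k D\<close> descend. An element that leaves them at some
  stage is a unit times a power of \<open>y\<close> modulo \<open>x\<close>; that the intersection
  of all of them lies in \<open>xD\<close> is Nakayama's lemma for multiplication by
  \<open>y\<close>.\<close>

lemma mod_x_dichotomy:
  assumes D: "subring D" and xD: "x \<in> D" and yD: "y \<in> D" and one: "1 \<notin> lin D x y"
    and unit: "\<And>d. d \<in> D \<Longrightarrow> d \<notin> lin D x y \<Longrightarrow> inverse d \<in> D"
    and noeth: "noetherian D" and a: "a \<in> D" "a \<notin> princ D x"
  shows "\<exists>u\<in>D. \<exists>k. \<exists>c\<in>D. u \<notin> lin D x y \<and> a = u * y ^ k + x * c"
proof -
  note M = is_ideal_lin[OF D xD yD]
  note cl = subring_closed[OF D]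
  define J where "J k = {i + b * y ^ k | i b. i \<in> princ D x \<and> b \<in> D}" for k
  have J: "is_ideal D (J k)" for k
    unfolding J_def by (intro is_ideal_insert[OF D is_ideal_princ[OF D xD]] cl yD)
  define I where "I = (\<Inter>k. J k)"
  have I: "is_ideal D I"
    unfolding I_def by (rule is_ideal_INT[OF J])
  have peel: "a \<in> J k \<or> (\<exists>u\<in>D. \<exists>j. \<exists>c\<in>D. u \<notin> lin D x y \<and> a = u * y ^ j + x * c)"
    if "a \<in> D" for a k
  proof (induction k)
    case 0
    have "a = 0 + a * y ^ 0" by simp
    then show ?case
      using that is_ideal_zero[OF is_ideal_princ[OF D xD]] unfolding J_def by blast
  next
    case (Suc k)
    then show ?case
    proof
      assume "a \<in> J k"
      then obtain c b where cb: "c \<in> D" "b \<in> D" and aeq: "a = x * c + b * y ^ k"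
        by (auto simp: J_def elim: princE)
      show ?case
      proof (cases "b \<in> lin D x y")
        case True
        then obtain p q where pq: "p \<in> D" "q \<in> D" "b = p * x + q * y" by (auto elim: linE)
        have "a = x * (c + p * y ^ k) + q * y ^ Suc k"
          using aeq pq by (simp add: algebra_simps)
        moreover have "x * (c + p * y ^ k) \<in> princ D x"
          using cb pq yD by (intro princI cl)
        ultimately show ?thesis using pq unfolding J_def by blast
      next
        case False
        then show ?thesis using cb aeq by (metis add.commute)
      qed
    qed auto
  qed
  show ?thesis
  proof (cases "a \<in> I")
    case False
    then show ?thesis using peel[OF a(1)] unfolding I_def by blast
  next
    case True
    \<comment> \<open>Otherwise \<open>J n\<close> would equal \<open>xD\<close> and
      \<open>a\<close>, which lies in every \<open>J n\<close>, would be a multiple of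
      \<open>x\<close>.\<close>
    have nonnil: "y ^ n \<notin> princ D x" for n
    proof
      assume yn: "y ^ n \<in> princ D x"
      have "a \<in> J n" using True by (auto simp: I_def)
      then obtain i b where "i \<in> princ D x" "b \<in> D" "a = i + b * y ^ n" by (auto simp: J_def)
      then show False
        using a(2) yn is_ideal_princ[OF D xD] is_ideal_add is_ideal_mult by blast
    qed
    obtain G where G: "finite G" "G \<subseteq> I" "I = ideal_gen D G"
      using noeth I unfolding noetherian_def by blast
    have "I \<subseteq> princ D x"
    proof (rule nakayama[OF D I is_ideal_princ[OF D xD] G yD])
      fix a assume "a \<in> D"
      then show "1 - y * a \<noteq> 0 \<and> inverse (1 - y * a) \<in> D"
        using unit_one_minus[OF D xD yD one unit] lin_gens(2)[OF D] by blast
    next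
      fix z assume z: "z \<in> I"
      then have "z \<in> J 1" by (auto simp: I_def)
      then obtain n b where nb: "n \<in> princ D x" "b \<in> D" "z = n + y * b"
        by (auto simp: J_def mult.commute)
      \<comment> \<open>If \<open>b\<close> stops at order \<open>j\<close>, then
        \<open>z = n + y * b\<close> has order \<open>j + 1\<close> modulo \<open>x\<close>; but
        \<open>z\<close> lies in \<open>J (j + 2)\<close>, so a unit times \<open>y ^ Suc j\<close>
        would be in \<open>xD\<close>.\<close>
      have "b \<in> J k" for k
      proof (rule ccontr)
        assume "b \<notin> J k"
        then obtain u j c where u: "u \<in> D" "u \<notin> lin D x y" and c: "c \<in> D"
          and beq: "b = u * y ^ j + x * c" using peel[OF nb(2)] by blast
        have "z \<in> J (Suc (Suc j))" using z by (auto simp: I_def)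
        then obtain m d where md: "m \<in> princ D x" "d \<in> D" "z = m + d * y ^ Suc (Suc j)"
          by (auto simp: J_def)
        have u': "u - d * y \<notin> lin D x y"
        proof
          assume "u - d * y \<in> lin D x y"
          from is_ideal_add[OF M this is_ideal_mult[OF M md(2) lin_gens(2)[OF D]]]
          show False using u by simp
        qed
        have "u - d * y \<in> D" using u md yD by (intro cl)
        then have inv: "inverse (u - d * y) \<in> D" "u - d * y \<noteq> 0"
          using unit[OF _ u'] u' is_ideal_zero[OF M] by metis+
        have "(u - d * y) * y ^ Suc j = m - n - x * (c * y)"
          using nb(3) md(3) beq by (simp add: algebra_simps)
        also have "\<dots> \<in> princ D x"
          using nb md c yD by (intro is_ideal_diff[OF D is_ideal_princ[OF D xD]] princI cl)
        finally have "inverse (u - d * y) * ((u - d * y) * y ^ Suc j) \<in> princ D x"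
          using inv is_ideal_mult[OF is_ideal_princ[OF D xD]] by blast
        moreover have "inverse (u - d * y) * ((u - d * y) * y ^ Suc j) = y ^ Suc j"
          using inv(2) by (simp add: mult.assoc[symmetric] del: power_Suc)
        ultimately show False using nonnil by metis
      qed
      then show "\<exists>n\<in>princ D x. \<exists>i\<in>I. z = n + y * i" using nb by (auto simp: I_def)
    qed
    then show ?thesis using a True by blast
  qed
qed

text \<open>Among the elements of a prime not containing $x$, one with minimal $y$-order modulo $x$
  generates.\<close>

lemma prime_principal:
  assumes D: "subring D" and xD: "x \<in> D" and yD: "y \<in> D" and one: "1 \<notin> lin D x y"
    and unit: "\<And>d. d \<in> D \<Longrightarrow> d \<notin> lin D x y \<Longrightarrow> inverse d \<in> D"
    and noeth: "noetherian D" and P: "prime_ideal D P" and xP: "x \<notin> P"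
  shows "\<exists>g\<in>P. P = princ D g"
proof -
  note M = is_ideal_lin[OF D xD yD]
  note cl = subring_closed[OF D]
  note PI = prime_ideal_ideal[OF P]
  obtain G where G: "finite G" "G \<subseteq> P" "P = ideal_gen D G"
    using noeth PI unfolding noetherian_def by blast
  \<comment> \<open>As \<open>x\<close> is not in the prime \<open>P\<close>, an element of
    \<open>P\<close> that is a multiple of \<open>x\<close> has its cofactor in \<open>P\<close>. So
    congruence to \<open>N\<close> modulo \<open>xD\<close> is already congruence modulo
    \<open>xP\<close>, and Nakayama's lemma applies.\<close>
  have nak: "P \<subseteq> N" if "is_ideal D N" and dec: "\<And>z. z \<in> P \<Longrightarrow> \<exists>n\<in>N. \<exists>c\<in>D. z = n + x * c"
    and NP: "N \<subseteq> P" for N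
  proof (rule nakayama[OF D PI that(1) G xD])
    fix a assume "a \<in> D"
    then show "1 - x * a \<noteq> 0 \<and> inverse (1 - x * a) \<in> D"
      using unit_one_minus[OF D xD yD one unit] lin_gens(1)[OF D] by blast
  next
    fix z assume z: "z \<in> P"
    then obtain n c where nc: "n \<in> N" "c \<in> D" "z = n + x * c" using dec by blast
    have "x * c = z - n" using nc by simp
    also have "\<dots> \<in> P" using z nc NP is_ideal_diff[OF D PI] by blast
    finally have "c \<in> P" using prime_ideal_cases[OF P xD nc(2)] xP by blast
    then show "\<exists>n\<in>N. \<exists>i\<in>P. z = n + x * i" using nc by blast
  qed
  define Q where "Q k \<longleftrightarrow> (\<exists>g\<in>P. \<exists>u\<in>D. \<exists>c\<in>D. u \<notin> lin D x y \<and> g = u * y ^ k + x * c)" for k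
  show ?thesis
  proof (cases "\<exists>k. Q k")
    case False
    \<comment> \<open>No element of \<open>P\<close> has a finite order, so \<open>P\<close> lies in
      \<open>xD\<close>, whence \<open>P = xP\<close>; the generator is 0.\<close>
    have "P \<subseteq> {0}"
    proof (rule nak)
      show "is_ideal D {0}" using is_ideal_ideal_gen[OF D, of "{}"] by (simp add: ideal_gen_empty)
      show "{0} \<subseteq> P" using is_ideal_zero[OF PI] by simp
      fix z assume z: "z \<in> P"
      have "z \<in> D" using z is_ideal_subset[OF PI] by blast
      then have "z \<in> princ D x"
        using mod_x_dichotomy[OF D xD yD one unit noeth] False z unfolding Q_def by blast
      then show "\<exists>n\<in>{0}. \<exists>c\<in>D. z = n + x * c" by (auto elim: princE)
    qed
    then have "P = princ D 0" "0 \<in> P"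
      using is_ideal_zero[OF PI] subring_zero[OF D] by (auto simp: princ_def)
    then show ?thesis by blast
  next
    case True
    define k where "k = (LEAST k. Q k)"
    have "Q k" using True unfolding k_def by (metis LeastI)
    then obtain g u c where g: "g \<in> P" "u \<in> D" "u \<notin> lin D x y" "c \<in> D"
      and geq: "g = u * y ^ k + x * c" by (auto simp: Q_def)
    have gD: "g \<in> D" using g is_ideal_subset[OF PI] by blast
    have uinv: "inverse u \<in> D" "u \<noteq> 0"
      using unit g is_ideal_zero[OF M] by auto
    have sub: "princ D g \<subseteq> P" using g is_ideal_mult2[OF PI] by (auto simp: princ_def)
    have "P \<subseteq> princ D g"
    proof (rule nak[OF is_ideal_princ[OF D gD] _ sub])
      fix z assume z: "z \<in> P"
      have zD: "z \<in> D" using z is_ideal_subset[OF PI] by blast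
      show "\<exists>n\<in>princ D g. \<exists>c\<in>D. z = n + x * c"
      proof (cases "z \<in> princ D x")
        case True
        then obtain d where "d \<in> D" "z = g * 0 + x * d" by (auto elim: princE)
        then show ?thesis using princI[OF subring_zero[OF D]] by metis
      next
        case False
        then obtain v j e where v: "v \<in> D" "v \<notin> lin D x y" "e \<in> D" and zeq: "z = v * y ^ j + x * e"
          using mod_x_dichotomy[OF D xD yD one unit noeth zD] by blast
        have "Q j" using v z zeq by (auto simp: Q_def)
        then have "k \<le> j" unfolding k_def by (rule Least_le)
        then have yj: "y ^ j = y ^ (j - k) * y ^ k" by (simp add: power_add[symmetric])
        define r where "r = v * inverse u * y ^ (j - k)"
        have r: "r \<in> D" using v uinv yD by (auto simp: r_def intro!: cl)
        have "r * u = v * y ^ (j - k)" using uinv by (simp add: r_def)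
        then have "v * y ^ j = r * u * y ^ k" unfolding yj by (simp add: mult.assoc)
        then have "z = g * r + x * (e - r * c)"
          using zeq geq by (simp add: algebra_simps)
        moreover have "e - r * c \<in> D" using v r g by (auto intro!: cl)
        ultimately show ?thesis using princI[OF r] by blast
      qed
    qed
    then show ?thesis using g sub by blast
  qed
qed

text \<open>Turns a hypothetical relation that \<open>y ^ n\<close> is a multiple of
  \<open>x\<close> into the same relation for the \<open>n\<close>-th power of any element of the
  maximal ideal.\<close>

lemma power_sum_mod:
  assumes D: "subring D" and "p \<in> D" "q \<in> D" "x \<in> D" "y \<in> D"
  shows "\<exists>c\<in>D. \<exists>d\<in>D. (p * x + q * y) ^ n = x * c + y ^ n * d"
proof (induction n)
  case 0
  have "(p * x + q * y) ^ 0 = x * 0 + y ^ 0 * 1" by simp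
  then show ?case using subring_zero[OF D] subring_one[OF D] by blast
next
  case (Suc n)
  then obtain c d where cd: "c \<in> D" "d \<in> D" and eq: "(p * x + q * y) ^ n = x * c + y ^ n * d" by blast
  have "(p * x + q * y) ^ Suc n = x * (p * (x * c + y ^ n * d) + q * y * c) + y ^ Suc n * (q * d)"
    unfolding power_Suc eq by (simp add: algebra_simps)
  moreover have "p * (x * c + y ^ n * d) + q * y * c \<in> D" "q * d \<in> D"
    using cd assms by (auto intro!: subring_closed[OF D])
  ultimately show ?case by blast
qed

text \<open>Dimension two enters through a prime \<open>p\<close> strictly between 0 and the maximal
  ideal. It shows that no power of \<open>y\<close> lies in \<open>xD\<close>; with the dichotomy
  modulo \<open>x\<close> this makes \<open>D/xD\<close> a discrete valuation ring, and the
  remaining axioms follow.\<close>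

lemma rlr2_of_regular:
  assumes reg: "regular_local_2 D" and max: "maximal_ideal D (lin D x y)"
  shows "rlr2 D x y"
proof -
  have loc: "local_ring D" and noeth: "noetherian D" and dim: "krull_dim_eq D 2"
    using reg by (auto simp: regular_local_2_def)
  have D: "subring D" using loc by (simp add: local_ring_def)
  note cl = subring_closed[OF D]
  have M: "is_ideal D (lin D x y)" using max by (simp add: maximal_ideal_def)
  have xD: "x \<in> D" and yD: "y \<in> D" using lin_gens[OF D] is_ideal_subset[OF M] by blast+
  have one: "1 \<notin> lin D x y" using maximal_ideal_one[OF max] .
  note unit = local_ring_unit[OF loc max]
  have disc: "\<exists>u\<in>D. \<exists>k. \<exists>c\<in>D. u \<notin> lin D x y \<and> a = u * y ^ k + x * c"
    if "a \<in> D" "a \<notin> princ D x" for a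
    using mod_x_dichotomy[OF D xD yD one unit noeth] that by blast
  \<comment> \<open>The middle term of a chain of three primes: nonzero because it is strictly above
    another prime, and not above the maximal ideal because the third term is still contained in
    that.\<close>
  obtain p where p: "prime_ideal D p" "p \<noteq> {0}" "\<not> lin D x y \<subseteq> p"
  proof -
    obtain P where P: "\<forall>i\<le>2. prime_ideal D (P i)" "\<forall>i<2. P i \<subset> P (Suc i)"
      using dim unfolding krull_dim_eq_def has_prime_chain_def by blast
    have "0 \<in> P 0" using P(1) prime_ideal_ideal is_ideal_zero by blast
    moreover have P01: "P 0 \<subset> P 1" "P 1 \<subset> P 2"
      using P(2) by (auto simp: numeral_2_eq_2)
    ultimately have "P 1 \<noteq> {0}" by (auto simp: psubset_eq)
    moreover have "P 2 \<subseteq> lin D x y"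
      using P(1) proper_ideal_in_maximal_local[OF loc max] prime_ideal_ideal prime_ideal_one
      by blast
    ultimately show ?thesis using that[of "P 1"] P(1) P01 by auto
  qed
  note pI = prime_ideal_ideal[OF p(1)]
  have xyp: "\<not> (x \<in> q \<and> y \<in> q)" if "\<not> lin D x y \<subseteq> q" "is_ideal D q" for q
  proof
    assume "x \<in> q \<and> y \<in> q"
    then have "lin D x y \<subseteq> q"
      using is_ideal_add[OF that(2)] is_ideal_mult[OF that(2)] by (auto simp: lin_def)
    with that(1) show False by blast
  qed
  have nonnil: "y ^ n \<notin> princ D x" for n
  proof
    assume yn: "y ^ n \<in> princ D x"
    have xp: "x \<notin> p"
    proof
      assume "x \<in> p"
      then have "y ^ n \<in> p" using yn is_ideal_mult2[OF pI] by (auto elim!: princE)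
      then show False
        using prime_ideal_power[OF D p(1) yD] xyp[OF p(3) pI] \<open>x \<in> p\<close> by blast
    qed
    obtain g where g: "g \<in> p" "p = princ D g"
      using prime_principal[OF D xD yD one unit noeth p(1) xp] by blast
    have gD: "g \<in> D" using g is_ideal_subset[OF pI] by blast
    have "g \<noteq> 0" using p(2) g is_ideal_zero[OF pI] by (auto simp: princ_def)
    have "p \<subseteq> lin D x y"
      using proper_ideal_in_maximal_local[OF loc max pI prime_ideal_one[OF p(1)]] .
    then obtain a b where "a \<in> D" "b \<in> D" "g = a * x + b * y"
      using g(1) unfolding lin_def by blast
    then obtain c d where cd: "c \<in> D" "d \<in> D" "g ^ n = x * c + y ^ n * d"
      using power_sum_mod[OF D _ _ xD yD] by blast
    have "g ^ n \<in> princ D x"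
      unfolding cd(3)
      using cd yn is_ideal_add[OF is_ideal_princ[OF D xD]] is_ideal_mult2[OF is_ideal_princ[OF D xD]]
        princI by blast
    \<comment> \<open>From \<open>x * e = g ^ Suc m\<close> and \<open>x\<close> outside
      \<open>p = gD\<close> the factor \<open>e\<close> is a multiple of \<open>g\<close>;
      cancelling \<open>g\<close> again and again ends with \<open>1 = x * e\<close>, which is
      impossible.\<close>
    moreover have "g ^ m \<notin> princ D x" for m
    proof
      assume "g ^ m \<in> princ D x"
      then obtain e where "e \<in> D" "g ^ m = x * e" by (auto elim: princE)
      then show False
      proof (induction m arbitrary: e)
        case 0
        then have "1 \<in> lin D x y"
          using is_ideal_mult2[OF M] lin_gens(1)[OF D] by (metis power_0)
        with one show False ..
      next
        case (Suc m)
        have "x * e \<in> p" using Suc.prems g(1) gD is_ideal_mult2[OF pI] cl(7)[OF gD, of m]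
          by (metis power_Suc)
        then have "e \<in> p" using prime_ideal_cases[OF p(1) xD Suc.prems(1)] xp by blast
        then obtain e' where "e' \<in> D" "e = g * e'" using g by (auto elim: princE)
        then show False using Suc.IH[of e'] Suc.prems \<open>g \<noteq> 0\<close> by auto
      qed
    qed
    ultimately show False by blast
  qed
  have y_notin: "y \<notin> princ D x" using nonnil[of 1] by simp
  have unit_notin: "w * y ^ k + x * c \<notin> princ D x" if "w \<in> D" "w \<notin> lin D x y" "c \<in> D" for w c k
  proof
    assume "w * y ^ k + x * c \<in> princ D x"
    from is_ideal_diff[OF D is_ideal_princ[OF D xD] this princI[OF that(3)]]
    have "w * y ^ k \<in> princ D x" by simp
    from is_ideal_mult[OF is_ideal_princ[OF D xD] unit[OF that(1,2)] this]
    have "(inverse w * w) * y ^ k \<in> princ D x" by (simp add: mult.assoc)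
    moreover have "w \<noteq> 0" using that is_ideal_zero[OF M] by auto
    ultimately show False using nonnil[of k] by simp
  qed
  have M_prime: "a * b \<notin> lin D x y" if "a \<in> D" "b \<in> D" "a \<notin> lin D x y" "b \<notin> lin D x y" for a b
  proof
    assume "a * b \<in> lin D x y"
    from is_ideal_mult[OF M unit[OF that(1,3)] this]
    have "(inverse a * a) * b \<in> lin D x y" by (simp add: mult.assoc)
    moreover have "a \<noteq> 0" using that is_ideal_zero[OF M] by auto
    ultimately show False using that by simp
  qed
  have x_nonzero: "x \<noteq> 0"
  proof
    assume "x = 0"
    then have "x \<in> p" using is_ideal_zero[OF pI] by simp
    then have yp: "y \<notin> p" using xyp[OF p(3) pI] by blast
    obtain a where a: "a \<in> p" "a \<noteq> 0" using p(2) is_ideal_zero[OF pI] by blast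
    then have aD: "a \<in> D" "a \<notin> princ D x"
      using is_ideal_subset[OF pI] \<open>x = 0\<close> by (auto simp: princ_def)
    then obtain w k c where w: "w \<in> D" "w \<notin> lin D x y" "a = w * y ^ k + x * c" using disc by blast
    then have "inverse w * a = y ^ k" using \<open>x = 0\<close> is_ideal_zero[OF M] by (auto simp: field_simps)
    then have "y ^ k \<in> p" using is_ideal_mult[OF pI unit[OF w(1,2)] a(1)] by simp
    then show False using prime_ideal_power[OF D p(1) yD] yp by blast
  qed
  show ?thesis
  proof
    show "subring D" "x \<in> D" "y \<in> D" "1 \<notin> lin D x y" "y \<notin> princ D x" "x \<noteq> 0" by fact+
    show "inverse d \<in> D" if "d \<in> D" "d \<notin> lin D x y" for d using unit that .
    show "\<exists>u\<in>D. \<exists>k. \<exists>c\<in>D. u \<notin> lin D x y \<and> a = u * y ^ k + x * c" if "a \<in> D" "a \<notin> princ D x" for a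
      using disc that .
    show "a \<in> princ D x \<or> b \<in> princ D x" if ab: "a \<in> D" "b \<in> D" "a * b \<in> princ D x" for a b
    proof (rule ccontr)
      assume "\<not> (a \<in> princ D x \<or> b \<in> princ D x)"
      then obtain w k c w' k' c' where w: "w \<in> D" "w \<notin> lin D x y" "c \<in> D" "w' \<in> D"
        "w' \<notin> lin D x y" "c' \<in> D" and eq: "a = w * y ^ k + x * c" "b = w' * y ^ k' + x * c'"
        using disc[OF ab(1)] disc[OF ab(2)] by blast
      have "a * b = (w * w') * y ^ (k + k') + x * (w * y ^ k * c' + c * (w' * y ^ k' + x * c'))"
        unfolding eq by (simp add: algebra_simps power_add)
      moreover have "w * y ^ k * c' + c * (w' * y ^ k' + x * c') \<in> D"
        using w xD yD by (intro cl)
      ultimately show False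
        using unit_notin[of "w * w'"] M_prime w ab(3) cl(5) by metis
    qed
    show "P = {0} \<or> P = lin D x y \<or> (\<exists>g\<in>D. P = princ D g)" if P: "prime_ideal D P" for P
    proof -
      note PI = prime_ideal_ideal[OF P]
      consider "x \<notin> P" | "lin D x y \<subseteq> P" | "x \<in> P" "y \<notin> P" using xyp[OF _ PI] by blast
      then show ?thesis
      proof cases
        case 1
        then show ?thesis
          using prime_principal[OF D xD yD one unit noeth P] is_ideal_subset[OF PI] by blast
      next
        case 2
        then show ?thesis
          using proper_ideal_in_maximal_local[OF loc max PI prime_ideal_one[OF P]] by blast
      next
        case 3
        have "P \<subseteq> princ D x"
        proof
          fix a assume a: "a \<in> P"
          show "a \<in> princ D x"
          proof (rule ccontr)
            assume "a \<notin> princ D x"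
            then obtain w k c where w: "w \<in> D" "w \<notin> lin D x y" "c \<in> D" "a = w * y ^ k + x * c"
              using disc a is_ideal_subset[OF PI] by blast
            have "w * y ^ k = a - x * c" using w by simp
            also have "\<dots> \<in> P" using a 3 w is_ideal_diff[OF D PI] is_ideal_mult2[OF PI] by blast
            finally have "inverse w * (w * y ^ k) \<in> P"
              using is_ideal_mult[OF PI unit[OF w(1,2)]] by blast
            moreover have "w \<noteq> 0" using w is_ideal_zero[OF M] by auto
            ultimately have "y ^ k \<in> P" by (simp add: mult.assoc[symmetric])
            then show False using prime_ideal_power[OF D P yD] 3 by blast
          qed
        qed
        moreover have "princ D x \<subseteq> P" using 3 is_ideal_mult2[OF PI] by (auto simp: princ_def)
        ultimately show ?thesis using xD by blast
      qed
    qed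
    show "\<exists>k. \<exists>b\<in>D. b \<notin> princ D x \<and> a = x ^ k * b" if a: "a \<in> D" "a \<noteq> 0" for a
    proof -
      \<comment> \<open>Krull's intersection theorem for the powers of \<open>x\<close>: since
        \<open>x\<close> can be cancelled, \<open>I = xI\<close>, and Nakayama's lemma gives
        \<open>I = 0\<close>.\<close>
      define I where "I = (\<Inter>k. princ D (x ^ k))"
      have I: "is_ideal D I"
        unfolding I_def by (rule is_ideal_INT[OF is_ideal_princ[OF D cl(7)[OF xD]]])
      obtain G where G: "finite G" "G \<subseteq> I" "I = ideal_gen D G"
        using noeth I unfolding noetherian_def by blast
      have "I \<subseteq> {0}"
      proof (rule nakayama[OF D I _ G xD])
        show "is_ideal D {0}" using is_ideal_ideal_gen[OF D, of "{}"] by (simp add: ideal_gen_empty)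
        show "1 - x * a \<noteq> 0 \<and> inverse (1 - x * a) \<in> D" if "a \<in> D" for a
          using unit_one_minus[OF D xD yD one unit] lin_gens(1)[OF D] that by blast
        fix z assume z: "z \<in> I"
        then have "z \<in> princ D (x ^ 1)" unfolding I_def by blast
        then obtain b where b: "b \<in> D" "z = x * b" by (auto elim: princE)
        have "b \<in> princ D (x ^ k)" for k
        proof -
          have "z \<in> princ D (x ^ Suc k)" using z unfolding I_def by blast
          then obtain d where "d \<in> D" "z = x ^ Suc k * d" by (auto elim: princE)
          then have "b = x ^ k * d" using b x_nonzero by simp
          then show ?thesis using \<open>d \<in> D\<close> princI by blast
        qed
        then show "\<exists>n\<in>{0}. \<exists>i\<in>I. z = n + x * i" using b by (auto simp: I_def)
      qed
      then have "\<exists>k. a \<notin> princ D (x ^ k)" using a(2) unfolding I_def by blast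
      then obtain k where k: "a \<notin> princ D (x ^ k)" "\<And>j. j < k \<Longrightarrow> a \<in> princ D (x ^ j)"
        using exists_least_iff[of "\<lambda>k. a \<notin> princ D (x ^ k)"] by blast
      have "k \<noteq> 0" using k(1) a(1) by (auto simp: princ_def intro: ccontr)
      then obtain j where j: "k = Suc j" using not0_implies_Suc by blast
      then obtain b where b: "b \<in> D" "a = x ^ j * b" using k(2)[of j] by (auto elim: princE)
      have "b \<notin> princ D x"
      proof
        assume "b \<in> princ D x"
        then obtain d where "d \<in> D" "b = x * d" by (auto elim: princE)
        then have "a = x ^ k * d" using b j by simp
        then show False using k(1) \<open>d \<in> D\<close> princI by blast
      qed
      then show ?thesis using b by blast
    qed
  qed
qed

section \<open>Cohen's criterion for noetherian rings\<close>

lemma gens_in_ideal_gen: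
  assumes "subring D" "finite G" "g \<in> G" "G \<subseteq> D"
  shows "g \<in> ideal_gen D G"
proof -
  have G: "G = insert g (G - {g})" "finite (G - {g})" "g \<notin> G - {g}" using assms by auto
  have "0 \<in> ideal_gen D (G - {g})"
    using is_ideal_zero[OF is_ideal_ideal_gen[OF assms(1) G(2)]] assms(4) by blast
  moreover have "g = 0 + 1 * g" by simp
  ultimately have "g \<in> ideal_gen D (insert g (G - {g}))"
    unfolding ideal_gen_insert[OF G(2,3)] using subring_one[OF assms(1)] by blast
  then show ?thesis using G(1) by simp
qed

lemma ideal_gen_subset:
  assumes "is_ideal D I" "finite G" "G \<subseteq> I"
  shows "ideal_gen D G \<subseteq> I"
  using assms(2,3)
proof (induction G rule: finite_induct)
  case empty
  then show ?case using is_ideal_zero[OF assms(1)] by (simp add: ideal_gen_empty)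
next
  case (insert g G)
  then show ?case
    using is_ideal_add[OF assms(1)] is_ideal_mult[OF assms(1)]
    unfolding ideal_gen_insert[OF insert.hyps] by blast
qed

text \<open>An ideal \<open>I\<close> maximal among those that are not finitely generated is prime.
  If \<open>a * b\<close> is in \<open>I\<close> and neither factor is, then
  \<open>K = I + aD\<close> and the colon ideal \<open>J = (I : a)\<close> are strictly larger,
  hence finitely generated, and \<open>I\<close> is generated by the \<open>I\<close>-components of
  generators of \<open>K\<close> together with \<open>a\<close> times generators of
  \<open>J\<close>. The criterion suits quadratic transforms, whose primes are known
  explicitly.\<close>

theorem cohen_noetherian:
  assumes D: "subring D"
    and primes: "\<And>P. prime_ideal D P \<Longrightarrow> \<exists>G. finite G \<and> G \<subseteq> P \<and> P = ideal_gen D G"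
  shows "noetherian D"
proof (rule ccontr)
  define fg where "fg I \<longleftrightarrow> (\<exists>G. finite G \<and> G \<subseteq> I \<and> I = ideal_gen D G)" for I
  define \<A> where "\<A> = {I. is_ideal D I \<and> \<not> fg I}"
  assume "\<not> noetherian D"
  then have ne: "\<A> \<noteq> {}" by (auto simp: noetherian_def \<A>_def fg_def)
  have "\<exists>M\<in>\<A>. \<forall>X\<in>\<A>. M \<subseteq> X \<longrightarrow> X = M"
  proof (rule subset_Zorn_nonempty[OF ne])
    fix \<C> assume C: "\<C> \<noteq> {}" "subset.chain \<A> \<C>"
    then have sub: "\<C> \<subseteq> \<A>" by (auto simp: subset.chain_def)
    have ideal: "is_ideal D (\<Union>\<C>)"
      using C sub by (intro is_ideal_Union_chain) (auto simp: subset.chain_def \<A>_def)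
    have "\<not> fg (\<Union>\<C>)"
    proof
      assume "fg (\<Union>\<C>)"
      then obtain G where G: "finite G" "G \<subseteq> \<Union>\<C>" "\<Union>\<C> = ideal_gen D G" by (auto simp: fg_def)
      then obtain I where I: "I \<in> \<C>" "G \<subseteq> I"
        using finite_subset_Union_chain[OF G(1,2) C] by blast
      then have "ideal_gen D G \<subseteq> I" using ideal_gen_subset[OF _ G(1)] sub by (auto simp: \<A>_def)
      then have "I = ideal_gen D G" using I(1) G(3) by blast
      then have "fg I" using G(1) I(2) by (auto simp: fg_def)
      then show False using I(1) sub by (auto simp: \<A>_def)
    qed
    then show "\<Union>\<C> \<in> \<A>" using ideal by (simp add: \<A>_def)
  qed
  then obtain I where I: "is_ideal D I" "\<not> fg I"
    and max: "\<And>J. is_ideal D J \<Longrightarrow> I \<subset> J \<Longrightarrow> fg J"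
    unfolding \<A>_def by blast
  have one: "I \<noteq> D"
  proof
    assume "I = D"
    have "ideal_gen D {1} = D"
      using gens_in_ideal_gen[OF D, of "{1}" 1] subring_one[OF D]
        is_ideal_eq_ring[OF is_ideal_ideal_gen[OF D, of "{1}"]] by auto
    then have "fg I" using \<open>I = D\<close> subring_one[OF D] unfolding fg_def
      by (intro exI[of _ "{1}"]) auto
    with I(2) show False ..
  qed
  have "a \<in> I \<or> b \<in> I" if ab: "a \<in> D" "b \<in> D" "a * b \<in> I" for a b
  proof (rule ccontr)
    assume n: "\<not> (a \<in> I \<or> b \<in> I)"
    define K where "K = {i + r * a | i r. i \<in> I \<and> r \<in> D}"
    define J where "J = {d \<in> D. d * a \<in> I}"
    have K: "is_ideal D K" unfolding K_def by (rule is_ideal_insert[OF D I(1) ab(1)])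
    have "i \<in> K" if "i \<in> I" for i
    proof -
      have "i = i + 0 * a" by simp
      then show ?thesis unfolding K_def using that subring_zero[OF D] by blast
    qed
    moreover have "a \<in> K"
    proof -
      have "a = 0 + 1 * a" by simp
      then show ?thesis unfolding K_def using is_ideal_zero[OF I(1)] subring_one[OF D] by blast
    qed
    ultimately have "I \<subset> K" using n by blast
    then obtain G where G: "finite G" "G \<subseteq> K" "K = ideal_gen D G" using max[OF K] fg_def by auto
    have colon: "is_ideal D {d \<in> D. d * a \<in> L}" if L: "is_ideal D L" for L
      unfolding is_ideal_def
    proof (intro conjI ballI)
      show "0 \<in> {d \<in> D. d * a \<in> L}" using is_ideal_zero[OF L] subring_zero[OF D] by simp
      show "p + q \<in> {d \<in> D. d * a \<in> L}" if "p \<in> {d \<in> D. d * a \<in> L}" "q \<in> {d \<in> D. d * a \<in> L}" for p q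
        using that is_ideal_add[OF L] subring_add[OF D] by (auto simp: distrib_right)
      show "c * p \<in> {d \<in> D. d * a \<in> L}" if "c \<in> D" "p \<in> {d \<in> D. d * a \<in> L}" for c p
        using that is_ideal_mult[OF L] subring_mult[OF D] by (auto simp: mult.assoc)
    qed auto
    have J: "is_ideal D J" unfolding J_def by (rule colon[OF I(1)])
    have "I \<subseteq> J" using is_ideal_mult2[OF I(1) ab(1)] is_ideal_subset[OF I(1)] by (auto simp: J_def)
    moreover have "b \<in> J" using ab by (simp add: J_def mult.commute)
    ultimately have "I \<subset> J" using n by blast
    then obtain G' where G': "finite G'" "G' \<subseteq> J" "J = ideal_gen D G'" using max[OF J] fg_def by auto
    have "\<forall>g\<in>G. \<exists>i. i \<in> I \<and> (\<exists>r\<in>D. g = i + r * a)" using G(2) unfolding K_def by blast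
    then obtain h where h: "\<And>g. g \<in> G \<Longrightarrow> h g \<in> I \<and> (\<exists>r\<in>D. g = h g + r * a)" by metis
    define H where "H = h ` G \<union> (\<lambda>d. d * a) ` G'"
    have H: "finite H" "H \<subseteq> I" using G(1) G' h by (auto simp: H_def J_def)
    define L where "L = ideal_gen D H"
    have HD: "H \<subseteq> D" using H(2) is_ideal_subset[OF I(1)] by blast
    have L: "is_ideal D L" unfolding L_def using is_ideal_ideal_gen[OF D H(1) HD] .
    have HL: "z \<in> L" if "z \<in> H" for z
      unfolding L_def using gens_in_ideal_gen[OF D H(1) that HD] .
    have LI: "L \<subseteq> I" unfolding L_def using ideal_gen_subset[OF I(1) H] .
    have KL: "K \<subseteq> {l + r * a | l r. l \<in> L \<and> r \<in> D}"
      unfolding G(3)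
    proof (rule ideal_gen_subset[OF is_ideal_insert[OF D L ab(1)] G(1)], rule subsetI)
      fix g assume "g \<in> G"
      then show "g \<in> {l + r * a | l r. l \<in> L \<and> r \<in> D}"
        using h[of g] HL[of "h g"] by (auto simp: H_def)
    qed
    have JL: "J \<subseteq> {d \<in> D. d * a \<in> L}"
      unfolding G'(3)
    proof (rule ideal_gen_subset[OF colon[OF L] G'(1)], rule subsetI)
      fix g assume "g \<in> G'"
      then show "g \<in> {d \<in> D. d * a \<in> L}"
        using HL[of "g * a"] G'(2) by (auto simp: H_def J_def)
    qed
    have "I \<subseteq> L"
    proof
      fix z assume z: "z \<in> I"
      then have "z \<in> K" using \<open>I \<subset> K\<close> by blast
      then obtain l r where lr: "l \<in> L" "r \<in> D" "z = l + r * a" using KL by blast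
      have "r * a = z - l" using lr by simp
      also have "\<dots> \<in> I" using z lr(1) LI is_ideal_diff[OF D I(1)] by blast
      finally have "r * a \<in> I" .
      then have "r * a \<in> L" using JL lr(2) by (auto simp: J_def)
      then show "z \<in> L" using lr is_ideal_add[OF L] by simp
    qed
    then have "I = L" using LI by blast
    then show False using I(2) H unfolding fg_def L_def by blast
  qed
  then have "prime_ideal D I" using I(1) one by (auto simp: prime_ideal_def)
  then show False using primes I(2) unfolding fg_def by blast
qed

lemma ideal_gen_single: "ideal_gen D {g} = princ D g"
  using ideal_gen_insert[of "{}" g D] by (auto simp: ideal_gen_empty princ_def mult.commute)

text \<open>\<open>ideal_gen\<close> sums over a set, so for \<open>x = y\<close> there is a single
  summand and that case is treated apart.\<close>

lemma ideal_gen_pair: "subring D \<Longrightarrow> ideal_gen D {x, y} = lin D x y"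
proof (cases "x = y")
  case True
  assume D: "subring D"
  have "princ D y = lin D y y"
  proof (intro equalityI subsetI)
    fix z assume "z \<in> princ D y"
    then obtain d where "d \<in> D" "z = d * y + 0 * y" by (auto simp: princ_def mult.commute)
    then show "z \<in> lin D y y" using linI subring_zero[OF D] by metis
  next
    fix z assume "z \<in> lin D y y"
    then obtain a b where "a \<in> D" "b \<in> D" "z = y * (a + b)" by (auto simp: lin_def algebra_simps)
    then show "z \<in> princ D y" using princI subring_add[OF D] by metis
  qed
  then show ?thesis using True ideal_gen_single[of D y] by simp
next
  case False
  then show ?thesis
    unfolding ideal_gen_insert[of "{y}" x, simplified, OF False] ideal_gen_single
    by (auto simp: lin_def princ_def) (metis add.commute mult.commute)+
qed

section \<open>From the elementary presentation back to regular local rings\<close>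

context rlr2
begin

lemmas closed = subring_closed[OF subring]

abbreviation M where "M \<equiv> lin D x y"

lemma M_ideal: "is_ideal D M"
  by (rule is_ideal_lin[OF subring xD yD])

lemmas gens = lin_gens(1)[OF subring, of x y] lin_gens(2)[OF subring, of y x]

lemma zero_in: "0 \<in> M" by (rule is_ideal_zero[OF M_ideal])

lemma M_sub: "m \<in> M \<Longrightarrow> m \<in> D" using is_ideal_subset[OF M_ideal] by blast

lemma ideal_in_M:
  assumes "is_ideal D I" "1 \<notin> I"
  shows "I \<subseteq> M"
proof
  fix a assume a: "a \<in> I"
  show "a \<in> M"
  proof (rule ccontr)
    assume n: "a \<notin> M"
    then have "inverse a * a \<in> I"
      using a assms unit is_ideal_subset[OF assms(1)] is_ideal_mult[OF assms(1)] by blast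
    moreover have "a \<noteq> 0" using n zero_in by auto
    ultimately show False using assms(2) by simp
  qed
qed

lemma M_maximal: "maximal_ideal D M"
  unfolding maximal_ideal_def
proof (intro conjI allI impI M_ideal)
  show "M \<noteq> D" using one_notin closed(2) by blast
  fix J assume "is_ideal D J \<and> M \<subseteq> J"
  then show "J = M \<or> J = D" using ideal_in_M[of J] is_ideal_eq_ring[of D J] by blast
qed

lemma local: "local_ring D"
  unfolding local_ring_def
proof (intro conjI ex1I)
  show "maximal_ideal D M" by (rule M_maximal)
  show "N = M" if "maximal_ideal D N" for N
    using that ideal_in_M[of N] maximal_ideal_one[OF that] M_ideal one_notin closed(2)
    unfolding maximal_ideal_def by blast
qed (rule subring)

lemma M_prime: "prime_ideal D M"
  unfolding prime_ideal_def
proof (intro conjI ballI impI M_ideal)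
  show "M \<noteq> D" using one_notin closed(2) by blast
  fix a b assume ab: "a \<in> D" "b \<in> D" "a * b \<in> M"
  show "a \<in> M \<or> b \<in> M"
  proof (rule ccontr)
    assume n: "\<not> (a \<in> M \<or> b \<in> M)"
    then have "inverse a * (a * b) \<in> M" using ab unit is_ideal_mult[OF M_ideal] by blast
    moreover have "a \<noteq> 0" using n zero_in by auto
    ultimately show False using n by (simp add: mult.assoc[symmetric])
  qed
qed

lemma princ_x_prime: "prime_ideal D (princ D x)"
  unfolding prime_ideal_def
proof (intro conjI ballI impI)
  show "is_ideal D (princ D x)" by (rule is_ideal_princ[OF subring xD])
  show "princ D x \<noteq> D" using y_notin yD by blast
qed (rule x_prime)

text \<open>Bounds the dimension. If \<open>Q = hD\<close> were strictly above \<open>gD\<close>,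
  then \<open>g = h * r\<close>, and primality of \<open>gD\<close> puts \<open>h\<close> or
  \<open>r\<close> into it: the former gives equality, the latter makes \<open>h\<close> a
  unit.\<close>

lemma above_principal_prime:
  assumes g: "g \<in> D" "g \<noteq> 0" "prime_ideal D (princ D g)" and Q: "prime_ideal D Q" "princ D g \<subset> Q"
  shows "Q = M"
proof (rule ccontr)
  assume "Q \<noteq> M"
  moreover have "g \<in> Q" using Q(2) self_in_princ[OF subring] by blast
  ultimately obtain h where h: "h \<in> D" "Q = princ D h" using primes[OF Q(1)] g(2) by blast
  obtain r where r: "r \<in> D" "g = h * r" using \<open>g \<in> Q\<close> h(2) by (auto elim: princE)
  have "h * r \<in> princ D g" using r(2) self_in_princ[OF subring] by auto
  then consider "h \<in> princ D g" | "r \<in> princ D g" using prime_ideal_cases[OF g(3) h(1) r(1)] by blast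
  then show False
  proof cases
    case 1
    then have "Q \<subseteq> princ D g"
      unfolding h(2) using is_ideal_mult2[OF is_ideal_princ[OF subring g(1)]] by (auto simp: princ_def[of D h])
    then show False using Q(2) by blast
  next
    case 2
    then obtain s where s: "s \<in> D" "r = g * s" by (auto elim: princE)
    then have "g * 1 = g * (h * s)" using r by (simp add: algebra_simps)
    then have "1 = h * s" using g(2) by (simp only: mult_cancel_left) simp
    then have "1 \<in> Q" using h(2) s(1) princI by metis
    then show False using prime_ideal_one[OF Q(1)] by blast
  qed
qed

lemma zero_prime: "prime_ideal D {0}"
proof -
  have "is_ideal D {0}" using is_ideal_ideal_gen[OF subring, of "{}"] by (simp add: ideal_gen_empty)
  then show ?thesis using closed(2) by (auto simp: prime_ideal_def)
qed

text \<open>All primes are finitely generated by \<open>primes\<close>, so Cohen's criterion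
  applies. The chain from 0 through \<open>xD\<close> to \<open>M\<close> has length two; in a
  longer chain the second prime would be principal and the third already maximal.\<close>

lemma regular: "regular_local_2 D"
proof -
  have "noetherian D"
  proof (rule cohen_noetherian[OF subring])
    fix P assume P: "prime_ideal D P"
    then consider "P = {0}" | "P = M" | g where "g \<in> D" "P = princ D g" using primes by blast
    then show "\<exists>G. finite G \<and> G \<subseteq> P \<and> P = ideal_gen D G"
    proof cases
      case 1
      then show ?thesis by (intro exI[of _ "{}"]) (simp add: ideal_gen_empty)
    next
      case 2
      then show ?thesis using gens by (intro exI[of _ "{x, y}"]) (simp add: ideal_gen_pair[OF subring])
    next
      case 3
      then show ?thesis using self_in_princ[OF subring]
        by (intro exI[of _ "{g}"]) (simp add: ideal_gen_single)
    qed
  qed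
  moreover have "has_prime_chain D 2"
    unfolding has_prime_chain_def
  proof (intro exI[of _ "\<lambda>i. if i = 0 then {0} else if i = 1 then princ D x else M"] conjI allI impI)
    fix i :: nat
    show "prime_ideal D (if i = 0 then {0} else if i = 1 then princ D x else M)"
      using zero_prime princ_x_prime M_prime by simp
    assume "i < 2"
    have "{0} \<subset> princ D x"
      using self_in_princ[OF subring, of x] x_nonzero
        is_ideal_zero[OF is_ideal_princ[OF subring xD]] by blast
    moreover have "princ D x \<subset> M"
      using is_ideal_mult2[OF M_ideal _ gens(1)] gens(2) y_notin by (auto elim!: princE)
    ultimately show "(if i = 0 then {0} else if i = 1 then princ D x else M)
      \<subset> (if Suc i = 0 then {0} else if Suc i = 1 then princ D x else M)"
      using \<open>i < 2\<close> by (cases i) auto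
  qed
  moreover have "\<not> has_prime_chain D (Suc 2)"
  proof
    assume "has_prime_chain D (Suc 2)"
    then obtain P where P: "\<forall>i\<le>3. prime_ideal D (P i)" "\<forall>i<3. P i \<subset> P (Suc i)"
      unfolding has_prime_chain_def by (auto simp: numeral_3_eq_3 numeral_2_eq_2)
    have ch: "P 0 \<subset> P 1" "P 1 \<subset> P 2" "P 2 \<subset> P 3"
      using P(2)[rule_format, of 0] P(2)[rule_format, of 1] P(2)[rule_format, of 2]
      by (simp_all add: numeral_3_eq_3 numeral_2_eq_2)
    have pr: "prime_ideal D (P 0)" "prime_ideal D (P 1)" "prime_ideal D (P 2)" "prime_ideal D (P 3)"
      using P(1) by auto
    have le: "P 3 \<subseteq> M"
      using ideal_in_M[OF prime_ideal_ideal[OF pr(4)] prime_ideal_one[OF pr(4)]] .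
    have nz: "P 1 \<noteq> {0}" using ch(1) is_ideal_zero[OF prime_ideal_ideal[OF pr(1)]] by auto
    have nM: "P 1 \<noteq> M" "P 2 \<noteq> M" using ch le by auto
    obtain g where g: "g \<in> D" "P 1 = princ D g" using primes[OF pr(2)] nz nM by blast
    have "g \<noteq> 0" using nz g closed(1) by (auto simp: princ_def)
    then show False using above_principal_prime[of g "P 2"] g pr ch nM by auto
  qed
  moreover have "\<exists>a b. N = ideal_gen D {a, b}" if "maximal_ideal D N" for N
  proof -
    have "N = M" using local that M_maximal by (auto simp: local_ring_def)
    then show ?thesis using ideal_gen_pair[OF subring] by metis
  qed
  ultimately show ?thesis using local by (simp add: regular_local_2_def krull_dim_eq_def)
qed

text \<open>The axioms of \<open>rlr2\<close> single out \<open>x\<close>; the intrinsic notion does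
  not. The exchange is needed whenever \<open>y\<close> has the smaller value in
  \<open>V\<close>.\<close>

lemma swap: "rlr2 D y x"
  using rlr2_of_regular[OF regular, of y x] M_maximal by (simp add: lin_commute[of D y x])

end

section \<open>Polynomials with coefficients in a subset of the ambient field\<close>

text \<open>The coefficient set may also be an ideal: for the maximal ideal \<open>M\<close>,
  \<open>polys M\<close> consists of the polynomials that vanish over the residue field.\<close>

definition polys :: "'a::field set \<Rightarrow> 'a poly set" where
  "polys D = {p. \<forall>i. coeff p i \<in> D}"

lemma polysD: "p \<in> polys D \<Longrightarrow> coeff p i \<in> D"
  by (simp add: polys_def)

lemma is_ideal_sum: "is_ideal A I \<Longrightarrow> (\<And>i. i \<in> S \<Longrightarrow> f i \<in> I) \<Longrightarrow> sum f S \<in> I"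
  by (induction S rule: infinite_finite_induct) (auto intro: is_ideal_zero is_ideal_add)

lemma is_ideal_self: "subring D \<Longrightarrow> is_ideal D D"
  by (auto simp: is_ideal_def intro: subring_closed)

lemma polys_zero: "0 \<in> D \<Longrightarrow> 0 \<in> polys D"
  by (simp add: polys_def)

lemma polys_add: "is_ideal A I \<Longrightarrow> p \<in> polys I \<Longrightarrow> q \<in> polys I \<Longrightarrow> p + q \<in> polys I"
  by (simp add: polys_def is_ideal_add)

lemma polys_diff: "subring A \<Longrightarrow> is_ideal A I \<Longrightarrow> p \<in> polys I \<Longrightarrow> q \<in> polys I \<Longrightarrow> p - q \<in> polys I"
  by (simp add: polys_def is_ideal_diff)

lemma polys_mult: "is_ideal A I \<Longrightarrow> p \<in> polys I \<Longrightarrow> q \<in> polys A \<Longrightarrow> p * q \<in> polys I"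
  by (simp add: polys_def coeff_mult is_ideal_sum is_ideal_mult2)

lemma polys_monom: "0 \<in> D \<Longrightarrow> c \<in> D \<Longrightarrow> monom c n \<in> polys D"
  by (simp add: polys_def)

lemma polys_pCons: "c \<in> D \<Longrightarrow> p \<in> polys D \<Longrightarrow> pCons c p \<in> polys D"
  by (auto simp: polys_def coeff_pCons split: nat.split)

lemma polys_pConsD: "pCons c p \<in> polys D \<Longrightarrow> c \<in> D \<and> p \<in> polys D"
  unfolding polys_def by (auto simp: coeff_pCons split: nat.splits)

lemma polys_const: "0 \<in> D \<Longrightarrow> c \<in> D \<Longrightarrow> [:c:] \<in> polys D"
  by (intro polys_pCons polys_zero)

lemma poly_in_ideal:
  assumes "subring V" "is_ideal V I" "t \<in> V" "p \<in> polys I"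
  shows "poly p t \<in> I"
  unfolding poly_altdef
  using assms by (intro is_ideal_sum[OF assms(2)] is_ideal_mult2[OF assms(2)])
    (auto intro: subring_power polysD)

lemma poly_in_subring: "subring V \<Longrightarrow> t \<in> V \<Longrightarrow> p \<in> polys V \<Longrightarrow> poly p t \<in> V"
  using poly_in_ideal is_ideal_self by blast

lemma polys_mono: "A \<subseteq> B \<Longrightarrow> polys A \<subseteq> polys B"
  by (auto simp: polys_def)

text \<open>If \<open>i\<close> and \<open>j\<close> are the lowest positions with coefficients
  outside \<open>P\<close>, the coefficient of the product at \<open>i + j\<close> is congruent
  modulo \<open>P\<close> to the product of these two. So \<open>P[X]\<close> is a prime of
  \<open>D[X]\<close>.\<close>

lemma polys_gauss:
  assumes D: "subring D" and P: "prime_ideal D P" and p: "p \<in> polys D" and q: "q \<in> polys D"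
    and pq: "p * q \<in> polys P"
  shows "p \<in> polys P \<or> q \<in> polys P"
proof (rule ccontr)
  note I = prime_ideal_ideal[OF P]
  assume "\<not> (p \<in> polys P \<or> q \<in> polys P)"
  then have ex: "\<exists>i. coeff p i \<notin> P" "\<exists>i. coeff q i \<notin> P" by (auto simp: polys_def)
  obtain i where i: "coeff p i \<notin> P" "\<And>k. k < i \<Longrightarrow> coeff p k \<in> P"
    using ex(1) exists_least_iff[of "\<lambda>i. coeff p i \<notin> P"] by blast
  obtain j where j: "coeff q j \<notin> P" "\<And>k. k < j \<Longrightarrow> coeff q k \<in> P"
    using ex(2) exists_least_iff[of "\<lambda>i. coeff q i \<notin> P"] by blast
  have "coeff (p * q) (i + j) = (\<Sum>k\<le>i+j. coeff p k * coeff q (i + j - k))" by (rule coeff_mult)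
  also have "\<dots> = coeff p i * coeff q j
      + (\<Sum>k\<in>{..i+j}-{i}. coeff p k * coeff q (i + j - k))"
    by (subst sum.remove[of _ i]) auto
  finally have "coeff p i * coeff q j
      = coeff (p * q) (i + j) - (\<Sum>k\<in>{..i+j}-{i}. coeff p k * coeff q (i + j - k))" by simp
  also have "\<dots> \<in> P"
  proof (intro is_ideal_diff[OF D I] is_ideal_sum[OF I] polysD[OF pq])
    fix k assume "k \<in> {..i+j}-{i}"
    then consider "k < i" | "i + j - k < j" by fastforce
    then show "coeff p k * coeff q (i + j - k) \<in> P"
    proof cases
      case 1
      then show ?thesis using i(2) polysD[OF q] is_ideal_mult2[OF I] by blast
    next
      case 2
      then show ?thesis using j(2) polysD[OF p] is_ideal_mult[OF I] by blast
    qed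
  qed
  finally show False using prime_ideal_cases[OF P polysD[OF p] polysD[OF q]] i(1) j(1) by blast
qed

lemma polys_split_top:
  assumes "0 \<in> D" "p \<in> polys D" "degree p \<le> Suc n"
  obtains q where "q \<in> polys D" "degree q \<le> n" "p = q + monom (coeff p (Suc n)) (Suc n)"
proof -
  define q where "q = p - monom (coeff p (Suc n)) (Suc n)"
  have c: "coeff q i = (if i = Suc n then 0 else coeff p i)" for i by (simp add: q_def)
  have "q \<in> polys D" using assms(1,2) unfolding polys_def by (simp add: c)
  moreover have "degree q \<le> n"
    using assms(3) by (intro degree_le) (auto simp: c coeff_eq_0)
  ultimately show ?thesis using that[of q] by (simp add: q_def)
qed

text \<open>Subtraction of degrees is truncated at 0, so the bound on \<open>degree a\<close> says
  too little when \<open>degree p < degree m\<close>; the last clause covers that case. Together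
  they control multiplicities later.\<close>

lemma polys_divide_monic:
  assumes D: "subring D" and m: "m \<in> polys D" "lead_coeff m = 1" "degree m > 0"
    and "p \<in> polys D"
  shows "\<exists>a\<in>polys D. \<exists>r\<in>polys D. p = a * m + r \<and> degree r < degree m
    \<and> degree a \<le> degree p - degree m \<and> (degree p < degree m \<longrightarrow> a = 0)"
  using assms(5)
proof (induction "degree p" arbitrary: p rule: less_induct)
  case less
  note self = is_ideal_self[OF D] and z = subring_zero[OF D]
  show ?case
  proof (cases "degree p < degree m")
    case True
    then show ?thesis using less.prems z polys_zero[OF z]
      by (intro bexI[of _ 0] bexI[of _ p]) auto
  next
    case False
    define a where "a = monom (lead_coeff p) (degree p - degree m)"
    define p1 where "p1 = p - a * m"
    have a: "a \<in> polys D" unfolding a_def using z polysD[OF less.prems] by (intro polys_monom)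
    have p1: "p1 \<in> polys D"
      unfolding p1_def using a m less.prems by (intro polys_diff[OF D self] polys_mult[OF self])
    have dega: "degree a \<le> degree p - degree m" unfolding a_def by (rule degree_monom_le)
    have deg: "degree p1 \<le> degree p"
      unfolding p1_def
    proof (rule degree_diff_le)
      show "degree (a * m) \<le> degree p" using degree_mult_le[of a m] dega False by linarith
    qed simp
    have "coeff (a * m) (degree p) = lead_coeff p"
      using False m(2) coeff_mult_degree_sum[of a m]
      by (simp add: a_def coeff_monom_mult)
    then have "coeff p1 (degree p) = 0" by (simp add: p1_def)
    then have lt: "degree p1 < degree p"
      using deg m(3) False by (metis degree_0 leading_coeff_0_iff le_neq_implies_less not_less_zero nat_neq_iff order_le_less_trans not_le)
    obtain a' r where a': "a' \<in> polys D" "r \<in> polys D" "p1 = a' * m + r" "degree r < degree m"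
      "degree a' \<le> degree p1 - degree m"
      using less.hyps[OF lt p1] by blast
    have "p = (a + a') * m + r" using a'(3) by (simp add: p1_def algebra_simps)
    moreover have "a + a' \<in> polys D" using a a' by (intro polys_add[OF self])
    moreover have "degree (a + a') \<le> degree p - degree m"
      using dega a'(5) lt by (intro degree_add_le) auto
    ultimately show ?thesis using a' False by blast
  qed
qed

definition adjoin :: "'a::field set \<Rightarrow> 'a \<Rightarrow> 'a set" where
  "adjoin A s = {poly p s | p. p \<in> polys A}"

lemma adjoin_subring:
  assumes A: "subring A"
  shows "subring (adjoin A s)" "A \<subseteq> adjoin A s" "s \<in> adjoin A s"
proof -
  note self = is_ideal_self[OF A] and z = subring_zero[OF A]
  have c: "c \<in> adjoin A s" if "c \<in> A" for c
    using polys_const[OF z that] unfolding adjoin_def by (auto intro!: exI[of _ "[:c:]"])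
  then show "A \<subseteq> adjoin A s" by blast
  have "[:0, 1:] \<in> polys A" using z subring_one[OF A] by (intro polys_pCons polys_zero)
  then show "s \<in> adjoin A s" unfolding adjoin_def by (auto intro!: exI[of _ "[:0, 1:]"])
  show "subring (adjoin A s)"
    unfolding subring_def
  proof (intro conjI ballI)
    show "0 \<in> adjoin A s" "1 \<in> adjoin A s" using c z subring_one[OF A] by auto
    fix a b assume "a \<in> adjoin A s" "b \<in> adjoin A s"
    then obtain p q where pq: "p \<in> polys A" "q \<in> polys A" "a = poly p s" "b = poly q s"
      by (auto simp: adjoin_def)
    have "p + q \<in> polys A" "p - q \<in> polys A" "p * q \<in> polys A"
      using pq polys_add[OF self] polys_diff[OF A self] polys_mult[OF self] by blast+
    then show "a + b \<in> adjoin A s" "a - b \<in> adjoin A s" "a * b \<in> adjoin A s"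
      unfolding adjoin_def pq(3,4) by (metis (mono_tags, lifting) mem_Collect_eq poly_add poly_diff poly_mult)+
  qed
qed

section \<open>The local quadratic transform along a valuation ring\<close>

text \<open>Here $V$ is quasilocal with maximal ideal $N$ and dominates $D$, and \<open>m\<close> is a monic lift of the
  minimal polynomial of the residue of $y/x$.\<close>

locale quadratic = rlr2 D x y for D :: "'a::field set" and x y +
  fixes V N :: "'a set" and m :: "'a poly"
  assumes V: "subring V" and N_prime: "prime_ideal V N"
    and V_unit: "v \<in> V \<Longrightarrow> v \<notin> N \<Longrightarrow> inverse v \<in> V"
    and DV: "D \<subseteq> V" and MN: "lin D x y \<subseteq> N" and tV: "y * inverse x \<in> V"
    and m_poly: "m \<in> polys D" and m_monic: "lead_coeff m = 1"
    and m_root: "poly m (y * inverse x) \<in> N"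
    and m_min: "p \<in> polys D \<Longrightarrow> degree p < degree m \<Longrightarrow> poly p (y * inverse x) \<in> N
      \<Longrightarrow> p \<in> polys (lin D x y)"

text \<open>For \<open>t = y/x\<close> and \<open>N\<close> the maximal ideal of a valuation ring
  containing \<open>D[t]\<close> this is \<open>D[t]\<close> localized at the centre of the
  valuation, the local quadratic transform.\<close>

definition quad_ring :: "'a::field set \<Rightarrow> 'a set \<Rightarrow> 'a \<Rightarrow> 'a set" where
  "quad_ring D N t = {poly p t * inverse (poly q t) | p q. p \<in> polys D \<and> q \<in> polys D \<and> poly q t \<notin> N}"

section \<open>Forms in \<open>x\<close>, \<open>y\<close> and the order with respect to the maximal
  ideal\<close>

context rlr2
begin

abbreviation t where "t \<equiv> y * inverse x"

lemma xt: "x * t = y" "t * x = y" using x_nonzero by (simp_all add: field_simps)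

lemma polys_closed:
  "0 \<in> polys D" "p \<in> polys D \<Longrightarrow> q \<in> polys D \<Longrightarrow> p + q \<in> polys D"
  "p \<in> polys D \<Longrightarrow> q \<in> polys D \<Longrightarrow> p - q \<in> polys D"
  "p \<in> polys D \<Longrightarrow> q \<in> polys D \<Longrightarrow> p * q \<in> polys D"
  "c \<in> D \<Longrightarrow> monom c n \<in> polys D" "c \<in> D \<Longrightarrow> [:c:] \<in> polys D"
  using polys_zero[OF closed(1)] polys_add[OF is_ideal_self[OF subring]]
    polys_diff[OF subring is_ideal_self[OF subring]] polys_mult[OF is_ideal_self[OF subring]]
    polys_monom[OF closed(1)] polys_const[OF closed(1)] by auto

lemma x_prime_power:
  assumes "a \<in> D" "a * y ^ k \<in> princ D x"
  shows "a \<in> princ D x"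
  using prime_ideal_cases[OF princ_x_prime assms(1) closed(7)[OF yD] assms(2)]
    prime_ideal_power[OF subring princ_x_prime yD] y_notin by blast

text \<open>A coefficient \<open>a * x + b * y\<close> equals \<open>x * (a + b * t)\<close>; the
  term \<open>b * t\<close> is what raises the degree by one.\<close>

lemma polys_M_eval:
  assumes "p \<in> polys M"
  shows "\<exists>q\<in>polys D. poly p t = x * poly q t \<and> degree q \<le> Suc (degree p)"
  using assms
proof (induction p)
  case 0
  then show ?case using polys_closed(1) by (intro bexI[of _ 0]) auto
next
  case (pCons c p)
  then have "c \<in> M" "p \<in> polys M" using polys_pConsD by blast+
  then obtain a b where ab: "a \<in> D" "b \<in> D" "c = a * x + b * y" by (auto elim: linE)
  show ?case
  proof (cases "p = 0")
    case True
    then show ?thesis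
      using ab xt closed(1) by (intro bexI[of _ "[:a, b:]"]) (auto simp: algebra_simps intro!: polys_pCons polys_zero)
  next
    case False
    obtain q where q: "q \<in> polys D" "poly p t = x * poly q t" "degree q \<le> Suc (degree p)"
      using pCons.IH \<open>p \<in> polys M\<close> by blast
    have "poly (pCons c p) t = x * poly ([:a, b:] + pCons 0 q) t"
      using ab q(2) xt by (simp add: algebra_simps)
    moreover have "[:a, b:] + pCons 0 q \<in> polys D"
      using ab q(1) closed(1) by (intro polys_closed(2) polys_pCons polys_zero)
    moreover have "degree ([:a, b:] + pCons 0 q) \<le> Suc (degree (pCons c p))"
      using q(3) False by (intro degree_add_le) (auto intro: order_trans[OF degree_pCons_le])
    ultimately show ?thesis by blast
  qed
qed

text \<open>\<open>x ^ n * poly p t\<close> is the form of degree \<open>n\<close> in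
  \<open>x\<close> and \<open>y\<close> with the coefficients of \<open>p\<close>.\<close>

lemma eval_int:
  assumes "p \<in> polys D" "degree p \<le> n"
  shows "x ^ n * poly p t \<in> D"
proof -
  have "x ^ n * poly p t = (\<Sum>i\<le>degree p. coeff p i * (x ^ (n - i) * y ^ i))"
    unfolding poly_altdef sum_distrib_left
  proof (rule sum.cong[OF refl])
    fix i assume "i \<in> {..degree p}"
    then have "x ^ n = x ^ (n - i) * x ^ i" using assms(2) by (simp add: power_add[symmetric])
    moreover have "x ^ i * t ^ i = y ^ i" by (simp add: power_mult_distrib[symmetric] xt)
    moreover have "(x ^ (n - i) * x ^ i) * (coeff p i * s) = coeff p i * (x ^ (n - i) * (x ^ i * s))"
      for s by (simp add: algebra_simps)
    ultimately show "x ^ n * (coeff p i * t ^ i) = coeff p i * (x ^ (n - i) * y ^ i)"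
      by (simp only:)
  qed
  also have "\<dots> \<in> D"
    using polysD[OF assms(1)] xD yD by (intro is_ideal_sum[OF is_ideal_self[OF subring]] closed)
  finally show ?thesis .
qed

text \<open>The only term of a form of degree \<open>n + 1\<close> without a factor \<open>x\<close>
  is the one in \<open>y ^ Suc n\<close>. As \<open>x\<close> is prime and does not divide
  \<open>y\<close>, the top coefficient can be tested modulo \<open>x\<close>, which drives the
  inductions below.\<close>

lemma eval_top:
  assumes "p \<in> polys D" "degree p \<le> Suc n"
  obtains q where "q \<in> polys D" "degree q \<le> n" "p = q + monom (coeff p (Suc n)) (Suc n)"
    "x ^ Suc n * poly p t = x * (x ^ n * poly q t) + coeff p (Suc n) * y ^ Suc n"
proof -
  obtain q where q: "q \<in> polys D" "degree q \<le> n" "p = q + monom (coeff p (Suc n)) (Suc n)"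
    using polys_split_top[OF closed(1) assms] .
  have "poly p t = poly q t + coeff p (Suc n) * t ^ Suc n"
    by (subst q(3)) (simp add: poly_monom)
  moreover have "x ^ Suc n * t ^ Suc n = y ^ Suc n"
    by (simp only: power_mult_distrib[symmetric] xt)
  ultimately have "x ^ Suc n * poly p t = x * (x ^ n * poly q t) + coeff p (Suc n) * y ^ Suc n"
    by (simp only: distrib_left mult.left_commute[of "x ^ Suc n"]) (simp add: mult.assoc)
  then show ?thesis using q that by blast
qed

text \<open>Quasi-regularity of \<open>x, y\<close>: the associated graded ring is a polynomial ring.\<close>

lemma eval_divisible_coeffs:
  assumes "p \<in> polys D" "q \<in> polys D" "poly p t = x * poly q t"
  shows "p \<in> polys M"
proof -
  have "p \<in> polys M" if "p \<in> polys D" "q \<in> polys D" "poly p t = x * poly q t" "degree p \<le> n"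
    "degree q \<le> Suc n" for n
    using that
  proof (induction n arbitrary: p q)
    case 0
    obtain q0 where q0: "q0 \<in> polys D" "degree q0 \<le> 0" "x ^ Suc 0 * poly q t
        = x * (x ^ 0 * poly q0 t) + coeff q (Suc 0) * y ^ Suc 0"
      using eval_top[OF 0(2,5)] by metis
    obtain a where a: "q0 = [:a:]" using q0(2) degree_eq_zeroE by (metis le_zero_eq)
    obtain c where c: "p = [:c:]" using 0(4) degree_eq_zeroE by (metis le_zero_eq)
    have "c = a * x + coeff q (Suc 0) * y" using 0(3) q0(3) a c by simp
    moreover have "a \<in> D" using q0(1) a polysD[of q0 D 0] by simp
    ultimately have "c \<in> M" using polysD[OF 0(2)] linI by metis
    then show ?case unfolding c using zero_in by (intro polys_const)
  next
    case (Suc n)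
    obtain p0 where p0: "p0 \<in> polys D" "degree p0 \<le> n" "p = p0 + monom (coeff p (Suc n)) (Suc n)"
      "x ^ Suc n * poly p t = x * (x ^ n * poly p0 t) + coeff p (Suc n) * y ^ Suc n"
      using eval_top[OF Suc.prems(1,4)] .
    obtain q0 where q0: "q0 \<in> polys D" "degree q0 \<le> Suc n"
      "q = q0 + monom (coeff q (Suc (Suc n))) (Suc (Suc n))"
      "x ^ Suc (Suc n) * poly q t = x * (x ^ Suc n * poly q0 t) + coeff q (Suc (Suc n)) * y ^ Suc (Suc n)"
      using eval_top[OF Suc.prems(2,5)] .
    define c d where "c = coeff p (Suc n)" and "d = coeff q (Suc (Suc n))"
    have cd: "c \<in> D" "d \<in> D" using Suc.prems polysD by (auto simp: c_def d_def)
    have "x ^ Suc n * poly p t = x ^ Suc (Suc n) * poly q t" using Suc.prems(3) by simp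
    then have "(c - d * y) * y ^ Suc n = x * (x ^ Suc n * poly q0 t - x ^ n * poly p0 t)"
      unfolding p0(4) q0(4) c_def[symmetric] d_def[symmetric] by (simp add: algebra_simps)
    moreover have "x ^ Suc n * poly q0 t - x ^ n * poly p0 t \<in> D"
      by (intro closed(4) eval_int p0 q0)
    \<comment> \<open>Comparing the pure powers of \<open>y\<close> on both sides modulo
      \<open>x\<close> gives \<open>c\<close> in \<open>M\<close>. The two top terms then cancel up
      to \<open>e * x * t ^ Suc n\<close>, which is moved into \<open>q\<close>, and the degree has
      dropped.\<close>
    ultimately have "(c - d * y) * y ^ Suc n \<in> princ D x" using princI by metis
    then have "c - d * y \<in> princ D x"
      by (rule x_prime_power[OF closed(4)[OF cd(1) closed(5)[OF cd(2) yD]]])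
    then obtain e where e: "e \<in> D" "c - d * y = x * e" by (auto elim: princE)
    have ceq: "c = e * x + d * y" using e(2) by (simp add: algebra_simps)
    have "poly p t = poly p0 t + c * t ^ Suc n"
      by (subst p0(3)) (simp add: poly_monom c_def)
    moreover have "poly q t = poly q0 t + d * t ^ Suc (Suc n)"
      by (subst q0(3)) (simp add: poly_monom d_def)
    ultimately have "poly p0 t + c * t ^ Suc n = x * poly q0 t + d * (x * t) * t ^ Suc n"
      using Suc.prems(3) by (simp add: algebra_simps)
    then have "poly p0 t = x * poly q0 t - e * x * t ^ Suc n"
      unfolding xt ceq by (simp add: algebra_simps)
    then have "poly p0 t = x * poly (q0 - monom e (Suc n)) t"
      by (simp add: poly_monom algebra_simps)
    moreover have "q0 - monom e (Suc n) \<in> polys D" using q0(1) e(1) by (intro polys_closed)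
    moreover have "degree (q0 - monom e (Suc n)) \<le> Suc n"
      using q0(2) by (intro degree_diff_le degree_monom_le)
    ultimately have "p0 \<in> polys M" using Suc.IH[OF p0(1)] p0(2) by blast
    moreover have "c \<in> M" using ceq e cd linI by metis
    ultimately show ?case
      by (subst p0(3), fold c_def) (intro polys_add[OF M_ideal] polys_monom zero_in)
  qed
  from this[OF assms, of "max (degree p) (degree q)"] show ?thesis by simp
qed

text \<open>This is the \<open>r\<close>-th power of the maximal ideal, written by forms of degree
  \<open>r\<close>.\<close>

definition form :: "nat \<Rightarrow> 'a set" where
  "form r = {x ^ r * poly p t | p. p \<in> polys D \<and> degree p \<le> r}"

text \<open>Modulo \<open>x\<close> only the top term of the form representing \<open>x * a\<close>
  survives, so its coefficient is \<open>x * e\<close>; after cancelling \<open>x\<close>, the term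
  \<open>e * y ^ Suc r\<close> is absorbed as \<open>(e * y) * y ^ r\<close>.\<close>

lemma form_cancel:
  assumes "a \<in> D" "x * a \<in> form (Suc r)"
  shows "a \<in> form r"
proof -
  obtain p where p: "p \<in> polys D" "degree p \<le> Suc r" "x * a = x ^ Suc r * poly p t"
    using assms(2) by (auto simp: form_def)
  obtain q where q: "q \<in> polys D" "degree q \<le> r"
    "x ^ Suc r * poly p t = x * (x ^ r * poly q t) + coeff p (Suc r) * y ^ Suc r"
    using eval_top[OF p(1,2)] by metis
  have xa: "x * a = x * (x ^ r * poly q t) + coeff p (Suc r) * y ^ Suc r"
    using p(3) q(3) by (simp only:)
  then have "coeff p (Suc r) * y ^ Suc r = x * (a - x ^ r * poly q t)"
    by (simp only: right_diff_distrib) simp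
  then have "coeff p (Suc r) * y ^ Suc r \<in> princ D x"
    using princI[OF closed(4)[OF assms(1) eval_int[OF q(1,2)]]] by (simp only:)
  then have "coeff p (Suc r) \<in> princ D x"
    by (rule x_prime_power[OF polysD[OF p(1)]])
  then obtain e where e: "e \<in> D" "coeff p (Suc r) = x * e" by (auto elim: princE)
  have "x * a = x * (x ^ r * poly q t + e * y ^ Suc r)"
    unfolding xa e(2) by (simp only: distrib_left mult.assoc)
  then have "a = x ^ r * poly q t + e * y ^ Suc r" using x_nonzero by simp
  also have "y ^ Suc r = y * (x ^ r * t ^ r)" by (simp add: power_mult_distrib[symmetric] xt)
  also have "x ^ r * poly q t + e * (y * (x ^ r * t ^ r)) = x ^ r * poly (q + monom (e * y) r) t"
    by (simp add: poly_monom algebra_simps)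
  finally have "a = x ^ r * poly (q + monom (e * y) r) t" .
  moreover have "q + monom (e * y) r \<in> polys D" using q(1) e(1) yD by (intro polys_closed closed)
  moreover have "degree (q + monom (e * y) r) \<le> r"
    using q(2) by (intro degree_add_le degree_monom_le)
  ultimately show ?thesis unfolding form_def by blast
qed

text \<open>\<open>r\<close> is the largest exponent such that \<open>g\<close> lies in the
  \<open>r\<close>-th power of \<open>M\<close>. It exists because \<open>g = x ^ k * b\<close>,
  where \<open>b\<close> has finite order \<open>j\<close> modulo \<open>x\<close> and hence is not
  in \<open>form (Suc j)\<close>, and factors \<open>x\<close> can be cancelled by
  \<open>form_cancel\<close>.\<close>

lemma order_exists:
  assumes "g \<in> D" "g \<noteq> 0"
  obtains r h where "h \<in> polys D" "h \<notin> polys M" "degree h \<le> r" "g = x ^ r * poly h t"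
proof -
  obtain k b where b: "b \<in> D" "b \<notin> princ D x" "g = x ^ k * b" using separated[OF assms] by blast
  obtain u j c where u: "u \<in> D" "u \<notin> M" "c \<in> D" "b = u * y ^ j + x * c" using disc[OF b(1,2)] by blast
  have "b \<notin> form (Suc j)"
  proof
    assume "b \<in> form (Suc j)"
    then obtain p where p: "p \<in> polys D" "degree p \<le> Suc j" "b = x ^ Suc j * poly p t"
      by (auto simp: form_def)
    obtain q where q: "q \<in> polys D" "degree q \<le> j"
      "x ^ Suc j * poly p t = x * (x ^ j * poly q t) + coeff p (Suc j) * y ^ Suc j"
      using eval_top[OF p(1,2)] by metis
    define d where "d = coeff p (Suc j)"
    have d: "d \<in> D" using polysD[OF p(1)] by (simp add: d_def)
    define s where "s = x ^ j * poly q t"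
    have "u * y ^ j + x * c = x * s + d * y ^ Suc j"
      using p(3) q(3) u(4) by (simp only: d_def s_def)
    then have "(u - d * y) * y ^ j = x * (s - c)" by (simp add: algebra_simps)
    moreover have "s - c \<in> D" unfolding s_def by (rule closed(4)[OF eval_int[OF q(1,2)] u(3)])
    ultimately have "(u - d * y) * y ^ j \<in> princ D x" using princI by metis
    then have "u - d * y \<in> princ D x"
      by (rule x_prime_power[OF closed(4)[OF u(1) closed(5)[OF d yD]]])
    then obtain e where "e \<in> D" "u - d * y = x * e" by (auto elim: princE)
    then have "u = e * x + d * y" "e \<in> D" by (simp_all add: algebra_simps)
    then show False using u(2) d linI by metis
  qed
  moreover have "x ^ i * b \<in> form (i + l) \<Longrightarrow> b \<in> form l" for i l
  proof (induction i)
    case (Suc i)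
    then show ?case using form_cancel[of "x ^ i * b" "i + l"] b(1) xD
      by (simp add: mult.assoc closed)
  qed simp
  ultimately have "g \<notin> form (k + Suc j)" using b(3) by blast
  then obtain n where n: "g \<notin> form n" "\<And>i. i < n \<Longrightarrow> g \<in> form i"
    using exists_least_iff[of "\<lambda>n. g \<notin> form n"] by blast
  have "g \<in> form 0"
    unfolding form_def using polys_closed(6)[OF assms(1)] by (auto intro!: exI[of _ "[:g:]"])
  then obtain r where r: "n = Suc r" using n(1) by (cases n) auto
  then obtain h where h: "h \<in> polys D" "degree h \<le> r" "g = x ^ r * poly h t"
    using n(2)[of r] by (auto simp: form_def)
  \<comment> \<open>Otherwise a further factor \<open>x\<close> comes out of
    \<open>poly h t\<close>, and \<open>g\<close> would belong to the next power of
    \<open>M\<close>.\<close>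
  have "h \<notin> polys M"
  proof
    assume "h \<in> polys M"
    then obtain q where q: "q \<in> polys D" "poly h t = x * poly q t" "degree q \<le> Suc (degree h)"
      using polys_M_eval by blast
    then have "g = x ^ Suc r * poly q t" "degree q \<le> Suc r" using h by (simp_all add: algebra_simps)
    then show False using n(1) q(1) r unfolding form_def by blast
  qed
  then show ?thesis using that h by blast
qed

end

lemma prime_ideal_contract:
  assumes "subring A" "A \<subseteq> B" "prime_ideal B P"
  shows "prime_ideal A (P \<inter> A)"
proof -
  note PI = prime_ideal_ideal[OF assms(3)]
  have "is_ideal A (P \<inter> A)"
    unfolding is_ideal_def
    using is_ideal_zero[OF PI] is_ideal_add[OF PI] is_ideal_mult[OF PI] assms(2)
      subring_closed[OF assms(1)] by (auto simp: subset_iff)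
  moreover have "P \<inter> A \<noteq> A" using prime_ideal_one[OF assms(3)] subring_one[OF assms(1)] by blast
  ultimately show ?thesis
    unfolding prime_ideal_def using prime_ideal_cases[OF assms(3)] assms(2) by (auto simp: subset_iff)
qed

section \<open>The quadratic transform is again a two-dimensional regular local ring\<close>

context quadratic
begin

abbreviation D' where "D' \<equiv> quad_ring D N t"

lemma N_ideal: "is_ideal V N" by (rule prime_ideal_ideal[OF N_prime])

lemma N_one: "1 \<notin> N" by (rule prime_ideal_one[OF N_prime])

lemma polys_V: "p \<in> polys D \<Longrightarrow> poly p t \<in> V"
  using poly_in_subring[OF V tV] polys_mono[OF DV] by blast

lemma polys_M_N: "p \<in> polys M \<Longrightarrow> poly p t \<in> N"
  using poly_in_ideal[OF V N_ideal tV] polys_mono[OF MN] by blast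

lemma N_zero: "0 \<in> N" by (rule is_ideal_zero[OF N_ideal])

lemma N_mult: "a \<in> V \<Longrightarrow> b \<in> V \<Longrightarrow> a * b \<in> N \<longleftrightarrow> a \<in> N \<or> b \<in> N"
  using prime_ideal_cases[OF N_prime] is_ideal_mult[OF N_ideal] is_ideal_mult2[OF N_ideal] by blast

lemma m_degree: "degree m > 0"
proof (rule ccontr)
  assume "\<not> degree m > 0"
  then obtain c where "m = [:c:]" using degree_eq_zeroE by blast
  then have "m = 1" using m_monic by (simp add: one_pCons)
  then show False using m_root N_one by simp
qed

lemma m_notin: "m \<notin> polys M"
  using polysD[of m M "degree m"] m_monic one_notin by auto

lemma quadI: "p \<in> polys D \<Longrightarrow> q \<in> polys D \<Longrightarrow> poly q t \<notin> N \<Longrightarrow> poly p t * inverse (poly q t) \<in> D'"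
  unfolding quad_ring_def by blast

lemma quadE:
  assumes "z \<in> D'"
  obtains p q where "p \<in> polys D" "q \<in> polys D" "poly q t \<notin> N" "poly q t \<noteq> 0"
    "z = poly p t * inverse (poly q t)" "poly p t = z * poly q t"
proof -
  obtain p q where *: "p \<in> polys D" "q \<in> polys D" "poly q t \<notin> N" "z = poly p t * inverse (poly q t)"
    using assms unfolding quad_ring_def by blast
  moreover have "poly q t \<noteq> 0" using *(3) N_zero by auto
  ultimately show ?thesis using that by (simp add: field_simps)
qed

lemma one_poly: "1 \<in> polys D"
  using polys_closed(6)[OF closed(2)] by (simp add: one_pCons)

lemma poly_in: "p \<in> polys D \<Longrightarrow> poly p t \<in> D'"
  using quadI[OF _ one_poly] N_one by simp

lemma inverse_in: "p \<in> polys D \<Longrightarrow> poly p t \<notin> N \<Longrightarrow> inverse (poly p t) \<in> D'"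
  using quadI[OF one_poly] by simp

lemma D_sub: "d \<in> D \<Longrightarrow> d \<in> D'"
  using poly_in[OF polys_closed(6)] by simp

lemma t_in: "t \<in> D'"
proof -
  have "[:0, 1:] \<in> polys D" using closed(1,2) by (intro polys_pCons polys_zero)
  from poly_in[OF this] show ?thesis by simp
qed

lemma D'_subring: "subring D'"
proof -
  note ad = adjoin_subring[OF subring, of t]
  have "D' = {a * inverse s | a s. a \<in> adjoin D t \<and> s \<in> adjoin D t - N}"
    unfolding quad_ring_def adjoin_def by blast
  moreover have "s * r \<in> adjoin D t - N" if "s \<in> adjoin D t - N" "r \<in> adjoin D t - N" for s r
  proof -
    have "s \<in> V" "r \<in> V" using that polys_V by (auto simp: adjoin_def)
    then show ?thesis using that N_mult subring_mult[OF ad(1)] by blast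
  qed
  ultimately show ?thesis
    using subring_fractions(1)[OF ad(1), of "adjoin D t - N"] subring_one[OF ad(1)] N_one N_zero by auto
qed

lemmas closed' = subring_closed[OF D'_subring]

lemma D'_V: "z \<in> D' \<Longrightarrow> z \<in> V"
  using polys_V V_unit subring_mult[OF V] by (erule_tac quadE) metis

lemma D'_unit:
  assumes "z \<in> D'" "z \<notin> N"
  shows "inverse z \<in> D'"
proof -
  obtain p q where *: "p \<in> polys D" "q \<in> polys D" "poly q t \<notin> N" "poly q t \<noteq> 0"
    "z = poly p t * inverse (poly q t)" "poly p t = z * poly q t" using quadE[OF assms(1)] .
  have "poly p t \<notin> N" unfolding *(6) using *(2,3) assms N_mult D'_V polys_V by blast
  from quadI[OF *(2,1) this] show ?thesis using *(5) by (simp add: mult.commute)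
qed

lemma unit_cancel:
  assumes "is_ideal D' I" "q \<in> polys D" "poly q t \<notin> N" "z * poly q t \<in> I"
  shows "z \<in> I"
proof -
  have "z * poly q t * inverse (poly q t) \<in> I"
    using is_ideal_mult2[OF assms(1) inverse_in[OF assms(2,3)] assms(4)] .
  moreover have "poly q t \<noteq> 0" using assms(3) N_zero by auto
  ultimately show ?thesis by (simp add: mult.assoc)
qed

text \<open>After division by \<open>m\<close> the remainder still evaluates into \<open>N\<close>.
  By the minimality of \<open>m\<close> its coefficients lie in \<open>M\<close>, so its value is a
  multiple of \<open>x\<close>. This makes \<open>x\<close> and \<open>poly m t\<close> generators
  of the new maximal ideal.\<close>

lemma eval_N_reduce:
  assumes "p \<in> polys D" "poly p t \<in> N"
  obtains a c where "a \<in> polys D" "c \<in> polys D" "poly p t = poly a t * poly m t + x * poly c t"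
    "p \<notin> polys M \<Longrightarrow> a \<notin> polys M" "p \<notin> polys M \<Longrightarrow> degree a + degree m \<le> degree p"
proof -
  obtain a r where ar: "a \<in> polys D" "r \<in> polys D" "p = a * m + r" "degree r < degree m"
    "degree a \<le> degree p - degree m" "degree p < degree m \<longrightarrow> a = 0"
    using polys_divide_monic[OF subring m_poly m_monic m_degree assms(1)] by blast
  have "poly r t = poly p t - poly a t * poly m t" using ar(3) by simp
  also have "\<dots> \<in> N"
    using assms(2) is_ideal_diff[OF V N_ideal] is_ideal_mult[OF N_ideal polys_V[OF ar(1)] m_root] by blast
  finally have r: "r \<in> polys M" using m_min[OF ar(2,4)] by blast
  obtain c where c: "c \<in> polys D" "poly r t = x * poly c t" using polys_M_eval[OF r] by blast
  have "poly p t = poly a t * poly m t + x * poly c t" unfolding c(2)[symmetric] ar(3) by simp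
  moreover have aM: "a \<notin> polys M" if "p \<notin> polys M"
  proof
    assume "a \<in> polys M"
    then have "a * m + r \<in> polys M"
      using r m_poly polys_add[OF M_ideal] polys_mult[OF M_ideal] by blast
    then show False using that ar(3) by simp
  qed
  moreover have "degree a + degree m \<le> degree p" if "p \<notin> polys M"
  proof -
    have "a \<noteq> 0" using aM[OF that] polys_zero[OF zero_in] by auto
    then show ?thesis using ar(5,6) by linarith
  qed
  ultimately show ?thesis using that ar(1) c(1) by blast
qed

lemma M'_eq: "lin D' x (poly m t) = D' \<inter> N"
proof (intro equalityI subsetI)
  fix z assume "z \<in> lin D' x (poly m t)"
  then obtain a b where ab: "a \<in> D'" "b \<in> D'" "z = a * x + b * poly m t" by (auto elim: linE)
  have "x \<in> N" using MN gens(1) by blast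
  then have "z \<in> N" unfolding ab(3)
    using ab D'_V m_root is_ideal_add[OF N_ideal] is_ideal_mult[OF N_ideal] by blast
  moreover have "z \<in> D'" unfolding ab(3) using ab D_sub[OF xD] poly_in[OF m_poly] by (intro closed')
  ultimately show "z \<in> D' \<inter> N" by blast
next
  fix z assume z: "z \<in> D' \<inter> N"
  then obtain p q where *: "p \<in> polys D" "q \<in> polys D" "poly q t \<notin> N" "poly p t = z * poly q t"
    using quadE by (metis IntD1)
  have "poly p t \<in> N" unfolding *(4) using z *(2) polys_V is_ideal_mult2[OF N_ideal] by blast
  then obtain a c where ac: "a \<in> polys D" "c \<in> polys D" "poly p t = poly a t * poly m t + x * poly c t"
    using eval_N_reduce[OF *(1)] by metis
  have "z * poly q t = poly c t * x + poly a t * poly m t" using ac(3) *(4) by (simp add: algebra_simps)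
  then have "z * poly q t \<in> lin D' x (poly m t)" using linI poly_in ac(1,2) by metis
  then show "z \<in> lin D' x (poly m t)"
    using unit_cancel[OF is_ideal_lin[OF D'_subring D_sub[OF xD] poly_in[OF m_poly]] *(2,3)] by blast
qed

lemma x_ideal: "is_ideal D' (princ D' x)"
  by (rule is_ideal_princ[OF D'_subring D_sub[OF xD]])

text \<open>Says that \<open>D'/xD'\<close> is a localization of the polynomial ring over the
  residue field of \<open>D\<close>, with \<open>t\<close> as the variable. Quasi-regularity settles
  numerators; \<open>polys_gauss\<close> removes the denominator \<open>q\<close>, which is not in
  \<open>M[X]\<close> since its value is outside \<open>N\<close>.\<close>

lemma in_princ_x_iff:
  assumes "p \<in> polys D"
  shows "poly p t \<in> princ D' x \<longleftrightarrow> p \<in> polys M"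
proof
  assume "poly p t \<in> princ D' x"
  then obtain z where z: "z \<in> D'" "poly p t = x * z" by (auto elim: princE)
  obtain a q where *: "a \<in> polys D" "q \<in> polys D" "poly q t \<notin> N" "poly a t = z * poly q t"
    using quadE[OF z(1)] by metis
  have "poly (p * q) t = x * poly a t" using z(2) *(4) by (simp only: poly_mult mult.assoc)
  then have "p * q \<in> polys M"
    using eval_divisible_coeffs *(1,2) assms polys_closed(4) by blast
  then show "p \<in> polys M" using polys_gauss[OF subring M_prime assms *(2)] polys_M_N *(3) by blast
next
  assume "p \<in> polys M"
  then show "poly p t \<in> princ D' x" using polys_M_eval poly_in princI by metis
qed

text \<open>Repeated division by \<open>m\<close>: modulo \<open>x\<close> the element
  \<open>poly m t\<close> is a uniformizer. The bound on the degrees is kept because it limits the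
  multiplicity after the transform.\<close>

lemma mod_x_form:
  assumes "p \<in> polys D" "p \<notin> polys M"
  shows "\<exists>u\<in>polys D. \<exists>k. \<exists>c\<in>D'. poly u t \<notin> N \<and> poly p t = poly u t * poly m t ^ k + x * c
    \<and> k * degree m + degree u \<le> degree p"
  using assms
proof (induction "degree p" arbitrary: p rule: less_induct)
  case less
  show ?case
  proof (cases "poly p t \<in> N")
    case False
    then show ?thesis using less.prems(1) closed'(1)
      by (intro bexI[of _ p] exI[of _ 0] bexI[of _ 0]) auto
  next
    case True
    obtain a c where ac: "a \<in> polys D" "c \<in> polys D" "poly p t = poly a t * poly m t + x * poly c t"
      "a \<notin> polys M" "degree a + degree m \<le> degree p"
      using eval_N_reduce[OF less.prems(1) True] less.prems(2) by metis
    have "degree a < degree p" using ac(5) m_degree by linarith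
    then obtain u k e where u: "u \<in> polys D" "e \<in> D'" "poly u t \<notin> N"
      "poly a t = poly u t * poly m t ^ k + x * e" "k * degree m + degree u \<le> degree a"
      using less.hyps[OF _ ac(1,4)] by blast
    have "poly p t = poly u t * poly m t ^ Suc k + x * (e * poly m t + poly c t)"
      unfolding ac(3) u(4) by (simp only: power_Suc2 distrib_left distrib_right mult.assoc add.assoc)
    moreover have "e * poly m t + poly c t \<in> D'" using u(2) poly_in m_poly ac(2) by (intro closed')
    moreover have "Suc k * degree m + degree u \<le> degree p" using u(5) ac(5) by simp
    ultimately show ?thesis using u(1,3) by blast
  qed
qed

lemma clear_denominator:
  assumes "z \<in> D'"
  obtains q n g where "q \<in> polys D" "poly q t \<notin> N" "g \<in> D" "g = x ^ n * (z * poly q t)"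
proof -
  obtain p q where *: "p \<in> polys D" "q \<in> polys D" "poly q t \<notin> N" "poly p t = z * poly q t"
    using quadE[OF assms] by metis
  show ?thesis using that[OF *(2,3) eval_int[OF *(1) order_refl]] *(4) by metis
qed

text \<open>Modulo \<open>x\<close> the ring \<open>D'\<close> is the localization of a polynomial
  ring over a field at an irreducible polynomial, hence a discrete valuation ring. Primes containing
  \<open>x\<close> are found there; a nonzero prime not containing \<open>x\<close> comes from a
  principal prime of \<open>D\<close>, whose generator only has to be freed of its powers of
  \<open>x\<close>.\<close>

theorem quad_rlr2: "rlr2 D' x (poly m t)"
proof
  note m' = poly_in[OF m_poly] and x' = D_sub[OF xD]
  show "subring D'" "x \<in> D'" "poly m t \<in> D'" "x \<noteq> 0" by (fact D'_subring x' m' x_nonzero)+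
  show "1 \<notin> lin D' x (poly m t)" using N_one M'_eq by blast
  show "inverse d \<in> D'" if "d \<in> D'" "d \<notin> lin D' x (poly m t)" for d
    using D'_unit that M'_eq by blast
  show m_notin: "poly m t \<notin> princ D' x" using in_princ_x_iff[OF m_poly] m_notin by blast
  show x_prime': "a \<in> princ D' x \<or> b \<in> princ D' x" if ab: "a \<in> D'" "b \<in> D'" "a * b \<in> princ D' x" for a b
  proof -
    obtain p q where *: "p \<in> polys D" "q \<in> polys D" "poly q t \<notin> N" "poly p t = a * poly q t"
      using quadE[OF ab(1)] by metis
    obtain p' q' where **: "p' \<in> polys D" "q' \<in> polys D" "poly q' t \<notin> N" "poly p' t = b * poly q' t"
      using quadE[OF ab(2)] by metis
    have "poly (p * p') t = (a * b) * poly (q * q') t"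
      by (simp only: poly_mult *(4) **(4)) (simp only: mult.assoc mult.left_commute mult.commute)
    then have "poly (p * p') t \<in> princ D' x"
      using is_ideal_mult2[OF x_ideal poly_in[OF polys_closed(4)[OF *(2) **(2)]] ab(3)] by (simp only:)
    then have "p * p' \<in> polys M" using in_princ_x_iff polys_closed(4)[OF *(1) **(1)] by blast
    then have "p \<in> polys M \<or> p' \<in> polys M" using polys_gauss[OF subring M_prime *(1) **(1)] by blast
    then show ?thesis
      using in_princ_x_iff[OF *(1)] in_princ_x_iff[OF **(1)] unit_cancel[OF x_ideal *(2,3), of a]
        unit_cancel[OF x_ideal **(2,3), of b] *(4) **(4) by auto
  qed
  \<comment> \<open>Since \<open>x\<close> is prime and does not divide \<open>h\<close>, powers of
    \<open>x\<close> cancel in a divisibility by \<open>h\<close>.\<close>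
  have power_cancel: "z \<in> princ D' h" if xz: "x ^ n * z \<in> princ D' h" and h: "h \<in> D'" "h \<notin> princ D' x" and z: "z \<in> D'" for n z h
  proof -
    obtain w where "w \<in> D'" "x ^ n * z = h * w" using xz by (auto elim: princE)
    then show ?thesis
    proof (induction n arbitrary: w)
      case 0
      then show ?case using princI by (metis mult_1 power_0)
    next
      case (Suc n)
      have "h * w = x * (x ^ n * z)" using Suc.prems by (simp add: mult.assoc)
      also have "\<dots> \<in> princ D' x" using z x' by (intro princI closed')
      finally have "w \<in> princ D' x" using x_prime'[OF h(1) Suc.prems(1)] h(2) by blast
      then obtain w' where w': "w' \<in> D'" "w = x * w'" by (auto elim: princE)
      have "x * (x ^ n * z) = x * (h * w')" using Suc.prems(2) w'(2) by (simp add: algebra_simps)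
      then show ?case using Suc.IH[OF w'(1)] x_nonzero by simp
    qed
  qed
  show disc': "\<exists>u\<in>D'. \<exists>k. \<exists>c\<in>D'. u \<notin> lin D' x (poly m t) \<and> a = u * poly m t ^ k + x * c"
    if a: "a \<in> D'" "a \<notin> princ D' x" for a
  proof -
    obtain p q where *: "p \<in> polys D" "q \<in> polys D" "poly q t \<notin> N" "poly q t \<noteq> 0"
      "a = poly p t * inverse (poly q t)" "poly p t = a * poly q t"
      using quadE[OF a(1)] .
    have "p \<notin> polys M"
      using in_princ_x_iff[OF *(1)] unit_cancel[OF x_ideal *(2,3), of a] *(6) a(2) by auto
    then obtain u k c where u: "u \<in> polys D" "c \<in> D'" "poly u t \<notin> N"
      "poly p t = poly u t * poly m t ^ k + x * c" using mod_x_form[OF *(1)] by blast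
    define i where "i = inverse (poly q t)"
    have i: "i \<in> D'" unfolding i_def by (rule inverse_in[OF *(2,3)])
    have "i \<notin> N"
    proof
      assume "i \<in> N"
      then have "i * poly q t \<in> N" using is_ideal_mult2[OF N_ideal polys_V[OF *(2)]] by blast
      then show False using N_one *(4) by (simp add: i_def)
    qed
    then have "poly u t * i \<notin> N" using u(1,3) i N_mult polys_V D'_V by blast
    moreover have "a = (poly u t * i) * poly m t ^ k + x * (c * i)"
      unfolding *(5) u(4) i_def[symmetric] by (simp only: distrib_left distrib_right mult.assoc mult.left_commute mult.commute)
    moreover have "poly u t * i \<in> D'" "c * i \<in> D'" using u i poly_in by (auto intro: closed')
    ultimately show ?thesis using M'_eq by blast
  qed
  show "\<exists>k. \<exists>b\<in>D'. b \<notin> princ D' x \<and> a = x ^ k * b" if a: "a \<in> D'" "a \<noteq> 0" for a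
  proof -
    obtain q n g where *: "q \<in> polys D" "poly q t \<notin> N" "g \<in> D" "g = x ^ n * (a * poly q t)"
      using clear_denominator[OF a(1)] .
    have q0: "poly q t \<noteq> 0" using *(2) N_zero by auto
    then have "g \<noteq> 0" using *(4) a(2) x_nonzero by simp
    then obtain r h where h: "h \<in> polys D" "h \<notin> polys M" "g = x ^ r * poly h t"
      using order_exists[OF *(3)] by metis
    define b where "b = poly h t * inverse (poly q t)"
    have b: "b \<in> D'" unfolding b_def by (rule quadI[OF h(1) *(1,2)])
    have bx: "b \<notin> princ D' x"
    proof
      assume "b \<in> princ D' x"
      from is_ideal_mult2[OF x_ideal poly_in[OF *(1)] this]
      show False using q0 in_princ_x_iff[OF h(1)] h(2) by (simp add: b_def mult.assoc)
    qed
    have eq: "x ^ n * a = x ^ r * b"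
    proof -
      have "(x ^ n * a) * poly q t = (x ^ r * b) * poly q t"
        using *(4) h(3) q0 by (simp add: b_def mult.assoc)
      then show ?thesis using q0 by simp
    qed
    \<comment> \<open>\<open>n\<close> clears the denominators in \<open>t\<close> and
      \<open>r\<close> is the order of the result in \<open>D\<close>. If \<open>n\<close> exceeded
      \<open>r\<close>, a factor \<open>x\<close> would be left in \<open>b\<close>.\<close>
    have "n \<le> r"
    proof (rule ccontr)
      assume "\<not> n \<le> r"
      then have "n = r + Suc (n - Suc r)" by simp
      then have "x ^ n = x ^ r * x ^ Suc (n - Suc r)" by (metis power_add)
      then have "x ^ r * b = x ^ r * (x * (x ^ (n - Suc r) * a))"
        unfolding eq[symmetric] by (simp add: mult.assoc)
      then have "b = x * (x ^ (n - Suc r) * a)" using x_nonzero by simp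
      moreover have "x ^ (n - Suc r) * a \<in> D'" using a(1) x' by (intro closed')
      ultimately show False using bx princI by blast
    qed
    then have "x ^ r = x ^ n * x ^ (r - n)" by (simp add: power_add[symmetric])
    then have "x ^ n * a = x ^ n * (x ^ (r - n) * b)" using eq by (simp add: mult.assoc)
    then have "a = x ^ (r - n) * b" using x_nonzero by simp
    then show ?thesis using b bx by blast
  qed
  show "P = {0} \<or> P = lin D' x (poly m t) \<or> (\<exists>g\<in>D'. P = princ D' g)" if P: "prime_ideal D' P" for P
  proof -
    note PI = prime_ideal_ideal[OF P]
    consider "x \<in> P" "poly m t \<in> P" | "x \<in> P" "poly m t \<notin> P" | "x \<notin> P" by blast
    then show ?thesis
    proof cases
      case 1
      then have "lin D' x (poly m t) \<subseteq> P"
        using is_ideal_add[OF PI] is_ideal_mult[OF PI] by (auto simp: lin_def)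
      moreover have "P \<subseteq> lin D' x (poly m t)"
      proof
        fix z assume z: "z \<in> P"
        then have zD: "z \<in> D'" using is_ideal_subset[OF PI] by blast
        show "z \<in> lin D' x (poly m t)"
        proof (rule ccontr)
          assume "z \<notin> lin D' x (poly m t)"
          then have "z \<notin> N" using M'_eq zD by blast
          then have "inverse z * z \<in> P" using is_ideal_mult[OF PI] D'_unit[OF zD] z by blast
          then show False using \<open>z \<notin> N\<close> N_zero prime_ideal_one[OF P] by (cases "z = 0") auto
        qed
      qed
      ultimately show ?thesis by blast
    next
      case 2
      have "P \<subseteq> princ D' x"
      proof
        fix a assume a: "a \<in> P"
        have aD: "a \<in> D'" using a is_ideal_subset[OF PI] by blast
        show "a \<in> princ D' x"
        proof (rule ccontr)
          assume "a \<notin> princ D' x"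
          then obtain u k c where u: "u \<in> D'" "u \<notin> lin D' x (poly m t)" "c \<in> D'" "a = u * poly m t ^ k + x * c"
            using disc'[OF aD] by blast
          have uN: "u \<notin> N" using u M'_eq by blast
          have "u * poly m t ^ k = a - x * c" using u(4) by simp
          also have "\<dots> \<in> P" using a 2 u(3) is_ideal_diff[OF D'_subring PI] is_ideal_mult2[OF PI] by blast
          finally have "inverse u * (u * poly m t ^ k) \<in> P"
            using is_ideal_mult[OF PI D'_unit[OF u(1) uN]] by blast
          moreover have "u \<noteq> 0" using uN N_zero by auto
          ultimately have "poly m t ^ k \<in> P" by (simp add: mult.assoc[symmetric])
          then show False using prime_ideal_power[OF D'_subring P m'] 2 by blast
        qed
      qed
      moreover have "princ D' x \<subseteq> P" using 2 is_ideal_mult2[OF PI] by (auto simp: princ_def)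
      ultimately show ?thesis using x' by blast
    next
      case 3
      show ?thesis
      proof (cases "P = {0}")
        case False
        then obtain a where a: "a \<in> P" "a \<noteq> 0" using is_ideal_zero[OF PI] by blast
        have PD: "z \<in> D'" if "z \<in> P" for z using that is_ideal_subset[OF PI] by blast
        define p where "p = P \<inter> D"
        have p: "prime_ideal D p"
          unfolding p_def by (rule prime_ideal_contract[OF subring _ P]) (use D_sub in blast)
        obtain q n g where *: "q \<in> polys D" "poly q t \<notin> N" "g \<in> D" "g = x ^ n * (a * poly q t)"
          using clear_denominator[OF PD[OF a(1)]] .
        have "g \<noteq> 0" using *(2,4) N_zero a(2) x_nonzero by auto
        moreover have "g \<in> p" unfolding p_def
          using * a(1) is_ideal_mult[OF PI closed'(7)[OF x']] is_ideal_mult2[OF PI poly_in[OF *(1)]] by auto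
        moreover have "x \<notin> p" using 3 by (simp add: p_def)
        \<comment> \<open>The contraction \<open>p\<close> is nonzero as it contains
          \<open>g\<close>, and differs from the maximal ideal as it does not contain
          \<open>x\<close>; so it is principal.\<close>
        ultimately obtain g0 where g0: "g0 \<in> D" "p = princ D g0" and "g \<in> p" "g \<noteq> 0"
          using primes[OF p] gens(1) by blast
        then have g0nz: "g0 \<noteq> 0" by (auto simp: princ_def)
        obtain r h where h: "h \<in> polys D" "h \<notin> polys M" "g0 = x ^ r * poly h t"
          using order_exists[OF g0(1) g0nz] by metis
        have hx: "poly h t \<notin> princ D' x" using in_princ_x_iff[OF h(1)] h(2) by blast
        have "x ^ r * poly h t \<in> P" using h(3) g0(2) self_in_princ[OF subring, of g0] p_def by auto
        then have hP: "poly h t \<in> P"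
          using prime_ideal_cases[OF P closed'(7)[OF x'] poly_in[OF h(1)]]
            prime_ideal_power[OF D'_subring P x'] 3 by blast
        have "P \<subseteq> princ D' (poly h t)"
        proof
          fix z assume z: "z \<in> P"
          obtain q n g where *: "q \<in> polys D" "poly q t \<notin> N" "g \<in> D" "g = x ^ n * (z * poly q t)"
            using clear_denominator[OF PD[OF z]] .
          have "g \<in> p" unfolding p_def
            using * z is_ideal_mult[OF PI closed'(7)[OF x']] is_ideal_mult2[OF PI poly_in[OF *(1)]] by auto
          then obtain d where d: "d \<in> D" "g = g0 * d" using g0(2) by (auto elim: princE)
          have "x ^ n * (z * poly q t) = poly h t * (x ^ r * d)"
            using *(4) d(2) h(3) by (simp only: mult.assoc mult.left_commute)
          moreover have "x ^ r * d \<in> D'" using d(1) D_sub x' by (intro closed')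
          ultimately have "x ^ n * (z * poly q t) \<in> princ D' (poly h t)" using princI by metis
          then have "z * poly q t \<in> princ D' (poly h t)"
            using power_cancel[OF _ poly_in[OF h(1)] hx] PD[OF z] poly_in[OF *(1)] closed'(5) by blast
          then show "z \<in> princ D' (poly h t)"
            using unit_cancel[OF is_ideal_princ[OF D'_subring poly_in[OF h(1)]] *(1,2)] by blast
        qed
        moreover have "princ D' (poly h t) \<subseteq> P" using hP is_ideal_mult2[OF PI] by (auto simp: princ_def)
        ultimately show ?thesis using poly_in[OF h(1)] by blast
      qed blast
    qed
  qed
qed

end

section \<open>Valuation rings\<close>

definition subfield :: "'a::field set \<Rightarrow> bool" where
  "subfield K \<longleftrightarrow> subring K \<and> (\<forall>a\<in>K. inverse a \<in> K)"

text \<open>The nonunits of \<open>V\<close>. Zero is listed separately since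
  \<open>inverse 0 = 0\<close> lies in \<open>V\<close>.\<close>

definition mv :: "'a::field set \<Rightarrow> 'a set" where
  "mv V = {v \<in> V. v = 0 \<or> inverse v \<notin> V}"

lemma qf_subset: "subring D \<Longrightarrow> D \<subseteq> qf D"
proof
  fix a assume "subring D" "a \<in> D"
  moreover have "a = a * inverse 1" by simp
  ultimately show "a \<in> qf D"
    unfolding qf_def using subring_one[of D] by (intro CollectI exI[of _ a] exI[of _ 1]) simp
qed

lemma subfield_qf:
  assumes D: "subring D"
  shows "subfield (qf D)"
  unfolding subfield_def
proof (intro conjI ballI)
  have "qf D = {a * inverse b | a b. a \<in> D \<and> b \<in> D - {0}}" by (auto simp: qf_def)
  then show "subring (qf D)"
    using subring_fractions(1)[OF D, of "D - {0}"] subring_one[OF D] subring_mult[OF D] by auto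
next
  fix u assume "u \<in> qf D"
  then obtain a b where *: "a \<in> D" "b \<in> D" "b \<noteq> 0" and u: "u = a * inverse b" unfolding qf_def by blast
  show "inverse u \<in> qf D"
  proof (cases "a = 0")
    case True
    then show ?thesis using u qf_subset[OF D] subring_zero[OF D] by auto
  next
    case False
    have "inverse u = b * inverse a" unfolding u by (simp add: mult.commute)
    then show ?thesis using * False unfolding qf_def by blast
  qed
qed

lemma qf_eq:
  assumes "subring D" "D \<subseteq> E" "E \<subseteq> qf D"
  shows "qf E = qf D"
proof
  show "qf E \<subseteq> qf D"
    using subfield_qf[OF assms(1)] assms(3) unfolding subfield_def qf_def[of E]
    by (auto intro!: subring_mult)
  show "qf D \<subseteq> qf E" using assms(2) unfolding qf_def by blast
qed

lemma valuation_subring: "valuation_ring_of K V \<Longrightarrow> subring V"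
  and valuation_sub: "valuation_ring_of K V \<Longrightarrow> V \<subseteq> K"
  and valuation_cases: "valuation_ring_of K V \<Longrightarrow> a \<in> K \<Longrightarrow> a \<noteq> 0 \<Longrightarrow> a \<in> V \<or> inverse a \<in> V"
  by (auto simp: valuation_ring_of_def)

lemma mv_prime:
  assumes K: "subfield K" and val: "valuation_ring_of K V"
  shows "prime_ideal V (mv V)"
proof -
  note V = valuation_subring[OF val]
  note cl = subring_closed[OF V]
  have add: "a + b \<in> mv V"
    if ab: "a \<in> mv V" "b \<in> mv V" "a \<noteq> 0" "b \<noteq> 0" "a * inverse b \<in> V" for a b
  proof -
    have "inverse (a + b) \<notin> V" if "a + b \<noteq> 0"
    proof
      assume "inverse (a + b) \<in> V"
      then have "(1 + a * inverse b) * inverse (a + b) \<in> V" using cl(5)[OF cl(3)[OF cl(2) ab(5)]] by blast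
      moreover have "(1 + a * inverse b) * inverse (a + b) = inverse b"
        using ab that by (simp add: divide_simps)
      ultimately show False using ab by (simp add: mv_def)
    qed
    then show ?thesis using ab cl(3) by (auto simp: mv_def)
  qed
  have "is_ideal V (mv V)"
    unfolding is_ideal_def
  proof (intro conjI ballI)
    show "mv V \<subseteq> V" "0 \<in> mv V" using cl(1) by (auto simp: mv_def)
    show "a + b \<in> mv V" if ab: "a \<in> mv V" "b \<in> mv V" for a b
    proof (cases "a = 0 \<or> b = 0")
      case False
      have "a \<in> K" "b \<in> K" using ab valuation_sub[OF val] by (auto simp: mv_def)
      then have "a * inverse b \<in> K"
        using K unfolding subfield_def by (auto intro: subring_mult)
      then consider "a * inverse b \<in> V" | "inverse (a * inverse b) \<in> V"
        using valuation_cases[OF val, of "a * inverse b"] False by auto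
      then show ?thesis
      proof cases
        case 1
        then show ?thesis using add ab False by blast
      next
        case 2
        then have "b * inverse a \<in> V" by (simp add: mult.commute)
        then show ?thesis using add[of b a] ab False by (simp add: add.commute)
      qed
    qed (use ab in auto)
    show "c * a \<in> mv V" if "c \<in> V" "a \<in> mv V" for c a
    proof (cases "c * a = 0")
      case False
      have "inverse (c * a) \<notin> V"
      proof
        assume "inverse (c * a) \<in> V"
        then have "c * inverse (c * a) \<in> V" using that by (intro cl)
        moreover have "c * inverse (c * a) = inverse a" using False by simp
        ultimately have "inverse a \<in> V" by (simp only:)
        then show False using that False by (simp add: mv_def)
      qed
      then show ?thesis using that cl(5) by (simp add: mv_def)
    qed (use cl(1) in \<open>auto simp: mv_def\<close>)
  qed
  moreover have "1 \<notin> mv V" by (simp add: mv_def cl(2))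
  then have "mv V \<noteq> V" using cl(2) by blast
  moreover have "a \<in> mv V \<or> b \<in> mv V" if "a \<in> V" "b \<in> V" "a * b \<in> mv V" for a b
    using that cl(5)[of "inverse a" "inverse b"] by (auto simp: mv_def)
  ultimately show ?thesis by (simp add: prime_ideal_def)
qed

lemma mv_antimono:
  assumes "valuation_ring_of K V" "valuation_ring_of K W" "V \<subseteq> W"
  shows "mv W \<subseteq> mv V"
proof
  fix a assume a: "a \<in> mv W"
  show "a \<in> mv V"
  proof (cases "a = 0")
    case True
    then show ?thesis using valuation_subring[OF assms(1)] by (simp add: mv_def subring_zero)
  next
    case False
    then have n: "inverse a \<notin> V" using a assms(3) by (auto simp: mv_def)
    moreover have "a \<in> K" using a valuation_sub[OF assms(2)] by (auto simp: mv_def)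
    ultimately show ?thesis using valuation_cases[OF assms(1)] False by (auto simp: mv_def)
  qed
qed

lemma subring_Union_chain:
  assumes "\<C> \<noteq> {}" "\<And>A. A \<in> \<C> \<Longrightarrow> subring A" "\<And>A B. A \<in> \<C> \<Longrightarrow> B \<in> \<C> \<Longrightarrow> A \<subseteq> B \<or> B \<subseteq> A"
  shows "subring (\<Union>\<C>)"
proof -
  have "a + b \<in> \<Union>\<C> \<and> a - b \<in> \<Union>\<C> \<and> a * b \<in> \<Union>\<C>" if "a \<in> \<Union>\<C>" "b \<in> \<Union>\<C>" for a b
  proof -
    from that obtain A B where "A \<in> \<C>" "B \<in> \<C>" "a \<in> A" "b \<in> B" by blast
    then obtain E where "E \<in> \<C>" "a \<in> E" "b \<in> E" using assms(3)[of A B] by blast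
    then show ?thesis using subring_closed(3-5)[OF assms(2)[of E]] by blast
  qed
  then show ?thesis
    unfolding subring_def using assms(1) subring_closed(1,2)[OF assms(2)] by blast
qed

lemma reverse_eval:
  assumes A: "subring A" and q: "q \<in> polys A" "degree q \<le> k" and s: "s \<noteq> 0"
  shows "\<exists>r\<in>polys A. degree r \<le> k \<and> poly r s = s ^ k * poly q (inverse s)"
proof -
  define r where "r = monom 1 (k - degree q) * reflect_poly q"
  have "reflect_poly q \<in> polys A"
    using polysD[OF q(1)] subring_zero[OF A] by (simp add: polys_def coeff_reflect_poly)
  then have "r \<in> polys A"
    unfolding r_def
    using polys_mult[OF is_ideal_self[OF A]] polys_monom[OF subring_zero[OF A] subring_one[OF A]] by blast
  moreover have "degree r \<le> k"
    unfolding r_def using degree_mult_le[of "monom 1 (k - degree q)" "reflect_poly q"]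
      degree_monom_le[of "1::'a" "k - degree q"] degree_reflect_poly_le[of q] q(2) by linarith
  moreover have "poly r s = s ^ k * poly q (inverse s)"
  proof -
    have "poly r s = s ^ (k - degree q) * (s ^ degree q * poly q (inverse s))"
      using s by (simp add: r_def poly_monom poly_reflect_poly_nz)
    also have "\<dots> = s ^ k * poly q (inverse s)"
      using q(2) by (simp add: mult.assoc[symmetric] power_add[symmetric])
    finally show ?thesis .
  qed
  ultimately show ?thesis by blast
qed

text \<open>A subring maximal among those not containing \<open>1/b\<close> is a valuation ring.\<close>

theorem chevalley_extension:
  assumes K: "subfield K" and B: "subring B" "B \<subseteq> K" and b: "b \<in> B" "b \<noteq> 0" "inverse b \<notin> B"
  shows "\<exists>W. valuation_ring_of K W \<and> B \<subseteq> W \<and> inverse b \<notin> W"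
proof -
  have Kr: "subring K" using K by (simp add: subfield_def)
  define \<A> where "\<A> = {A. subring A \<and> B \<subseteq> A \<and> A \<subseteq> K \<and> inverse b \<notin> A}"
  have "\<exists>W\<in>\<A>. \<forall>X\<in>\<A>. W \<subseteq> X \<longrightarrow> X = W"
  proof (rule subset_Zorn_nonempty)
    show "\<A> \<noteq> {}" using B b by (auto simp: \<A>_def)
    fix \<C> assume C: "\<C> \<noteq> {}" "subset.chain \<A> \<C>"
    then have sub: "\<C> \<subseteq> \<A>" by (auto simp: subset.chain_def)
    have "subring (\<Union>\<C>)"
      using C sub by (intro subring_Union_chain) (auto simp: subset.chain_def \<A>_def)
    moreover have "B \<subseteq> \<Union>\<C>" using C(1) sub by (auto simp: \<A>_def)
    ultimately show "\<Union>\<C> \<in> \<A>" using sub by (auto simp: \<A>_def)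
  qed
  then obtain A where A: "subring A" "B \<subseteq> A" "A \<subseteq> K" "inverse b \<notin> A"
    and max: "\<And>X. subring X \<Longrightarrow> A \<subseteq> X \<Longrightarrow> X \<subseteq> K \<Longrightarrow> inverse b \<notin> X \<Longrightarrow> X = A"
    unfolding \<A>_def by (auto dest: order_trans)
  note cl = subring_closed[OF A(1)] and self = is_ideal_self[OF A(1)]
  have bA: "b \<in> A" using b A by blast
  have nonunit: "1 \<noteq> b * a" if "a \<in> A" for a
    using that A(4) by (metis inverse_unique)
  \<comment> \<open>Inverting all \<open>1 - b * e\<close> does not bring in \<open>1/b\<close>:
    such an equation would clear to \<open>1 = b * (c + e)\<close>. By maximality these inverses are
    in \<open>A\<close> already.\<close>
  have unit: "inverse (1 - b * a) \<in> A" if a: "a \<in> A" for a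
  proof -
    have nz: "1 - b * e \<noteq> 0" if "e \<in> A" for e using nonunit[OF that] by auto
    define L where "L = {c * inverse (1 - b * e) | c e. c \<in> A \<and> e \<in> A}"
    define S where "S = {1 - b * e | e. e \<in> A}"
    have Leq: "L = {c * inverse s | c s. c \<in> A \<and> s \<in> S}" unfolding L_def S_def by blast
    have "S \<subseteq> A" unfolding S_def using cl(4)[OF cl(2) cl(5)[OF bA]] by blast
    moreover have "1 \<in> S" using cl(1) unfolding S_def by (intro CollectI exI[of _ 0]) simp
    moreover have "0 \<notin> S" unfolding S_def using nz by auto
    moreover have "s * r \<in> S" if sr: "s \<in> S" "r \<in> S" for s r
    proof -
      obtain e e' where *: "e \<in> A" "e' \<in> A" "s = 1 - b * e" "r = 1 - b * e'"
        using sr unfolding S_def by blast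
      have "s * r = 1 - b * (e + e' - b * e * e')" unfolding *(3,4) by (simp add: algebra_simps)
      moreover have "e + e' - b * e * e' \<in> A" using * bA by (intro cl)
      ultimately show ?thesis unfolding S_def by blast
    qed
    ultimately have AL: "A \<subseteq> L" and "subring L"
      unfolding Leq using subring_fractions[OF A(1), of S] by blast+
    moreover have "L \<subseteq> K"
    proof
      fix z assume "z \<in> L"
      then obtain c e where "c \<in> A" "e \<in> A" "z = c * inverse (1 - b * e)" unfolding L_def by blast
      moreover have "1 - b * e \<in> K"
        using A(3) cl(4)[OF cl(2) cl(5)[OF bA \<open>e \<in> A\<close>]] by blast
      ultimately show "z \<in> K" using K A(3) subring_mult[OF Kr] unfolding subfield_def by blast
    qed
    moreover have "inverse b \<notin> L"
    proof
      assume "inverse b \<in> L"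
      then obtain c e where *: "c \<in> A" "e \<in> A" "inverse b = c * inverse (1 - b * e)" unfolding L_def by blast
      then have "1 = b * (c * inverse (1 - b * e))" using b(2) by (metis right_inverse)
      then have "1 - b * e = b * c" using nz[OF *(2)] by (simp add: field_simps)
      then have "1 = b * (c + e)" by (simp add: algebra_simps)
      then show False using nonunit[OF cl(3)[OF *(1,2)]] by blast
    qed
    ultimately have "L = A" using max AL by blast
    moreover have "1 * inverse (1 - b * a) \<in> L" unfolding L_def using a cl(2) by blast
    ultimately show ?thesis by simp
  qed
  have expr: "\<exists>p\<in>polys A. 1 = b * poly p s" if "s \<in> K" "s \<notin> A" for s
  proof -
    have "adjoin A s \<subseteq> K"
      using poly_in_subring[OF Kr that(1)] polys_mono[OF A(3)] by (auto simp: adjoin_def)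
    then have "inverse b \<in> adjoin A s"
      using max[OF adjoin_subring(1,2)[OF A(1)]] adjoin_subring(3)[OF A(1), of s] that(2) by blast
    then show ?thesis using b(2) by (auto simp: adjoin_def) (metis right_inverse)
  qed
  \<comment> \<open>If neither \<open>s\<close> nor \<open>1/s\<close> is in \<open>A\<close>, both
    satisfy an equation \<open>1 = b * p\<close>. The one of smaller degree is used to shorten the
    other, contradicting a choice of minimal degrees.\<close>
  have reduce: "\<exists>p'\<in>polys A. 1 = b * poly p' s \<and> degree p' < degree p"
    if s: "s \<noteq> 0" and p: "p \<in> polys A" "1 = b * poly p s"
      and q: "q \<in> polys A" "1 = b * poly q (inverse s)" and deg: "degree q \<le> degree p" for s p q
  proof -
    have dp: "degree p > 0"
    proof (rule ccontr)
      assume "\<not> degree p > 0"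
      then obtain c where "p = [:c:]" using degree_eq_zeroE by blast
      then show False using nonunit[of c] p polysD[OF p(1), of 0] by simp
    qed
    then obtain n where n: "degree p = Suc n" using gr0_implies_Suc by blast
    obtain q0 q1 where qq: "q = pCons q0 q1" by (cases q)
    have q01: "q0 \<in> A" "q1 \<in> polys A" using q(1) polys_pConsD unfolding qq by blast+
    define u where "u = inverse (1 - b * q0)"
    have u: "u \<in> A" "u * (1 - b * q0) = 1"
      using unit[OF q01(1)] nonunit[OF q01(1)] by (auto simp: u_def)
    have "1 - b * q0 = b * (inverse s * poly q1 (inverse s))" using q(2) by (simp add: qq algebra_simps)
    then have one: "1 = u * (b * (inverse s * poly q1 (inverse s)))" using u(2) by simp
    have "degree q1 \<le> n" using deg n by (cases "q1 = 0") (auto simp: qq)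
    then obtain r where r: "r \<in> polys A" "degree r \<le> n" "poly r s = s ^ n * poly q1 (inverse s)"
      using reverse_eval[OF A(1) q01(2) _ s] by blast
    \<comment> \<open>The constant term of \<open>q\<close> is moved to the left, where
      \<open>1 - b * q0\<close> is a unit; multiplication by \<open>s ^ Suc n\<close> then expresses
      this power through lower ones, and it replaces the leading term of \<open>p\<close>.\<close>
    have sn: "s ^ Suc n = u * b * poly r s"
    proof -
      have "s ^ Suc n * 1 = s ^ Suc n * (u * (b * (inverse s * poly q1 (inverse s))))"
        using one by simp
      also have "\<dots> = u * b * poly r s" using s unfolding r(3) by simp
      finally show ?thesis by simp
    qed
    define c where "c = coeff p (Suc n)"
    have c: "c \<in> A" unfolding c_def by (rule polysD[OF p(1)])
    obtain p0 where p0: "p0 \<in> polys A" "degree p0 \<le> n" "p = p0 + monom c (Suc n)"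
      using polys_split_top[OF cl(1) p(1), of n] n unfolding c_def by auto
    define p' where "p' = p0 + monom (c * u * b) 0 * r"
    have "p' \<in> polys A"
      unfolding p'_def using p0 r c u bA cl
      by (intro polys_add[OF self] polys_mult[OF self] polys_monom) auto
    moreover have "degree p' \<le> n"
      unfolding p'_def
    proof (rule degree_add_le[OF p0(2)])
      show "degree (monom (c * u * b) 0 * r) \<le> n"
        using degree_mult_le[of "monom (c * u * b) 0" r] degree_monom_le[of "c * u * b" 0] r(2) by linarith
    qed
    moreover have "poly p' s = poly p s"
      unfolding p'_def p0(3) by (simp only: poly_add poly_mult poly_monom sn) (simp add: mult.assoc)
    ultimately show ?thesis using p(2) n by (intro bexI[of _ p']) auto
  qed
  have "s \<in> A \<or> inverse s \<in> A" if s: "s \<in> K" "s \<noteq> 0" for s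
  proof (rule ccontr)
    assume n: "\<not> (s \<in> A \<or> inverse s \<in> A)"
    have sK: "inverse s \<in> K" using K s by (simp add: subfield_def)
    obtain p where p: "p \<in> polys A" "1 = b * poly p s"
      and pmin: "\<And>p'. p' \<in> polys A \<Longrightarrow> 1 = b * poly p' s \<Longrightarrow> degree p \<le> degree p'"
      using expr[OF s(1)] n ex_has_least_nat[of "\<lambda>p. p \<in> polys A \<and> 1 = b * poly p s" _ degree] by blast
    obtain q where q: "q \<in> polys A" "1 = b * poly q (inverse s)"
      and qmin: "\<And>p'. p' \<in> polys A \<Longrightarrow> 1 = b * poly p' (inverse s) \<Longrightarrow> degree q \<le> degree p'"
      using expr[OF sK] n ex_has_least_nat[of "\<lambda>p. p \<in> polys A \<and> 1 = b * poly p (inverse s)" _ degree]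
      by blast
    show False
    proof (cases "degree q \<le> degree p")
      case True
      then show False using reduce[OF s(2) p q] pmin by (meson not_le)
    next
      case False
      then show False using reduce[of "inverse s" q p] s(2) p q qmin by (metis inverse_inverse_eq nle_le nonzero_imp_inverse_nonzero not_le)
    qed
  qed
  then have "valuation_ring_of K A" using A by (simp add: valuation_ring_of_def)
  then show ?thesis using A by blast
qed

text \<open>Zorn's lemma is applied to complements because a minimal ring is wanted. The
  intersection of a chain is a valuation ring: if \<open>a\<close> and \<open>1/a\<close> were both
  missing from it, some single member would miss both.\<close>

lemma minimal_valuation_below:
  assumes "subring D" and W: "valuation_overring D W"
  shows "\<exists>V. minimal_valuation_overring D V \<and> V \<subseteq> W"
proof -
  define \<A> where "\<A> = {- V | V. valuation_overring D V \<and> V \<subseteq> W}"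
  have "\<exists>X\<in>\<A>. \<forall>Y\<in>\<A>. X \<subseteq> Y \<longrightarrow> Y = X"
  proof (rule subset_Zorn_nonempty)
    show "\<A> \<noteq> {}" using W by (auto simp: \<A>_def)
    fix \<C> assume C: "\<C> \<noteq> {}" "subset.chain \<A> \<C>"
    then have sub: "\<C> \<subseteq> \<A>" by (auto simp: subset.chain_def)
    define R where "R = - \<Union>\<C>"
    have val: "valuation_overring D (- X) \<and> - X \<subseteq> W" if "X \<in> \<C>" for X
      using that sub by (auto simp: \<A>_def)
    then have sr: "subring (- X)" "- X \<subseteq> qf D" "D \<subseteq> - X" if "X \<in> \<C>" for X
      using that by (auto simp: valuation_overring_def valuation_ring_of_def)
    have Rdef: "a \<in> R \<longleftrightarrow> (\<forall>X\<in>\<C>. a \<in> - X)" for a by (auto simp: R_def)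
    have "subring R"
      unfolding subring_def
    proof (intro conjI ballI)
      show "0 \<in> R" "1 \<in> R" unfolding Rdef using subring_closed(1,2)[OF sr(1)] by blast+
      fix a b assume ab: "a \<in> R" "b \<in> R"
      show "a + b \<in> R" "a - b \<in> R" "a * b \<in> R"
        unfolding Rdef using ab[unfolded Rdef] subring_closed(3-5)[OF sr(1)] by meson+
    qed
    moreover have "a \<in> R \<or> inverse a \<in> R" if a: "a \<in> qf D" "a \<noteq> 0" for a
    proof (rule ccontr)
      assume "\<not> (a \<in> R \<or> inverse a \<in> R)"
      then obtain X Y where XY: "X \<in> \<C>" "Y \<in> \<C>" "a \<in> X" "inverse a \<in> Y" by (auto simp: R_def)
      have "X \<subseteq> Y \<or> Y \<subseteq> X" using C(2) XY(1,2) by (simp add: subset_chain_def)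
      then obtain Z where "Z \<in> \<C>" "a \<in> Z" "inverse a \<in> Z" using XY by blast
      then show False
        using val[of Z] a valuation_cases[of "qf D" "- Z" a] by (auto simp: valuation_overring_def)
    qed
    moreover have "R \<subseteq> W" "D \<subseteq> R" "R \<subseteq> qf D"
      using C(1) val sr by (auto simp: Rdef subset_iff)
    ultimately have "valuation_overring D R \<and> R \<subseteq> W"
      by (auto simp: valuation_overring_def valuation_ring_of_def)
    then show "\<Union>\<C> \<in> \<A>" unfolding \<A>_def R_def by (auto intro!: exI[of _ "- \<Union>\<C>"])
  qed
  then obtain X where X: "X \<in> \<A>" "\<And>Y. Y \<in> \<A> \<Longrightarrow> X \<subseteq> Y \<Longrightarrow> Y = X" by blast
  then obtain V where V: "X = - V" "valuation_overring D V" "V \<subseteq> W" by (auto simp: \<A>_def)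
  have "V' = V" if "valuation_overring D V'" "V' \<subseteq> V" for V'
  proof -
    have "- V' \<in> \<A>" using that V(3) by (auto simp: \<A>_def)
    then have "- V' = - V" using X(2)[of "- V'"] that V(1) by blast
    then show ?thesis by blast
  qed
  then show ?thesis using V by (auto simp: minimal_valuation_overring_def)
qed

section \<open>Minimal valuation overrings\<close>

locale minval =
  fixes D V :: "'a::field set"
  assumes D_subring: "subring D" and minimal: "minimal_valuation_overring D V"
begin

lemma val: "valuation_ring_of (qf D) V" and D_V: "D \<subseteq> V"
  using minimal by (auto simp: minimal_valuation_overring_def valuation_overring_def)

lemmas V_subring = valuation_subring[OF val]
lemmas K_subfield = subfield_qf[OF D_subring]
lemmas mv_prime = mv_prime[OF K_subfield val]
lemmas mv_ideal = prime_ideal_ideal[OF mv_prime]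

text \<open>Otherwise a valuation ring \<open>W\<close> above \<open>B\<close> omits
  \<open>1/b\<close>. An element \<open>a\<close> of \<open>W\<close> outside \<open>V\<close> would
  have \<open>1/a\<close>, hence \<open>(1/a) * (1/b)\<close>, in \<open>mv V\<close>, which is part
  of \<open>B\<close>; multiplying by \<open>a\<close> would put \<open>1/b\<close> into
  \<open>W\<close>. So \<open>W\<close> is contained in \<open>V\<close>, and minimality gives
  equality, although \<open>1/b\<close> is in \<open>V\<close>.\<close>

lemma minimal_unit:
  assumes B: "subring B" "D \<subseteq> B" "mv V \<subseteq> B" "B \<subseteq> V" and b: "b \<in> B" "b \<notin> mv V"
  shows "inverse b \<in> B"
proof (rule ccontr)
  assume n: "inverse b \<notin> B"
  have bV: "b \<noteq> 0" "inverse b \<in> V" using b B(4) subring_zero[OF V_subring] by (auto simp: mv_def)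
  obtain W where W: "valuation_ring_of (qf D) W" "B \<subseteq> W" "inverse b \<notin> W"
    using chevalley_extension[OF K_subfield B(1) _ b(1) bV(1) n] B(4) valuation_sub[OF val] by blast
  have "W \<subseteq> V"
  proof
    fix a assume a: "a \<in> W"
    show "a \<in> V"
    proof (rule ccontr)
      assume aV: "a \<notin> V"
      then have a0: "a \<noteq> 0" using subring_zero[OF V_subring] by auto
      then have "inverse a \<in> V" using valuation_cases[OF val] a valuation_sub[OF W(1)] aV by blast
      then have "inverse a \<in> mv V" using aV by (simp add: mv_def)
      then have "inverse a * inverse b \<in> mv V" using is_ideal_mult2[OF mv_ideal bV(2)] by blast
      then have "a * (inverse a * inverse b) \<in> W"
        using B(3) W(2) a subring_mult[OF valuation_subring[OF W(1)]] by blast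
      moreover have "a * (inverse a * inverse b) = inverse b" using a0 by simp
      ultimately show False using W(3) by simp
    qed
  qed
  then have "W = V"
    using minimal W B(2) by (auto simp: minimal_valuation_overring_def valuation_overring_def)
  then show False using W(3) bV(2) by blast
qed

text \<open>If \<open>a\<close> in \<open>M\<close> were a unit of \<open>V\<close>, then
  \<open>1/a = d + v\<close> in the ring \<open>D + mv V\<close>, so \<open>1 - a * d\<close> would
  be in \<open>mv V\<close> while being a unit of \<open>D\<close>.\<close>

lemma dominates:
  assumes "rlr2 D x y"
  shows "lin D x y \<subseteq> mv V"
proof
  interpret rlr2 D x y by fact
  fix a assume a: "a \<in> M"
  show "a \<in> mv V"
  proof (rule ccontr)
    assume n: "a \<notin> mv V"
    define B where "B = {d + v | d v. d \<in> D \<and> v \<in> mv V}"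
    note B = subring_add_ideal[OF V_subring D_subring D_V mv_ideal, folded B_def]
    have "inverse a \<in> B"
      using minimal_unit[OF B(1-4)] B(2) n M_sub[OF a] by blast
    then obtain d v where dv: "d \<in> D" "v \<in> mv V" "inverse a = d + v" unfolding B_def by blast
    have a0: "a \<noteq> 0" using n is_ideal_zero[OF mv_ideal] by auto
    have "1 - a * d = a * v" using dv(3) a0 by (metis add_diff_cancel_left' distrib_left right_inverse)
    then have "1 - a * d \<in> mv V"
      using dv(2) D_V M_sub[OF a] is_ideal_mult[OF mv_ideal] by auto
    moreover have "1 - a * d \<noteq> 0 \<and> inverse (1 - a * d) \<in> D"
      using unit_one_minus[OF subring xD yD one_notin unit a dv(1)] .
    ultimately show False using D_V by (auto simp: mv_def)
  qed
qed

text \<open>If \<open>t\<close> is a unit of \<open>V\<close>, it is one of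
  \<open>D[t] + mv V\<close>, so \<open>1/t = poly q t + v\<close>. Then \<open>1 - X q\<close>
  evaluates into \<open>mv V\<close>, and its constant coefficient 1 keeps it out of
  \<open>M[X]\<close>.\<close>

lemma residue_algebraic:
  assumes "rlr2 D x y" and tV: "t \<in> V"
  shows "\<exists>p\<in>polys D. p \<notin> polys (lin D x y) \<and> poly p t \<in> mv V"
proof (cases "t \<in> mv V")
  case True
  interpret rlr2 D x y by fact
  have "[:0, 1:] \<in> polys D" using closed(1,2) by (intro polys_pCons polys_zero)
  moreover have "[:0, 1:] \<notin> polys M" using polysD[of "[:0, 1:]" M 1] one_notin by auto
  ultimately show ?thesis using True by (intro bexI[of _ "[:0, 1:]"]) auto
next
  case False
  interpret rlr2 D x y by fact
  define B where "B = {a + v | a v. a \<in> adjoin D t \<and> v \<in> mv V}"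
  note ad = adjoin_subring[OF subring, of t]
  have adV: "adjoin D t \<subseteq> V"
    using poly_in_subring[OF V_subring tV] polys_mono[OF D_V] by (auto simp: adjoin_def)
  note B = subring_add_ideal[OF V_subring ad(1) adV mv_ideal, folded B_def]
  have "inverse t \<in> B"
    using minimal_unit[OF B(1) _ B(3,4)] False B(2) ad(2,3) by blast
  then obtain q v where qv: "q \<in> polys D" "v \<in> mv V" "inverse t = poly q t + v"
    unfolding B_def adjoin_def by blast
  have t0: "t \<noteq> 0" using False is_ideal_zero[OF mv_ideal] by auto
  define p where "p = 1 - pCons 0 q"
  have "1 = t * (poly q t + v)" using t0 qv(3) by (metis right_inverse)
  then have "poly p t = t * v" by (simp add: p_def algebra_simps)
  then have "poly p t \<in> mv V" using qv(2) tV is_ideal_mult[OF mv_ideal] by simp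
  moreover have "p \<in> polys D"
    unfolding p_def one_pCons using qv(1) closed(1,2) polys_closed(6) by (intro polys_closed polys_pCons)
  moreover have "p \<notin> polys M"
    using polysD[of p M 0] one_notin by (auto simp: p_def)
  ultimately show ?thesis by blast
qed

lemma quadratic_exists:
  assumes R: "rlr2 D x y" and tV: "y * inverse x \<in> V"
  shows "\<exists>m. quadratic D x y V (mv V) m"
proof -
  interpret rlr2 D x y by fact
  define Q where "Q p \<longleftrightarrow> p \<in> polys D \<and> p \<notin> polys M \<and> poly p t \<in> mv V" for p
  have "\<exists>p. Q p" using residue_algebraic[OF R tV] unfolding Q_def by blast
  then obtain p where p: "Q p" and pmin: "\<And>q. Q q \<Longrightarrow> degree p \<le> degree q"
    using ex_has_least_nat[of Q _ degree] by blast
  have pD: "p \<in> polys D" and pM: "p \<notin> polys M" and pN: "poly p t \<in> mv V" using p by (auto simp: Q_def)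
  define c where "c = lead_coeff p"
  have cD: "c \<in> D" unfolding c_def by (rule polysD[OF pD])
  \<comment> \<open>A leading term with coefficient in \<open>M\<close> could be dropped: the value
    stays in \<open>mv V\<close>, and the rest is still nonzero modulo \<open>M\<close>. Minimal
    degree therefore forces a unit, and \<open>p\<close> can be made monic.\<close>
  have cM: "c \<notin> M"
  proof
    assume c: "c \<in> M"
    then have c': "c \<in> mv V" using dominates[OF R] by blast
    show False
    proof (cases "degree p")
      case 0
      then obtain a where "p = [:a:]" using degree_eq_zeroE by blast
      then show False using pM c polys_const[OF zero_in] by (simp add: c_def)
    next
      case (Suc n)
      obtain q where q: "q \<in> polys D" "degree q \<le> n" "p = q + monom c (Suc n)"
        using polys_split_top[OF closed(1) pD, of n] Suc unfolding c_def by auto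
      have "q \<notin> polys M"
        using pM q(3) polys_add[OF M_ideal] polys_monom[OF zero_in c] by blast
      moreover have "poly q t \<in> mv V"
      proof -
        have "poly q t = poly p t - c * t ^ Suc n" unfolding q(3) by (simp add: poly_monom)
        also have "\<dots> \<in> mv V"
          using pN is_ideal_diff[OF V_subring mv_ideal]
            is_ideal_mult2[OF mv_ideal subring_power[OF V_subring tV] c'] by blast
        finally show ?thesis .
      qed
      ultimately have "degree p \<le> degree q" using pmin q(1) by (simp add: Q_def)
      then show False using q(2) Suc by simp
    qed
  qed
  have c0: "c \<noteq> 0" using cM zero_in by auto
  have ci: "inverse c \<in> D" using unit[OF cD cM] .
  define m where "m = smult (inverse c) p"
  have "quadratic D x y V (mv V) m"
  proof
    show "subring V" "prime_ideal V (mv V)" "D \<subseteq> V" "M \<subseteq> mv V" "t \<in> V"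
      by (fact V_subring mv_prime D_V dominates[OF R] tV)+
    show "inverse v \<in> V" if "v \<in> V" "v \<notin> mv V" for v using that by (simp add: mv_def)
    show "m \<in> polys D" unfolding m_def polys_def using polysD[OF pD] ci closed(5) by simp
    show "lead_coeff m = 1" using c0 by (simp add: m_def c_def)
    show "poly m t \<in> mv V"
      unfolding m_def using pN ci D_V is_ideal_mult[OF mv_ideal] by auto
    show "q \<in> polys M" if "q \<in> polys D" "degree q < degree m" "poly q t \<in> mv V" for q
      using pmin[of q] that c0 by (auto simp: Q_def m_def)
  qed
  then show ?thesis ..
qed

lemma minval_extend:
  assumes "subring E" "D \<subseteq> E" "E \<subseteq> V"
  shows "minval E V" "qf E = qf D"
proof -
  show q: "qf E = qf D" using qf_eq[OF D_subring assms(2)] assms(3) valuation_sub[OF val] by blast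
  show "minval E V"
  proof
    show "minimal_valuation_overring E V"
      using minimal assms q unfolding minimal_valuation_overring_def valuation_overring_def
      by (metis order_trans)
  qed fact
qed

end

section \<open>The sequence of quadratic transforms along a minimal valuation overring\<close>

text \<open>The parameters are ordered so that \<open>Y n / X n\<close> lies in \<open>V\<close>.
  They are exchanged only if the ratio after the exchange is in \<open>mv V\<close>; this strictness
  is used in comparing multiplicities.\<close>

locale qseq =
  fixes V :: "'a::field set" and E :: "nat \<Rightarrow> 'a set" and X Y :: "nat \<Rightarrow> 'a" and m :: "nat \<Rightarrow> 'a poly"
  assumes quad: "quadratic (E n) (X n) (Y n) V (mv V) (m n)"
    and minval: "minval (E n) V"
    and E_Suc: "E (Suc n) = quad_ring (E n) (mv V) (Y n * inverse (X n))"
    and XY_Suc: "X (Suc n) = X n \<and> Y (Suc n) = poly (m n) (Y n * inverse (X n))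
      \<or> X (Suc n) = poly (m n) (Y n * inverse (X n)) \<and> Y (Suc n) = X n
        \<and> Y (Suc n) * inverse (X (Suc n)) \<in> mv V"

text \<open>Dependent choice over tuples of a ring, two parameters and a polynomial. It can continue
  because \<open>V\<close> remains a minimal valuation overring of each transform, which supplies
  the next polynomial.\<close>

lemma qseq_exists:
  assumes reg: "regular_local_2 D" and min: "minimal_valuation_overring D V"
  shows "\<exists>E X Y m. qseq V E X Y m \<and> E 0 = D"
proof -
  define good where "good s \<longleftrightarrow> (case s of (A, x, y, p) \<Rightarrow> quadratic A x y V (mv V) p \<and> minval A V)"
    for s :: "'a set \<times> 'a \<times> 'a \<times> 'a poly"
  define nxt where "nxt s s' \<longleftrightarrow> (case s of (A, x, y, p) \<Rightarrow> case s' of (A', x', y', p') \<Rightarrow>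
      A' = quad_ring A (mv V) (y * inverse x) \<and>
      (x' = x \<and> y' = poly p (y * inverse x)
       \<or> x' = poly p (y * inverse x) \<and> y' = x \<and> y' * inverse x' \<in> mv V))"
    for s s' :: "'a set \<times> 'a \<times> 'a \<times> 'a poly"
  have D: "subring D" using reg by (simp add: regular_local_2_def local_ring_def)
  interpret D: minval D V by unfold_locales (fact D min)+
  have ex: "\<exists>p. good (A, x, y, p)" if "rlr2 A x y" "minval A V" "y * inverse x \<in> V" for A x y
    using minval.quadratic_exists[OF that(2,1,3)] that(2) by (auto simp: good_def)
  have ratio: "y * inverse x \<in> V \<or> x * inverse y \<in> mv V" if "x \<in> V" "y \<in> V" "x \<noteq> 0" for x y
  proof (cases "y = 0")
    case True
    then show ?thesis using subring_zero[OF D.V_subring] by simp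
  next
    case False
    have "y * inverse x \<in> qf D"
      using that D.K_subfield valuation_sub[OF D.val] unfolding subfield_def
      by (intro subring_mult) auto
    then have "y * inverse x \<in> V \<or> inverse (y * inverse x) \<in> V"
      using valuation_cases[OF D.val, of "y * inverse x"] False that(3) by auto
    then show ?thesis using False that(3) by (auto simp: mv_def mult.commute)
  qed
  obtain M where M: "maximal_ideal D M" using reg by (auto simp: regular_local_2_def local_ring_def)
  obtain x y where xy: "M = ideal_gen D {x, y}" using reg M by (auto simp: regular_local_2_def)
  then have R: "rlr2 D x y" using rlr2_of_regular[OF reg] M ideal_gen_pair[OF D] by simp
  have "\<exists>s. good s \<and> fst s = D"
  proof -
    have xyV: "x \<in> V" "y \<in> V" "x \<noteq> 0" using rlr2.xD[OF R] rlr2.yD[OF R] rlr2.x_nonzero[OF R] D.D_V by auto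
    from ratio[OF this] show ?thesis
    proof
      assume "y * inverse x \<in> V"
      then show ?thesis using ex[OF R D.minval_axioms] by force
    next
      assume "x * inverse y \<in> mv V"
      then have "x * inverse y \<in> V" by (simp add: mv_def)
      then show ?thesis using ex[OF rlr2.swap[OF R] D.minval_axioms] by force
    qed
  qed
  then obtain s0 where s0: "good s0" "fst s0 = D" by blast
  have step: "\<exists>s'. (good s') \<and> nxt s s'" if "good s" for s
  proof -
    obtain A x y p where s: "s = (A, x, y, p)" by (cases s)
    interpret Q: quadratic A x y V "mv V" p using that by (simp add: good_def s)
    interpret A: minval A V using that by (simp add: good_def s)
    have mA: "minval Q.D' V"
      using A.minval_extend(1)[OF Q.D'_subring] Q.D_sub Q.D'_V by blast
    have R': "rlr2 Q.D' x (poly p Q.t)" by (rule Q.quad_rlr2)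
    have xyV: "x \<in> V" "poly p Q.t \<in> V" "x \<noteq> 0" using Q.xD Q.DV Q.polys_V[OF Q.m_poly] Q.x_nonzero by auto
    from ratio[OF this] show ?thesis
    proof
      assume "poly p Q.t * inverse x \<in> V"
      then obtain p' where "good (Q.D', x, poly p Q.t, p')" using ex[OF R' mA] by blast
      then show ?thesis by (intro exI[of _ "(Q.D', x, poly p Q.t, p')"]) (auto simp: s nxt_def)
    next
      assume *: "x * inverse (poly p Q.t) \<in> mv V"
      then have "x * inverse (poly p Q.t) \<in> V" by (simp add: mv_def)
      then obtain p' where "good (Q.D', poly p Q.t, x, p')" using ex[OF rlr2.swap[OF R'] mA] by blast
      then show ?thesis using *
        by (intro exI[of _ "(Q.D', poly p Q.t, x, p')"]) (auto simp: s nxt_def)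
    qed
  qed
  obtain F where F: "\<And>n. good (F n)" "\<And>n. nxt (F n) (F (Suc n))" "F 0 = s0"
    using dependent_nat_choice[of "\<lambda>n s. good s \<and> (n = 0 \<longrightarrow> s = s0)" "\<lambda>n s s'. nxt s s'"] s0 step
    by (metis nat.simps(3))
  define E X Y m where "E n = fst (F n)" and "X n = fst (snd (F n))" and "Y n = fst (snd (snd (F n)))"
    and "m n = snd (snd (snd (F n)))" for n
  have Feq: "F n = (E n, X n, Y n, m n)" for n by (simp add: E_def X_def Y_def m_def)
  have "qseq V E X Y m"
  proof (rule qseq.intro)
    fix n
    show "quadratic (E n) (X n) (Y n) V (mv V) (m n)" "minval (E n) V"
      using F(1)[of n] unfolding Feq by (simp_all add: good_def)
    show "E (Suc n) = quad_ring (E n) (mv V) (Y n * inverse (X n))"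
      "X (Suc n) = X n \<and> Y (Suc n) = poly (m n) (Y n * inverse (X n))
      \<or> X (Suc n) = poly (m n) (Y n * inverse (X n)) \<and> Y (Suc n) = X n
        \<and> Y (Suc n) * inverse (X (Suc n)) \<in> mv V"
      using F(2)[of n] unfolding Feq by (auto simp: nxt_def)
  qed
  moreover have "E 0 = D" using F(3) s0(2) by (simp add: E_def)
  ultimately show ?thesis by blast
qed

section \<open>Multiplicities along the sequence\<close>

context qseq
begin

abbreviation T where "T n \<equiv> Y n * inverse (X n)"

lemma rlr2_E: "rlr2 (E n) (X n) (Y n)" using quad[of n] by (simp add: quadratic_def)

lemma rlr2_Suc: "rlr2 (E (Suc n)) (X n) (poly (m n) (T n))"
  unfolding E_Suc by (rule quadratic.quad_rlr2[OF quad])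

lemma E_subring: "subring (E n)" by (rule rlr2.subring[OF rlr2_E])

lemma E_V: "E n \<subseteq> V" by (rule quadratic.DV[OF quad])

lemma X_nonzero: "X n \<noteq> 0" by (rule rlr2.x_nonzero[OF rlr2_E])

lemma X_in: "X n \<in> E n" by (rule rlr2.xD[OF rlr2_E])

lemma E_mono_Suc: "E n \<subseteq> E (Suc n)"
  unfolding E_Suc using quadratic.D_sub[OF quad] by blast

lemma E_mono: "i \<le> j \<Longrightarrow> E i \<subseteq> E j"
  using E_mono_Suc lift_Suc_mono_le by blast

lemma T_in: "T n \<in> E (Suc n)" unfolding E_Suc by (rule quadratic.t_in[OF quad])

lemma V_subring: "subring V" by (rule quadratic.V[OF quad])

lemma mv_prime: "prime_ideal V (mv V)" by (rule quadratic.N_prime[OF quad])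

lemmas mv_ideal = prime_ideal_ideal[OF mv_prime]

lemma mv_one: "1 \<notin> mv V" by (rule prime_ideal_one[OF mv_prime])

lemma E_max: "lin (E n) (X n) (Y n) = E n \<inter> mv V"
proof
  interpret Q: quadratic "E n" "X n" "Y n" V "mv V" "m n" by (rule quad)
  show "Q.M \<subseteq> E n \<inter> mv V" using Q.MN Q.M_sub by blast
  show "E n \<inter> mv V \<subseteq> Q.M"
  proof
    fix a assume a: "a \<in> E n \<inter> mv V"
    show "a \<in> Q.M"
    proof (rule ccontr)
      assume n: "a \<notin> Q.M"
      then have "inverse a \<in> V" using Q.unit a E_V by blast
      moreover have "a \<noteq> 0" using n Q.zero_in by auto
      ultimately show False using a by (simp add: mv_def)
    qed
  qed
qed

lemma E_unit: "a \<in> E n \<Longrightarrow> a \<notin> mv V \<Longrightarrow> inverse a \<in> E n"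
  using rlr2.unit[OF rlr2_E] E_max by blast

lemma X_mv: "X n \<in> mv V" using E_max rlr2.gens(1)[OF rlr2_E] by blast

text \<open>The maximal ideal of \<open>E n\<close> becomes principal in \<open>E (Suc n)\<close>,
  generated by \<open>X n\<close>.\<close>

lemma E_divide:
  assumes "a \<in> E n" "a \<in> mv V"
  obtains d where "d \<in> E (Suc n)" "a = X n * d"
proof -
  obtain p q where pq: "p \<in> E n" "q \<in> E n" "a = p * X n + q * Y n" using assms E_max by (metis IntI linE)
  have "a = X n * (p + q * T n)" using pq(3) X_nonzero by (simp add: field_simps)
  moreover have "p + q * T n \<in> E (Suc n)"
    using subring_add[OF E_subring _ subring_mult[OF E_subring _ T_in]] pq(1,2) E_mono_Suc by blast
  ultimately show ?thesis using that by blast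
qed

text \<open>For \<open>g\<close> in \<open>E n\<close> this is its order with respect to the maximal
  ideal of \<open>E n\<close>, read off as the exact power of \<open>X n\<close> dividing it in
  \<open>E (Suc n)\<close>.\<close>

definition ordr :: "nat \<Rightarrow> 'a \<Rightarrow> nat \<Rightarrow> bool" where
  "ordr n g r \<longleftrightarrow> (\<exists>c\<in>E (Suc n). c \<notin> princ (E (Suc n)) (X n) \<and> g = X n ^ r * c)"

lemma ordr_form:
  assumes "g \<in> E n" "g \<noteq> 0"
  obtains r h where "ordr n g r" "h \<in> polys (E n)" "h \<notin> polys (lin (E n) (X n) (Y n))" "degree h \<le> r"
    "g = X n ^ r * poly h (T n)"
proof -
  interpret Q: quadratic "E n" "X n" "Y n" V "mv V" "m n" by (rule quad)
  obtain r h where h: "h \<in> polys (E n)" "h \<notin> polys Q.M" "degree h \<le> r" "g = X n ^ r * poly h Q.t"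
    using Q.order_exists[OF assms] .
  have "ordr n g r"
    unfolding ordr_def E_Suc using h Q.in_princ_x_iff[OF h(1)] Q.poly_in[OF h(1)] by blast
  then show ?thesis using that h by blast
qed

lemma ordr_le:
  assumes "ordr n g r" "d \<in> E (Suc n)" "g = X n ^ s * d"
  shows "s \<le> r"
proof (rule ccontr)
  assume n: "\<not> s \<le> r"
  obtain c where c: "c \<in> E (Suc n)" "c \<notin> princ (E (Suc n)) (X n)" "g = X n ^ r * c"
    using assms(1) by (auto simp: ordr_def)
  have "s = r + Suc (s - Suc r)" using n by simp
  then have "X n ^ s = X n ^ r * X n ^ Suc (s - Suc r)" by (metis power_add)
  then have "X n ^ r * c = X n ^ r * (X n * (X n ^ (s - Suc r) * d))"
    using assms(3) unfolding c(3) by (simp add: mult.assoc)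
  then have "c = X n * (X n ^ (s - Suc r) * d)" using X_nonzero by simp
  moreover have "X n ^ (s - Suc r) * d \<in> E (Suc n)"
    using assms(2) X_in E_mono_Suc by (intro subring_closed[OF E_subring]) auto
  ultimately show False using c(2) princI by metis
qed

lemma ordr_unique: "ordr n g r \<Longrightarrow> ordr n g s \<Longrightarrow> r = s"
  using ordr_le[of n g r _ s] ordr_le[of n g s _ r] unfolding ordr_def[of n g] by (metis le_antisym)

lemma ordr_divide:
  assumes "g \<in> E n" "ordr n g r" "s \<le> r"
  obtains d where "d \<in> E (Suc n)" "g = X n ^ s * d"
proof -
  obtain c where c: "c \<in> E (Suc n)" "g = X n ^ r * c" using assms(2) by (auto simp: ordr_def)
  have "X n ^ r = X n ^ s * X n ^ (r - s)" using assms(3) by (simp add: power_add[symmetric])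
  then have "g = X n ^ s * (X n ^ (r - s) * c)" using c(2) by (simp add: mult.assoc)
  moreover have "X n ^ (r - s) * c \<in> E (Suc n)"
    using c X_in E_mono_Suc by (intro subring_closed[OF E_subring]) auto
  ultimately show ?thesis using that by blast
qed

text \<open>The multiplicity of a curve cannot increase under a quadratic transform; if it stays the same,
  then \<open>X\<close> remains a parameter of minimal value, unless the transformed curve misses the next
  point.\<close>

lemma ordr_transform:
  assumes a: "a \<in> E n" "a \<noteq> 0" "ordr n a e" "a = X n ^ e * a'"
    and a': "ordr (Suc n) a' e'" and e: "e \<le> e'" "0 < e"
  shows "e' = e \<and> (X (Suc n) = X n \<or> (\<exists>w. w \<notin> mv V \<and> a' = X (Suc n) ^ e * w))"
proof -
  interpret Q: quadratic "E n" "X n" "Y n" V "mv V" "m n" by (rule quad)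
  interpret R: rlr2 "E (Suc n)" "X n" "poly (m n) (T n)" by (rule rlr2_Suc)
  interpret S: rlr2 "E (Suc n)" "X (Suc n)" "Y (Suc n)" by (rule rlr2_E)
  define \<pi> where "\<pi> = poly (m n) (T n)"
  define x where "x = X n"
  obtain r h where h: "ordr n a r" "h \<in> polys (E n)" "h \<notin> polys Q.M" "degree h \<le> r"
    "a = X n ^ r * poly h (T n)" using ordr_form[OF a(1,2)] .
  have hE: "poly h (T n) \<in> E (Suc n)" unfolding E_Suc by (rule Q.poly_in[OF h(2)])
  have "r = e" by (rule ordr_unique[OF h(1) a(3)])
  then have a'h: "a' = poly h (T n)" using a(4) h(5) X_nonzero by simp
  have a'E: "a' \<in> E (Suc n)" "a' \<noteq> 0" using a'h hE a(2,4) by auto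
  obtain u k c where u: "u \<in> polys (E n)" "c \<in> E (Suc n)" "poly u (T n) \<notin> mv V"
    "a' = poly u (T n) * \<pi> ^ k + x * c" "k * degree (m n) + degree u \<le> degree h"
    using Q.mod_x_form[OF h(2,3)] unfolding E_Suc[symmetric] a'h[symmetric] \<pi>_def x_def by blast
  have uE: "poly u (T n) \<in> E (Suc n)" unfolding E_Suc by (rule Q.poly_in[OF u(1)])
  \<comment> \<open>Each factor \<open>\<pi>\<close> costs at least one degree of \<open>h\<close>,
    so the order \<open>k\<close> of \<open>a'\<close> along \<open>\<pi>\<close> modulo
    \<open>x\<close> is at most the old multiplicity \<open>e\<close>.\<close>
  have "k \<le> k * degree (m n)" using Q.m_degree by simp
  then have ke: "k \<le> e" using u(5) h(4) \<open>r = e\<close> by linarith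
  obtain r' h' where h': "ordr (Suc n) a' r'" "h' \<in> polys (E (Suc n))" "degree h' \<le> r'"
    "a' = X (Suc n) ^ r' * poly h' (T (Suc n))" using ordr_form[OF a'E] by metis
  have "r' = e'" by (rule ordr_unique[OF h'(1) a'])
  obtain l where l: "e' = Suc l" using e by (cases e') auto
  have \<pi>E: "\<pi> \<in> E (Suc n)" unfolding \<pi>_def by (rule R.yD)
  \<comment> \<open>Modulo \<open>x\<close> there is a discrete valuation ring with uniformizer
    \<open>\<pi>\<close>. There \<open>a'\<close> is both a unit times \<open>\<pi> ^ k\<close> and
    \<open>w * \<pi> ^ e'\<close>; since \<open>k \<le> e \<le> e'\<close>, all three exponents
    agree and \<open>w\<close> is a unit.\<close>
  have compare: "e' = e \<and> w \<notin> mv V"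
    if w: "w \<in> E (Suc n)" "d \<in> E (Suc n)" "a' = w * \<pi> ^ e' + x * d" for w d
  proof -
    define v where "v = poly u (T n) - w * \<pi> ^ (e' - k)"
    have "\<pi> ^ e' = \<pi> ^ (e' - k) * \<pi> ^ k" using ke e by (simp add: power_add[symmetric])
    then have "v * \<pi> ^ k = x * (d - c)"
      using u(4) w(3) unfolding v_def by (simp add: algebra_simps)
    moreover have "d - c \<in> E (Suc n)" using w u by (intro R.closed)
    ultimately have "v * \<pi> ^ k \<in> princ (E (Suc n)) x" using princI by metis
    moreover have "v \<in> E (Suc n)" unfolding v_def using uE w \<pi>E by (intro R.closed)
    ultimately have "v \<in> princ (E (Suc n)) x" using R.x_prime_power[of v k] unfolding x_def \<pi>_def by blast
    then have vmv: "v \<in> mv V"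
      using is_ideal_mult2[OF mv_ideal _ X_mv] E_V unfolding x_def by (auto elim!: princE)
    have nin: "w * \<pi> ^ (e' - k) \<notin> mv V"
    proof
      assume "w * \<pi> ^ (e' - k) \<in> mv V"
      from is_ideal_add[OF mv_ideal vmv this] show False using u(3) by (simp add: v_def)
    qed
    have "\<pi> \<in> mv V" unfolding \<pi>_def by (rule Q.m_root)
    have "e' = k"
    proof (rule ccontr)
      assume "e' \<noteq> k"
      then have "\<pi> ^ (e' - k) = \<pi> * \<pi> ^ (e' - k - 1)" using ke e by (simp add: power_eq_if)
      then have "\<pi> ^ (e' - k) \<in> mv V"
        using is_ideal_mult2[OF mv_ideal _ \<open>\<pi> \<in> mv V\<close>] E_V R.closed(7)[OF \<pi>E] by auto
      then show False using nin is_ideal_mult[OF mv_ideal] w(1) E_V by blast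
    qed
    then show ?thesis using nin ke e by auto
  qed
  from XY_Suc[of n] show ?thesis
  proof
    \<comment> \<open>Here \<open>\<pi>\<close> is \<open>Y (Suc n)\<close>, and in a form of degree
      \<open>e'\<close> all terms except the pure power of \<open>\<pi>\<close> are multiples of
      \<open>x\<close>.\<close>
    assume XY: "X (Suc n) = X n \<and> Y (Suc n) = poly (m n) (T n)"
    have dh: "degree h' \<le> Suc l" using h'(3) \<open>r' = e'\<close> l by simp
    obtain q where q: "q \<in> polys (E (Suc n))" "degree q \<le> l"
      "X (Suc n) ^ Suc l * poly h' (T (Suc n)) = X (Suc n) * (X (Suc n) ^ l * poly q (T (Suc n)))
        + coeff h' (Suc l) * Y (Suc n) ^ Suc l"
      using S.eval_top[OF h'(2) dh] by metis
    have "a' = coeff h' (Suc l) * \<pi> ^ e' + x * (X (Suc n) ^ l * poly q (T (Suc n)))"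
      using q(3) h'(4) \<open>r' = e'\<close> XY unfolding l \<pi>_def x_def by simp
    then show ?thesis
      using compare[OF polysD[OF h'(2)] S.eval_int[OF q(1,2)]] XY by blast
  next
    \<comment> \<open>Now \<open>\<pi>\<close> is \<open>X (Suc n)\<close>, so the constant
      coefficient \<open>w\<close> of \<open>h'\<close> is compared. As \<open>T (Suc n)\<close> is
      in \<open>mv V\<close>, the value of \<open>h'\<close> is congruent to the unit
      \<open>w\<close>.\<close>
    assume XY: "X (Suc n) = poly (m n) (T n) \<and> Y (Suc n) = X n \<and> T (Suc n) \<in> mv V"
    obtain w q where hq: "h' = pCons w q" by (cases h')
    have wq: "w \<in> E (Suc n)" "q \<in> polys (E (Suc n))" using h'(2) polys_pConsD unfolding hq by blast+
    have dq: "degree q \<le> l" using h'(3) \<open>r' = e'\<close> l by (cases "q = 0") (auto simp: hq)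
    have ev: "poly h' (T (Suc n)) = w + T (Suc n) * poly q (T (Suc n))" by (simp add: hq)
    have "a' = w * X (Suc n) ^ e' + (X (Suc n) * T (Suc n)) * (X (Suc n) ^ l * poly q (T (Suc n)))"
      unfolding h'(4) ev \<open>r' = e'\<close> l by (simp only: power_Suc distrib_left mult.assoc mult.left_commute mult.commute)
    then have "a' = w * \<pi> ^ e' + x * (X (Suc n) ^ l * poly q (T (Suc n)))"
      unfolding S.xt using XY by (simp only: \<pi>_def x_def)
    then have *: "e' = e" "w \<notin> mv V" using compare[OF wq(1) S.eval_int[OF wq(2) dq]] by blast+
    have "poly h' (T (Suc n)) \<notin> mv V"
    proof
      assume asm: "poly h' (T (Suc n)) \<in> mv V"
      have "poly q (T (Suc n)) \<in> V"
        using quadratic.polys_V[OF quad wq(2)] .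
      then have "T (Suc n) * poly q (T (Suc n)) \<in> mv V"
        using XY is_ideal_mult2[OF mv_ideal] by blast
      from is_ideal_diff[OF V_subring mv_ideal asm this] show False using *(2) ev by simp
    qed
    then show ?thesis using *(1) h'(4) \<open>r' = e'\<close> by blast
  qed
qed

end

section \<open>The sequence exhausts \<open>V\<close>\<close>

context qseq
begin

text \<open>Among all representations of \<open>f\<close> as a quotient, at all stages, one with an
  entry of least order \<open>e\<close> is taken. Orders cannot rise under transforms nor fall below
  \<open>e\<close>, so they stay equal to \<open>e\<close> and the parameter \<open>X\<close> never
  changes again. Both entries are then divisible by all powers of it, which yields a common factor
  whose removal lowers the order.\<close>

theorem union_dichotomy:
  assumes f: "f \<in> qf (E 0)" "f \<noteq> 0"
  shows "\<exists>n. f \<in> E n \<or> inverse f \<in> E n"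
proof (rule ccontr)
  assume "\<not> ?thesis"
  then have nf: "f \<notin> E n" "inverse f \<notin> E n" for n by auto
  note cl = subring_closed[OF E_subring]
  \<comment> \<open>Symmetric in the two entries and in \<open>f\<close> and \<open>1/f\<close>, so
    that the minimum may be taken over either entry.\<close>
  define pair where "pair a b \<longleftrightarrow> a \<noteq> 0 \<and> b \<noteq> 0 \<and> (f = a * inverse b \<or> f = b * inverse a)" for a b
  have pair_swap: "pair b a" if "pair a b" for a b using that by (auto simp: pair_def)
  have pair_scale: "pair a b" if "pair (c * a) (c * b)" for a b c
  proof -
    have "(c * a) * inverse (c * b) = a * inverse b" "(c * b) * inverse (c * a) = b * inverse a"
      using that by (auto simp: pair_def field_simps)
    then show ?thesis using that unfolding pair_def by auto
  qed
  have pair_mv: "a \<in> mv V" if "a \<in> E n" "b \<in> E n" "pair a b" for a b n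
  proof (rule ccontr)
    assume "a \<notin> mv V"
    then have "b * inverse a \<in> E n" using E_unit that cl(5) by blast
    moreover have "f = b * inverse a \<or> inverse f = b * inverse a"
      using that(3) by (auto simp: pair_def mult.commute)
    ultimately show False using nf by auto
  qed
  define rep where "rep e \<longleftrightarrow> (\<exists>n a b. a \<in> E n \<and> b \<in> E n \<and> pair a b \<and> ordr n a e)" for e
  have "\<exists>e. rep e"
  proof -
    obtain a b where ab: "a \<in> E 0" "b \<in> E 0" "b \<noteq> 0" "f = a * inverse b" using f(1) by (auto simp: qf_def)
    then have "pair a b" using f(2) by (auto simp: pair_def)
    moreover obtain e where "ordr 0 a e" using ordr_form[OF ab(1)] calculation by (metis pair_def)
    ultimately show ?thesis using ab unfolding rep_def by blast
  qed
  then obtain e where e: "rep e" "\<And>r. rep r \<Longrightarrow> e \<le> r"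
    using LeastI_ex[of rep] Least_le[of rep] by blast
  have min_ord: "e \<le> r" if "a \<in> E n" "b \<in> E n" "pair a b" "ordr n a r" for a b n r
    using e(2) that unfolding rep_def by blast
  have e_pos: "0 < e" if ab: "a \<in> E n" "b \<in> E n" "pair a b" "ordr n a e" for a b n
  proof -
    obtain d where "d \<in> E (Suc n)" "a = X n * d"
      using E_divide[OF ab(1) pair_mv[OF ab(1-3)]] .
    then have "1 \<le> e" using ordr_le[OF ab(4), of d 1] by simp
    then show ?thesis by simp
  qed
  have divide: "\<exists>d\<in>E (Suc n). b = X n ^ e * d" if ab: "a \<in> E n" "b \<in> E n" "pair a b" for a b n
  proof -
    have "b \<noteq> 0" using ab(3) by (simp add: pair_def)
    then obtain r where r: "ordr n b r" using ordr_form[OF ab(2)] by metis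
    have "e \<le> r" using min_ord[OF ab(2,1) pair_swap[OF ab(3)] r] .
    then show ?thesis using ordr_divide[OF ab(2) r] by blast
  qed
  have step: "\<exists>a' b'. a' \<in> E (Suc n) \<and> b' \<in> E (Suc n) \<and> a = X n ^ e * a' \<and> b = X n ^ e * b'
      \<and> pair a' b' \<and> ordr (Suc n) a' e \<and> X (Suc n) = X n"
    if ab: "a \<in> E n" "b \<in> E n" "pair a b" "ordr n a e" for a b n
  proof -
    obtain a' where a': "a' \<in> E (Suc n)" "a = X n ^ e * a'" using divide[OF ab(2,1) pair_swap[OF ab(3)]] by blast
    obtain b' where b': "b' \<in> E (Suc n)" "b = X n ^ e * b'" using divide[OF ab(1-3)] by blast
    have p': "pair a' b'" using pair_scale ab(3) unfolding a'(2) b'(2) by blast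
    have nz: "a \<noteq> 0" "a' \<noteq> 0" using ab(3) p' by (auto simp: pair_def)
    obtain e' where e': "ordr (Suc n) a' e'" using ordr_form[OF a'(1) nz(2)] by metis
    have "e \<le> e'" using min_ord[OF a'(1) b'(1) p' e'] .
    from ordr_transform[OF ab(1) nz(1) ab(4) a'(2) e' this e_pos[OF ab]]
    have ee: "e' = e" and alt: "X (Suc n) = X n \<or> (\<exists>w. w \<notin> mv V \<and> a' = X (Suc n) ^ e * w)" by blast+
    \<comment> \<open>Otherwise \<open>a'\<close> is \<open>X (Suc n) ^ e\<close> times a unit of
      \<open>V\<close>. As \<open>b'\<close> is divisible by the same power, cancelling it leaves a
      pair with a unit entry, which \<open>pair_mv\<close> excludes.\<close>
    have "X (Suc n) = X n"
    proof (rule ccontr)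
      assume "X (Suc n) \<noteq> X n"
      then obtain w where w: "w \<notin> mv V" "a' = X (Suc n) ^ e * w" using alt by blast
      obtain w' where w': "w' \<in> E (Suc (Suc n))" "a' = X (Suc n) ^ e * w'"
        using divide[OF b'(1) a'(1) pair_swap[OF p']] by blast
      have "w = w'" using w(2) w'(2) X_nonzero by simp
      obtain v where v: "v \<in> E (Suc (Suc n))" "b' = X (Suc n) ^ e * v" using divide[OF a'(1) b'(1) p'] by blast
      have "pair w' v" using pair_scale p' unfolding w'(2) v(2) by blast
      then show False using pair_mv[OF w'(1) v(1)] w(1) \<open>w = w'\<close> by blast
    qed
    then show ?thesis using a' b' p' e' ee by blast
  qed
  obtain n a b where ab: "a \<in> E n" "b \<in> E n" "pair a b" "ordr n a e" using e(1) unfolding rep_def by blast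
  define x where "x = X n"
  have x0: "x \<noteq> 0" unfolding x_def by (rule X_nonzero)
  have chain: "\<exists>a' b'. a' \<in> E (n + j) \<and> b' \<in> E (n + j) \<and> a = x ^ (e * j) * a' \<and> b = x ^ (e * j) * b'
      \<and> pair a' b' \<and> ordr (n + j) a' e \<and> X (n + j) = x" for j
  proof (induction j)
    case 0
    then show ?case using ab by (intro exI[of _ a] exI[of _ b]) (simp add: x_def)
  next
    case (Suc j)
    then obtain a' b' where *: "a' \<in> E (n + j)" "b' \<in> E (n + j)" "a = x ^ (e * j) * a'"
      "b = x ^ (e * j) * b'" "pair a' b'" "ordr (n + j) a' e" "X (n + j) = x" by blast
    obtain a'' b'' where **: "a'' \<in> E (Suc (n + j))" "b'' \<in> E (Suc (n + j))" "a' = x ^ e * a''"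
      "b' = x ^ e * b''" "pair a'' b''" "ordr (Suc (n + j)) a'' e" "X (Suc (n + j)) = x"
      using step[OF *(1,2,5,6)] *(7) by auto
    have "a = x ^ (e * Suc j) * a''" "b = x ^ (e * Suc j) * b''"
      using *(3,4) **(3,4) by (simp_all add: power_add mult.assoc mult.left_commute)
    then show ?case using ** by (intro exI[of _ a''] exI[of _ b'']) simp
  qed
  have Xx: "X i = x" if "n \<le> i" for i
    using chain[of "i - n"] that by auto
  define R where "R = (\<Union>i. E i)"
  have R: "subring R"
    unfolding R_def
  proof (rule subring_Union_chain)
    fix A B assume "A \<in> range E" "B \<in> range E"
    then show "A \<subseteq> B \<or> B \<subseteq> A" using E_mono by (metis image_iff nle_le)
  qed (use E_subring in auto)
  have RV: "R \<subseteq> V" using E_V by (auto simp: R_def)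
  have xR: "x \<in> R" unfolding x_def R_def using X_in by blast
  \<comment> \<open>The elements infinitely divisible by \<open>x\<close> in the union;
    \<open>a\<close> and \<open>b\<close> are among them.\<close>
  define P where "P = {r \<in> R. \<forall>k. \<exists>r'\<in>R. r = x ^ k * r'}"
  have deepI: "r \<in> P" if "\<And>j. \<exists>r'\<in>R. r = x ^ (e * j) * r'" for r
  proof -
    have "\<exists>r'\<in>R. r = x ^ k * r'" for k
    proof -
      obtain r' where r': "r' \<in> R" "r = x ^ (e * k) * r'" using \<open>\<And>j. \<exists>r'\<in>R. r = x ^ (e * j) * r'\<close> by blast
      have "k \<le> e * k" using e_pos[OF ab] by simp
      then have "x ^ (e * k) = x ^ k * x ^ (e * k - k)" by (simp add: power_add[symmetric])
      then have "r = x ^ k * (x ^ (e * k - k) * r')" using r' by (simp add: mult.assoc)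
      moreover have "x ^ (e * k - k) * r' \<in> R" using r' xR R by (intro subring_closed)
      ultimately show ?thesis by blast
    qed
    moreover from this[of 0] have "r \<in> R" by auto
    ultimately show ?thesis by (simp add: P_def)
  qed
  have aP: "a \<in> P" "b \<in> P"
  proof -
    have "\<exists>r'\<in>R. a = x ^ (e * j) * r'" "\<exists>r'\<in>R. b = x ^ (e * j) * r'" for j
      using chain[of j] by (auto simp: R_def)
    then show "a \<in> P" "b \<in> P" using deepI by blast+
  qed
  have inv_x: "inverse x \<notin> V" using X_mv[of n] x0 by (simp add: mv_def x_def)
  \<comment> \<open>Division by \<open>x\<close> stops at some quotient. If that were a nonunit of
    \<open>V\<close>, \<open>E_divide\<close> would split off the parameter of a late stage, which
    is again \<open>x\<close>.\<close>
  have unit_form: "\<exists>k u. u \<in> V \<and> u \<notin> mv V \<and> r = x ^ k * u" if r: "r \<in> R" "r \<notin> P" for r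
  proof -
    have "\<exists>k. \<not> (\<exists>r'\<in>R. r = x ^ k * r')" using r unfolding P_def by blast
    then obtain k where k: "\<not> (\<exists>r'\<in>R. r = x ^ k * r')" "\<And>j. j < k \<Longrightarrow> \<exists>r'\<in>R. r = x ^ j * r'"
      using exists_least_iff[of "\<lambda>k. \<not> (\<exists>r'\<in>R. r = x ^ k * r')"] by blast
    have "k \<noteq> 0" using k(1) r(1) by (metis mult_1 power_0)
    then obtain l where l: "k = Suc l" using not0_implies_Suc by blast
    then obtain u where u: "u \<in> R" "r = x ^ l * u" using k(2) by blast
    have "u \<notin> mv V"
    proof
      assume um: "u \<in> mv V"
      obtain i where "u \<in> E i" using u(1) by (auto simp: R_def)
      then have ui: "u \<in> E (max i n)" using E_mono[of i "max i n"] by auto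
      obtain d where d: "d \<in> E (Suc (max i n))" "u = X (max i n) * d" using E_divide[OF ui um] .
      have "r = x ^ k * d" using u(2) d(2) Xx[of "max i n"] l by (simp add: mult.assoc)
      then show False using k(1) d(1) by (auto simp: R_def)
    qed
    then show ?thesis using u RV by blast
  qed
  have P_prime: "prime_ideal R P"
    unfolding prime_ideal_def is_ideal_def
  proof (intro conjI ballI impI)
    show "P \<subseteq> R" by (auto simp: P_def)
    show "0 \<in> P" using subring_zero[OF R] by (auto simp: P_def intro!: bexI[of _ 0])
    show "r + s \<in> P" if "r \<in> P" "s \<in> P" for r s
      unfolding P_def
    proof (intro CollectI conjI allI)
      show "r + s \<in> R" using that subring_add[OF R] by (auto simp: P_def)
      fix k
      obtain r' s' where "r' \<in> R" "s' \<in> R" "r = x ^ k * r'" "s = x ^ k * s'" using \<open>r \<in> P\<close> \<open>s \<in> P\<close> unfolding P_def by blast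
      then have "r + s = x ^ k * (r' + s')" "r' + s' \<in> R" using subring_add[OF R] by (simp_all add: distrib_left)
      then show "\<exists>t'\<in>R. r + s = x ^ k * t'" by blast
    qed
    show "c * r \<in> P" if "c \<in> R" "r \<in> P" for c r
      unfolding P_def
    proof (intro CollectI conjI allI)
      show "c * r \<in> R" using that subring_mult[OF R] by (auto simp: P_def)
      fix k
      obtain r' where "r' \<in> R" "r = x ^ k * r'" using \<open>r \<in> P\<close> unfolding P_def by blast
      then have "c * r = x ^ k * (c * r')" "c * r' \<in> R" using \<open>c \<in> R\<close> subring_mult[OF R] by (simp_all add: mult.left_commute)
      then show "\<exists>t'\<in>R. c * r = x ^ k * t'" by blast
    qed
    have "1 \<notin> P"
    proof
      assume "1 \<in> P"
      then obtain r' where r': "r' \<in> R" "1 = x ^ 1 * r'" unfolding P_def by blast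
      then have "inverse x = r'" by (metis inverse_unique power_one_right)
      then show False using r'(1) RV inv_x by auto
    qed
    then show "P \<noteq> R" using subring_one[OF R] by blast
    show "r \<in> P \<or> s \<in> P" if rs: "r \<in> R" "s \<in> R" "r * s \<in> P" for r s
    proof (rule ccontr)
      assume "\<not> (r \<in> P \<or> s \<in> P)"
      then obtain k u l v where u: "u \<in> V" "u \<notin> mv V" "r = x ^ k * u" and v: "v \<in> V" "v \<notin> mv V" "s = x ^ l * v"
        using unit_form rs(1,2) by metis
      obtain q where q: "q \<in> R" "r * s = x ^ Suc (k + l) * q" using rs(3) unfolding P_def by blast
      have "x ^ (k + l) * (u * v) = x ^ (k + l) * (x * q)"
        using q(2) u(3) v(3) by (simp add: power_add algebra_simps)
      then have uv: "u * v = x * q" using x0 by simp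
      moreover have "x * q \<in> mv V"
        using is_ideal_mult2[OF mv_ideal _ X_mv] q(1) RV unfolding x_def by blast
      ultimately show False using prime_ideal_cases[OF mv_prime u(1) v(1)] u(2) v(2) by auto
    qed
  qed
  have "prime_ideal (E n) (P \<inter> E n)"
    by (rule prime_ideal_contract[OF E_subring _ P_prime]) (auto simp: R_def)
  moreover have "x \<notin> P"
  proof
    assume "x \<in> P"
    then obtain q where q: "q \<in> R" "x = x ^ 2 * q" unfolding P_def by blast
    then have "x * 1 = x * (x * q)" by (simp add: power2_eq_square)
    then have "1 = x * q" using x0 by (simp only: mult_cancel_left) simp
    then have "inverse x = q" by (metis inverse_unique)
    then show False using q(1) RV inv_x by auto
  qed
  then have "P \<inter> E n \<noteq> lin (E n) (X n) (Y n)" using rlr2.gens(1)[OF rlr2_E[of n]] by (auto simp: x_def)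
  moreover have "a \<noteq> 0" using ab(3) by (simp add: pair_def)
  then have "P \<inter> E n \<noteq> {0}" using aP(1) ab(1) by blast
  ultimately obtain g where g: "g \<in> E n" "P \<inter> E n = princ (E n) g"
    using rlr2.primes[OF rlr2_E[of n]] by blast
  obtain a1 where a1: "a1 \<in> E n" "a = g * a1" using aP(1) ab(1) g(2) by (metis IntI princE)
  obtain b1 where b1: "b1 \<in> E n" "b = g * b1" using aP(2) ab(2) g(2) by (metis IntI princE)
  have p1: "pair a1 b1" using pair_scale ab(3) unfolding a1(2) b1(2) by blast
  \<comment> \<open>As a nonunit, \<open>g\<close> contributes at least one factor
    \<open>X n\<close>, so \<open>a1 = a/g\<close> has order less than \<open>e\<close>, against the
    choice of \<open>e\<close>.\<close>
  have gm: "g \<in> mv V"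
  proof (rule ccontr)
    assume "g \<notin> mv V"
    then have "inverse g \<in> E n" using E_unit g(1) by blast
    moreover have "g \<noteq> 0" using a1(2) ab(3) by (auto simp: pair_def)
    ultimately have "1 \<in> princ (E n) g" using princI[of "inverse g" "E n" g] by simp
    then show False using g(2) prime_ideal_one[OF P_prime] by blast
  qed
  obtain d where d: "d \<in> E (Suc n)" "g = X n * d" using E_divide[OF g(1) gm] .
  obtain r where r: "ordr n a1 r" using ordr_form[OF a1(1)] p1 by (metis pair_def)
  obtain c where c: "c \<in> E (Suc n)" "a1 = X n ^ r * c" using r by (auto simp: ordr_def)
  have "a = X n ^ Suc r * (d * c)" using a1(2) d(2) c(2) by (simp add: algebra_simps)
  then have "Suc r \<le> e" using ordr_le[OF ab(4) cl(5)[OF d(1) c(1)]] by blast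
  moreover have "e \<le> r" using min_ord[OF a1(1) b1(1) p1 r] .
  ultimately show False by simp
qed

theorem union_eq: "V = (\<Union>n. E n)"
proof
  show "(\<Union>n. E n) \<subseteq> V" using E_V by blast
  show "V \<subseteq> (\<Union>n. E n)"
  proof
    fix f assume f: "f \<in> V"
    show "f \<in> (\<Union>n. E n)"
    proof (cases "f = 0")
      case True
      then show ?thesis using subring_zero[OF E_subring] by blast
    next
      case False
      have "f \<in> qf (E 0)" using f valuation_sub[OF minval.val[OF minval]] by blast
      then obtain n where "f \<in> E n \<or> inverse f \<in> E n" using union_dichotomy False by blast
      moreover have "inverse f \<notin> mv V" using False f by (simp add: mv_def)
      ultimately show ?thesis using E_unit[of "inverse f" n] by auto
    qed
  qed
qed

end

section \<open>Valuations of prime elements and regular rings with a prescribed nonunit\<close>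

context rlr2
begin

text \<open>If \<open>x\<close> divides \<open>w\<close>, it is replaced by
  \<open>q = x + y ^ Suc j\<close>, where \<open>j\<close> is the order modulo \<open>x\<close> of
  the part \<open>b\<close> of \<open>w\<close> prime to \<open>x\<close>. A multiple of
  \<open>q\<close> has order at least \<open>j + 1\<close> modulo \<open>x\<close>, so
  \<open>q\<close> does not divide \<open>b\<close>; and it does not divide \<open>x\<close>, as it
  would then divide a power of \<open>y\<close>.\<close>

lemma fresh_parameter:
  assumes w: "w \<in> D" "w \<noteq> 0"
  shows "\<exists>q z. rlr2 D q z \<and> lin D q z = M \<and> w \<notin> princ D q"
proof (cases "w \<in> princ D x")
  case False
  then show ?thesis using rlr2_axioms by blast
next
  case True
  obtain k b where b: "b \<in> D" "b \<notin> princ D x" "w = x ^ k * b" using separated[OF w] by blast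
  obtain u j c where u: "u \<in> D" "u \<notin> M" "c \<in> D" "b = u * y ^ j + x * c" using disc[OF b(1,2)] by blast
  define q where "q = x + y ^ Suc j"
  have qD: "q \<in> D" unfolding q_def using xD yD by (intro closed)
  have M_eq: "lin D q y = M"
  proof (intro equalityI subsetI)
    fix v assume "v \<in> lin D q y"
    then obtain r s where "r \<in> D" "s \<in> D" "v = r * x + (r * y ^ j + s) * y"
      by (auto simp: lin_def q_def algebra_simps)
    moreover have "r * y ^ j + s \<in> D" using calculation yD by (auto intro!: closed)
    ultimately show "v \<in> M" using linI by blast
  next
    fix v assume "v \<in> M"
    then obtain r s where "r \<in> D" "s \<in> D" "v = r * q + (s - r * y ^ j) * y"
      by (auto simp: lin_def q_def algebra_simps)
    moreover have "s - r * y ^ j \<in> D" using calculation yD by (auto intro!: closed)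
    ultimately show "v \<in> lin D q y" using linI by blast
  qed
  have "maximal_ideal D (lin D q y)" unfolding M_eq by (rule M_maximal)
  then interpret Q: rlr2 D q y by (rule rlr2_of_regular[OF regular])
  have "w \<notin> princ D q"
  proof
    assume "w \<in> princ D q"
    then have "x ^ k \<in> princ D q \<or> b \<in> princ D q"
      using Q.x_prime[of "x ^ k" b] b closed(7)[OF xD] by auto
    then show False
    proof
      assume "x ^ k \<in> princ D q"
      then have "x \<in> princ D q" using prime_ideal_power[OF subring Q.princ_x_prime xD] by blast
      then have "q - x \<in> princ D q"
        using is_ideal_diff[OF subring is_ideal_princ[OF subring qD]] self_in_princ[OF subring] by blast
      then have "y ^ Suc j \<in> princ D q" by (simp add: q_def)
      then show False using prime_ideal_power[OF subring Q.princ_x_prime yD] Q.y_notin by blast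
    next
      assume "b \<in> princ D q"
      then obtain d where d: "d \<in> D" "b = q * d" by (auto elim: princE)
      have "(u - d * y) * y ^ j = x * (d - c)" using d(2) u(4) by (simp add: q_def algebra_simps)
      then have "(u - d * y) * y ^ j \<in> princ D x" using princI[OF closed(4)[OF d(1) u(3)]] by metis
      then have "u - d * y \<in> princ D x"
        by (rule x_prime_power[OF closed(4)[OF u(1) closed(5)[OF d(1) yD]]])
      then obtain f where "f \<in> D" "u - d * y = x * f" by (auto elim: princE)
      then have "u = f * x + d * y" "f \<in> D" by (simp_all add: algebra_simps)
      then show False using u(2) d(1) linI by metis
    qed
  qed
  then show ?thesis using Q.rlr2_axioms M_eq by blast
qed

abbreviation W where "W \<equiv> loc_prime D (princ D x)"

lemma W_I: "a \<in> D \<Longrightarrow> s \<in> D \<Longrightarrow> s \<notin> princ D x \<Longrightarrow> a * inverse s \<in> W"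
  unfolding loc_prime_def by blast

lemma D_W: "D \<subseteq> W" by (rule subring_loc_prime(2)[OF subring princ_x_prime])

lemma zero_in_princ: "0 \<in> princ D x" by (rule is_ideal_zero[OF is_ideal_princ[OF subring xD]])

text \<open>Numerator and denominator are powers of \<open>x\<close> times elements outside
  \<open>xD\<close>, which are units of \<open>W\<close>; the difference of exponents
  decides.\<close>

lemma loc_prime_valuation: "valuation_overring D W"
  unfolding valuation_overring_def valuation_ring_of_def
proof (intro conjI ballI impI)
  show "D \<subseteq> W" by (rule D_W)
  show "W \<subseteq> qf D"
  proof
    fix a assume "a \<in> W"
    then obtain c s where cs: "c \<in> D" "s \<in> D" "s \<notin> princ D x" "a = c * inverse s"
      unfolding loc_prime_def by blast
    then have "s \<noteq> 0" using zero_in_princ by auto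
    then show "a \<in> qf D" using cs unfolding qf_def by blast
  qed
  show "subring W" by (rule subring_loc_prime(1)[OF subring princ_x_prime])
  fix a assume a: "a \<in> qf D" "a \<noteq> 0"
  then obtain c s where cs: "c \<in> D" "s \<in> D" "s \<noteq> 0" "a = c * inverse s" by (auto simp: qf_def)
  have "c \<noteq> 0" using a cs by auto
  obtain k c' where c': "c' \<in> D" "c' \<notin> princ D x" "c = x ^ k * c'" using separated[OF cs(1) \<open>c \<noteq> 0\<close>] by blast
  obtain l s' where s': "s' \<in> D" "s' \<notin> princ D x" "s = x ^ l * s'" using separated[OF cs(2,3)] by blast
  have nz: "c' \<noteq> 0" "s' \<noteq> 0" using c' s' zero_in_princ by auto
  show "a \<in> W \<or> inverse a \<in> W"
  proof (cases "l \<le> k")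
    case True
    then have "x ^ k = x ^ l * x ^ (k - l)" by (simp add: power_add[symmetric])
    then have "a = (x ^ (k - l) * c') * inverse s'"
      unfolding cs(4) c'(3) s'(3) using x_nonzero nz by (simp add: field_simps)
    moreover have "x ^ (k - l) * c' \<in> D" using xD c' by (intro closed)
    ultimately show ?thesis using W_I[OF _ s'(1,2)] by metis
  next
    case False
    then have "x ^ l = x ^ k * x ^ (l - k)" by (simp add: power_add[symmetric])
    then have "inverse a = (x ^ (l - k) * s') * inverse c'"
      unfolding cs(4) c'(3) s'(3) using x_nonzero nz by (simp add: field_simps)
    moreover have "x ^ (l - k) * s' \<in> D" using xD s' by (intro closed)
    ultimately show ?thesis using W_I[OF _ c'(1,2)] by metis
  qed
qed

lemma loc_prime_mv:
  assumes "e \<in> D" "v \<in> D" "v \<notin> princ D x"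
  shows "x * e * inverse v \<in> mv W"
proof (cases "e = 0")
  case True
  have "0 \<in> W" using D_W closed(1) by blast
  then show ?thesis using True by (simp add: mv_def)
next
  case False
  have v0: "v \<noteq> 0" using assms(3) zero_in_princ by auto
  have "x * e * inverse v \<in> W" using assms xD closed(5) by (intro W_I)
  moreover have "inverse (x * e * inverse v) \<notin> W"
  proof
    assume "inverse (x * e * inverse v) \<in> W"
    then obtain a s where as: "a \<in> D" "s \<in> D" "s \<notin> princ D x" "inverse (x * e * inverse v) = a * inverse s"
      unfolding loc_prime_def by blast
    have "s \<noteq> 0" using as(3) zero_in_princ by auto
    then have "v * s = x * (e * a)" using as(4) v0 x_nonzero False by (simp add: field_simps)
    then have "v * s \<in> princ D x" using princI[OF closed(5)[OF assms(1) as(1)]] by metis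
    then show False using x_prime[OF assms(2) as(2)] assms(3) as(3) by blast
  qed
  ultimately show ?thesis by (simp add: mv_def)
qed

end

text \<open>Below \<open>W\<close> there is a minimal valuation overring \<open>V\<close>; maximal
  ideals grow as valuation rings shrink, so \<open>z\<close> is still a nonunit. Since
  \<open>V\<close> is the union of the quadratic transforms of \<open>A\<close> along it, some
  transform contains \<open>z\<close>.\<close>

lemma dominating_regular_ring:
  assumes A: "regular_local_2 A" and W: "valuation_overring A W" and z: "z \<in> mv W"
  shows "\<exists>\<alpha> V. minval A V \<and> regular_local_2 \<alpha> \<and> A \<subseteq> \<alpha> \<and> \<alpha> \<subseteq> V \<and> z \<in> \<alpha> \<and> z \<in> mv V
    \<and> (\<forall>v\<in>\<alpha>. v \<notin> mv V \<longrightarrow> inverse v \<in> \<alpha>)"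
proof -
  have sr: "subring A" using A by (simp add: regular_local_2_def local_ring_def)
  obtain V where V: "minimal_valuation_overring A V" "V \<subseteq> W" using minimal_valuation_below[OF sr W] by blast
  interpret mA: minval A V by unfold_locales (fact sr V(1))+
  obtain E X Y m where seq: "qseq V E X Y m" and E0: "E 0 = A" using qseq_exists[OF A V(1)] by blast
  interpret qseq V E X Y m by (rule seq)
  have zV: "z \<in> mv V"
    using mv_antimono[OF mA.val _ V(2)] W z by (auto simp: valuation_overring_def)
  then have "z \<in> V" by (simp add: mv_def)
  then obtain n where n: "z \<in> E n" using union_eq by blast
  show ?thesis
    using mA.minval_axioms rlr2.regular[OF rlr2_E[of n]] E_mono[of 0 n] E0 E_V n zV E_unit by blast
qed

section \<open>Small elements of the maximal ideal\<close>

context qseq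
begin

lemma qf_E: "qf (E n) = qf (E 0)"
  by (rule minval.minval_extend(2)[OF minval[of 0] E_subring E_mono[OF le0] E_V])

lemmas K_subfield = subfield_qf[OF E_subring]

lemma V_val: "valuation_ring_of (qf (E 0)) V" by (rule minval.val[OF minval])

lemma V_K: "V \<subseteq> qf (E 0)" by (rule valuation_sub[OF V_val])

lemma K_closed: "a \<in> qf (E 0) \<Longrightarrow> b \<in> qf (E 0) \<Longrightarrow> a * b \<in> qf (E 0)"
  "a \<in> qf (E 0) \<Longrightarrow> inverse a \<in> qf (E 0)"
  using K_subfield[of 0] by (simp_all add: subfield_def subring_mult)

text \<open>The divisibility condition says that \<open>V[1/w]\<close> is the whole quotient field,
  that is, \<open>w\<close> lies in every nonzero prime of \<open>V\<close>.\<close>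

definition small :: "'a \<Rightarrow> bool" where
  "small w \<longleftrightarrow> w \<in> mv V \<and> w \<noteq> 0 \<and> (\<forall>b\<in>qf (E 0). b \<noteq> 0 \<longrightarrow> (\<exists>N. w ^ N * inverse b \<in> V))"

lemma smallI:
  assumes "w \<in> mv V" "w \<noteq> 0" and b: "\<And>b. b \<in> E 0 \<Longrightarrow> b \<noteq> 0 \<Longrightarrow> \<exists>N. w ^ N * inverse b \<in> V"
  shows "small w"
  unfolding small_def
proof (intro conjI assms(1,2) ballI impI)
  fix c assume "c \<in> qf (E 0)" "c \<noteq> 0"
  then obtain a d where ad: "a \<in> E 0" "d \<in> E 0" "d \<noteq> 0" "c = a * inverse d"
    by (auto simp: qf_def)
  have "a \<noteq> 0" using ad \<open>c \<noteq> 0\<close> by auto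
  then obtain N where "w ^ N * inverse a \<in> V" using b ad(1) by blast
  then have "w ^ N * inverse a * d \<in> V" using ad(2) E_V V_subring by (auto intro: subring_mult)
  moreover have "w ^ N * inverse c = w ^ N * inverse a * d" by (simp add: ad(4))
  ultimately show "\<exists>N. w ^ N * inverse c \<in> V" by metis
qed

text \<open>Any nonzero element of the maximal ideal is small when $V$ has rank one; otherwise a nonzero
  nonmaximal prime of $V$ contracts to a principal prime \<open>gE n\<close>, and \<open>g\<close> is small.\<close>

lemma small_exists: "\<exists>w. small w"
proof (cases "small (X 0)")
  case False
  define w where "w = X 0"
  have w: "w \<in> mv V" "w \<noteq> 0" unfolding w_def by (rule X_mv, rule X_nonzero)
  have wi: "inverse w \<notin> V" using w by (simp add: mv_def)
  note cl = subring_closed[OF V_subring]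
  obtain b where b: "b \<in> E 0" "b \<noteq> 0" "\<And>N. w ^ N * inverse b \<notin> V"
    using False smallI[OF w(1,2)] unfolding w_def by blast
  have swap: "b * inverse (w ^ N) \<in> V" if "w ^ N * inverse b \<notin> V" "b \<in> V" "b \<noteq> 0" for b N
  proof -
    have "w ^ N * inverse b \<in> qf (E 0)"
      using K_closed V_K that w cl(7)[of w N] by (auto simp: mv_def)
    moreover have "w ^ N * inverse b \<noteq> 0" using that w by simp
    ultimately have "inverse (w ^ N * inverse b) \<in> V" using valuation_cases[OF V_val] that(1) by blast
    then show ?thesis by (simp add: mult.commute)
  qed
  \<comment> \<open>The elements divisible by every power of \<open>w\<close>. It contains
    \<open>b\<close> but not \<open>w\<close>, and an element outside it divides a power of
    \<open>w\<close>.\<close>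
  define P where "P = {p \<in> V. \<forall>N. p * inverse (w ^ N) \<in> V}"
  have outside: "\<exists>N. w ^ N * inverse r \<in> V" if r: "r \<in> V" "r \<notin> P" for r
  proof -
    obtain N where N: "r * inverse (w ^ N) \<notin> V" using r by (auto simp: P_def)
    moreover have "r \<noteq> 0" using N cl(1) by auto
    ultimately show ?thesis using swap[of N r] r(1) by blast
  qed
  have P: "prime_ideal V P"
    unfolding prime_ideal_def is_ideal_def
  proof (intro conjI ballI impI)
    show "P \<subseteq> V" "0 \<in> P" using cl(1) by (auto simp: P_def)
    show "r + s \<in> P" if "r \<in> P" "s \<in> P" for r s
      using that cl(3) by (auto simp: P_def distrib_right)
    show "c * r \<in> P" if "c \<in> V" "r \<in> P" for c r
      using that cl(5) by (auto simp: P_def mult.assoc)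
    have "1 * inverse (w ^ 1) \<notin> V" using wi by simp
    then have "1 \<notin> P" unfolding P_def by blast
    then show "P \<noteq> V" using cl(2) by blast
    show "r \<in> P \<or> s \<in> P" if rs: "r \<in> V" "s \<in> V" "r * s \<in> P" for r s
    proof (rule ccontr)
      assume n: "\<not> (r \<in> P \<or> s \<in> P)"
      obtain N where N: "w ^ N * inverse r \<in> V" using outside n rs(1) by blast
      obtain L where L: "w ^ L * inverse s \<in> V" using outside n rs(2) by blast
      have nz: "r \<noteq> 0" "s \<noteq> 0" using n cl(1) by (auto simp: P_def)
      have "r * s * inverse (w ^ (N + L + 1)) \<in> V" using rs(3) unfolding P_def by blast
      then have "(w ^ N * inverse r) * (w ^ L * inverse s) * (r * s * inverse (w ^ (N + L + 1))) \<in> V"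
        using N L cl(5) by blast
      moreover have "(w ^ N * inverse r) * (w ^ L * inverse s) * (r * s * inverse (w ^ (N + L + 1))) = inverse w"
        using nz w(2) by (simp add: field_simps power_add)
      ultimately show False using wi by (simp only:)
    qed
  qed
  note PI = prime_ideal_ideal[OF P]
  have wP: "w \<notin> P"
  proof
    assume "w \<in> P"
    then have "w * inverse (w ^ 2) \<in> V" unfolding P_def by blast
    moreover have "w * inverse (w ^ 2) = inverse w" using w(2) by (simp add: field_simps power2_eq_square)
    ultimately show False using wi by (simp only:)
  qed
  have bP: "b \<in> P" using b swap E_V unfolding P_def by blast
  have "prime_ideal (E 0) (P \<inter> E 0)" by (rule prime_ideal_contract[OF E_subring E_V P])
  moreover have "P \<inter> E 0 \<noteq> lin (E 0) (X 0) (Y 0)"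
    using wP rlr2.gens(1)[OF rlr2_E[of 0]] unfolding w_def by blast
  moreover have "P \<inter> E 0 \<noteq> {0}" using bP b by blast
  ultimately obtain g where g: "g \<in> E 0" "P \<inter> E 0 = princ (E 0) g"
    using rlr2.primes[OF rlr2_E[of 0]] by blast
  have gP: "g \<in> P" using g self_in_princ[OF E_subring] by blast
  have "g \<noteq> 0" using bP b g(2) by (auto simp: princ_def)
  have gm: "g \<in> mv V"
  proof (rule ccontr)
    assume "g \<notin> mv V"
    then have "inverse g * g \<in> P" using gP is_ideal_mult[OF PI] is_ideal_subset[OF PI] by (auto simp: mv_def)
    then show False using \<open>g \<noteq> 0\<close> prime_ideal_one[OF P] by simp
  qed
  have "small g"
  proof (rule smallI[OF gm \<open>g \<noteq> 0\<close>])
    fix a assume a: "a \<in> E 0" "a \<noteq> 0"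
    obtain r where r: "ordr 0 a r" using ordr_form[OF a] by metis
    obtain d where d: "d \<in> E 1" "g = X 0 * d" using E_divide[OF g(1) gm] by auto
    \<comment> \<open>\<open>g\<close> has a factor \<open>X 0\<close> in \<open>E 1\<close>, so its
      exponent in \<open>a\<close> is bounded by the order of \<open>a\<close>.\<close>
    have bound: "k \<le> r" if c: "c \<in> E 0" "a = g ^ k * c" for k c
    proof -
      have "a = X 0 ^ k * (d ^ k * c)" using c(2) d(2) by (simp add: power_mult_distrib mult.assoc)
      moreover have "d ^ k * c \<in> E 1"
        using d(1) c(1) E_mono[of 0 1] subring_closed(5,7)[OF E_subring[of 1]] by auto
      ultimately show ?thesis using ordr_le[OF r] by simp
    qed
    have "\<exists>k. \<not> (\<exists>c\<in>E 0. a = g ^ k * c)" using bound by (metis Suc_n_not_le_n)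
    then obtain k where k: "\<not> (\<exists>c\<in>E 0. a = g ^ k * c)" "\<And>j. j < k \<Longrightarrow> \<exists>c\<in>E 0. a = g ^ j * c"
      using exists_least_iff[of "\<lambda>k. \<not> (\<exists>c\<in>E 0. a = g ^ k * c)"] by blast
    have "k \<noteq> 0" using k(1) a(1) by (metis mult_1 power_0)
    then obtain l where l: "k = Suc l" using not0_implies_Suc by blast
    then obtain c where c: "c \<in> E 0" "a = g ^ l * c" using k(2) by blast
    have "c \<notin> P"
    proof
      assume "c \<in> P"
      then obtain e where "e \<in> E 0" "c = g * e" using g(2) c(1) by (metis IntI princE)
      then have "a = g ^ k * e" using c(2) l by (simp add: mult.assoc)
      then show False using k(1) \<open>e \<in> E 0\<close> by blast
    qed
    then obtain N where N: "w ^ N * inverse c \<in> V" using outside c(1) E_V by blast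
    \<comment> \<open>With \<open>a = g ^ l * c\<close>, one further factor \<open>g\<close> absorbs
      \<open>c\<close>, because \<open>c\<close> divides \<open>w ^ N\<close> and
      \<open>w ^ N\<close> divides \<open>g\<close>.\<close>
    have "g * inverse (w ^ N) \<in> V" using gP unfolding P_def by blast
    then have "g * inverse (w ^ N) * (w ^ N * inverse c) \<in> V" using N cl(5) by blast
    moreover have "g * inverse (w ^ N) * (w ^ N * inverse c) = g ^ k * inverse a"
      using c(2) l \<open>g \<noteq> 0\<close> w(2) a(2) by (simp add: field_simps)
    ultimately show "\<exists>N. g ^ N * inverse a \<in> V" by metis
  qed
  then show ?thesis ..
qed blast

end

section \<open>Valuation rings that are Krull domains\<close>

text \<open>For \<open>z\<close> in \<open>W2\<close> but not in \<open>W1\<close> and a nonzero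
  nonunit \<open>x\<close> of \<open>W2\<close>, all \<open>x * z ^ n\<close> lie in
  \<open>W1\<close> and generate an increasing chain of ideals there. As \<open>W1\<close> is
  noetherian the chain stops, which puts \<open>z\<close> into \<open>W1\<close>.\<close>

lemma DVR_maximal:
  assumes W1: "DVR_of K W1" and W2: "DVR_of K W2" and sub: "W1 \<subseteq> W2"
  shows "W1 = W2"
proof (rule ccontr)
  assume "W1 \<noteq> W2"
  then obtain z where z: "z \<in> W2" "z \<notin> W1" using sub by blast
  have val: "valuation_ring_of K W1" "valuation_ring_of K W2" and noeth: "noetherian W1"
    using W1 W2 by (auto simp: DVR_of_def)
  note sr = valuation_subring[OF val(1)] valuation_subring[OF val(2)]
  obtain x where x: "x \<in> W2" "x \<noteq> 0" "inverse x \<notin> W2" using W2 by (auto simp: DVR_of_def)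
  have z0: "z \<noteq> 0" using z subring_zero[OF sr(1)] by auto
  have zi: "inverse z \<in> W1" using valuation_cases[OF val(1)] z z0 valuation_sub[OF val(2)] by blast
  have xz: "x * z ^ n \<in> W1" for n
  proof (rule ccontr)
    assume n: "x * z ^ n \<notin> W1"
    have "x * z ^ n \<in> W2" using x z sr(2) by (intro subring_closed)
    then have "inverse (x * z ^ n) \<in> W2"
      using valuation_cases[OF val(1), of "x * z ^ n"] n x z0 valuation_sub[OF val(2)] sub by auto
    then have "z ^ n * inverse (x * z ^ n) \<in> W2" using z sr(2) by (intro subring_closed)
    moreover have "z ^ n * inverse (x * z ^ n) = inverse x" using z0 by (simp add: field_simps)
    ultimately show False using x(3) by (simp only:)
  qed
  define \<C> where "\<C> = range (\<lambda>n. princ W1 (x * z ^ n))"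
  have mono: "princ W1 (x * z ^ i) \<subseteq> princ W1 (x * z ^ j)" if "i \<le> j" for i j
  proof
    fix a assume "a \<in> princ W1 (x * z ^ i)"
    then obtain d where d: "d \<in> W1" "a = x * z ^ i * d" by (auto elim: princE)
    have "z ^ j = z ^ i * z ^ (j - i)" using that by (simp add: power_add[symmetric])
    then have "a = x * z ^ j * (inverse z ^ (j - i) * d)"
      using d(2) z0 by (simp add: field_simps)
    moreover have "inverse z ^ (j - i) * d \<in> W1" using zi d(1) sr(1) by (intro subring_closed)
    ultimately show "a \<in> princ W1 (x * z ^ j)" using princI by metis
  qed
  have chain: "A \<subseteq> B \<or> B \<subseteq> A" if AB: "A \<in> \<C>" "B \<in> \<C>" for A B
  proof -
    obtain i j where "A = princ W1 (x * z ^ i)" "B = princ W1 (x * z ^ j)" using AB by (auto simp: \<C>_def)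
    then show ?thesis using mono[of i j] mono[of j i] nat_le_linear[of i j] by blast
  qed
  have I: "is_ideal W1 (\<Union>\<C>)"
    using chain by (intro is_ideal_Union_chain) (auto simp: \<C>_def intro!: is_ideal_princ sr xz)
  then obtain G where G: "finite G" "G \<subseteq> \<Union>\<C>" "\<Union>\<C> = ideal_gen W1 G"
    using noeth by (auto simp: noetherian_def)
  have "subset.chain UNIV \<C>" using chain by (auto simp: subset_chain_def)
  then obtain B where B: "B \<in> \<C>" "G \<subseteq> B"
    using finite_subset_Union_chain[OF G(1,2)] by (auto simp: \<C>_def)
  then obtain n where n: "B = princ W1 (x * z ^ n)" by (auto simp: \<C>_def)
  have "\<Union>\<C> \<subseteq> princ W1 (x * z ^ n)"
    using ideal_gen_subset[OF is_ideal_princ[OF sr(1) xz] G(1)] B(2) G(3) n by auto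
  moreover have "x * z ^ Suc n \<in> \<Union>\<C>" using self_in_princ[OF sr(1), of "x * z ^ Suc n"] unfolding \<C>_def by blast
  ultimately have "x * z ^ Suc n \<in> princ W1 (x * z ^ n)" by blast
  then obtain d where d: "d \<in> W1" "x * z ^ Suc n = x * z ^ n * d" by (rule princE)
  then have "z = d" using x(2) z0 by simp
  then show False using d(1) z(2) by simp
qed

text \<open>The discrete valuation rings in a Krull representation of \<open>V\<close> contain
  \<open>V\<close>, so any two are comparable, hence equal by \<open>DVR_maximal\<close>. As
  \<open>V\<close> has a nonunit, the family is not empty, and \<open>V\<close> is its only
  member.\<close>

lemma krull_valuation_DVR:
  assumes val: "valuation_ring_of (qf V) V" and x: "x \<in> mv V" "x \<noteq> 0" and krull: "krull_domain V"
  shows "is_DVR V"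
proof -
  obtain \<V> where dvr: "\<And>W. W \<in> \<V> \<Longrightarrow> DVR_of (qf V) W" and Veq: "V = qf V \<inter> \<Inter>\<V>"
    using krull by (auto simp: krull_domain_def)
  have V: "subring V" by (rule valuation_subring[OF val])
  have K: "subfield (qf V)" by (rule subfield_qf[OF V])
  have "inverse x \<notin> V" "inverse x \<in> qf V"
    using x qf_subset[OF V] K by (auto simp: mv_def subfield_def)
  then obtain W where W: "W \<in> \<V>" using Veq by blast
  have sub: "V \<subseteq> W" if "W \<in> \<V>" for W using that Veq by blast
  have wval: "valuation_ring_of (qf V) W" if "W \<in> \<V>" for W using dvr[OF that] by (simp add: DVR_of_def)
  have "W' = W" if W': "W' \<in> \<V>" for W'
  proof -
    have "W \<subseteq> W' \<or> W' \<subseteq> W"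
    proof (rule ccontr)
      assume "\<not> (W \<subseteq> W' \<or> W' \<subseteq> W)"
      then obtain a b where ab: "a \<in> W" "a \<notin> W'" "b \<in> W'" "b \<notin> W" by blast
      have nz: "a \<noteq> 0" "b \<noteq> 0"
        using ab subring_zero[OF valuation_subring[OF wval]] W W' by auto
      have "a \<in> qf V" "b \<in> qf V" using ab valuation_sub[OF wval] W W' by blast+
      then have "a * inverse b \<in> qf V" using K by (simp add: subfield_def subring_mult)
      then have "a * inverse b \<in> V \<or> inverse (a * inverse b) \<in> V"
        using valuation_cases[OF val, of "a * inverse b"] nz by simp
      then have "a * inverse b * b \<in> W' \<or> inverse (a * inverse b) * a \<in> W"
        using ab sub[OF W] sub[OF W'] subring_mult[OF valuation_subring[OF wval]] W W' by blast
      moreover have "a * inverse b * b = a" "inverse (a * inverse b) * a = b" using nz by (simp_all add: field_simps)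
      ultimately show False using ab by (simp only:) blast
    qed
    then show ?thesis using DVR_maximal dvr W W' by blast
  qed
  then have "\<Inter>\<V> = W" using W by blast
  then have "V = W" using Veq valuation_sub[OF wval[OF W]] by blast
  then show ?thesis using dvr[OF W] by (simp add: is_DVR_def)
qed

section \<open>Intersections of regular local rings\<close>

text \<open>Membership in the maximal ideal stated without naming it. The condition that
  \<open>1 + z * u\<close> is nonzero is explicit because \<open>inverse 0 = 0\<close>.\<close>

definition in_jacobson :: "'a::field set \<Rightarrow> 'a \<Rightarrow> bool" where
  "in_jacobson \<alpha> z \<longleftrightarrow> z \<in> \<alpha> \<and> (\<forall>u\<in>\<alpha>. 1 + z * u \<noteq> 0 \<and> inverse (1 + z * u) \<in> \<alpha>)"

lemma in_jacobson_mult: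
  assumes "subring \<alpha>" "in_jacobson \<alpha> z" "c \<in> \<alpha>"
  shows "in_jacobson \<alpha> (z * c)"
  using assms subring_mult[OF assms(1)] unfolding in_jacobson_def by (simp add: mult.assoc)

lemma Qset_subring: "\<alpha> \<in> Qset D \<Longrightarrow> subring \<alpha>"
  by (simp add: Qset_def regular_local_2_def local_ring_def)

lemma subring_qf_Inter:
  assumes D: "subring D" and U: "U \<subseteq> Qset D"
  shows "subring (qf D \<inter> \<Inter>U)"
  unfolding subring_def
proof (intro conjI ballI)
  have K: "subring (qf D)" using subfield_qf[OF D] by (simp add: subfield_def)
  have \<alpha>: "subring \<alpha>" if "\<alpha> \<in> U" for \<alpha> using that U Qset_subring by blast
  show "0 \<in> qf D \<inter> \<Inter>U" "1 \<in> qf D \<inter> \<Inter>U"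
    using subring_closed(1,2)[OF K] subring_closed(1,2)[OF \<alpha>] by auto
  fix a b assume "a \<in> qf D \<inter> \<Inter>U" "b \<in> qf D \<inter> \<Inter>U"
  then show "a + b \<in> qf D \<inter> \<Inter>U" "a - b \<in> qf D \<inter> \<Inter>U" "a * b \<in> qf D \<inter> \<Inter>U"
    using subring_closed(3-5)[OF K] subring_closed(3-5)[OF \<alpha>] by auto
qed

section \<open>Construction of the family of rings\<close>

context qseq
begin

lemma small_mult:
  assumes "small w" "v \<in> V" "v \<noteq> 0"
  shows "small (w * v)"
  unfolding small_def
proof (intro conjI ballI impI)
  show "w * v \<in> mv V" "w * v \<noteq> 0"
    using assms is_ideal_mult2[OF mv_ideal] by (auto simp: small_def)
  fix b assume "b \<in> qf (E 0)" "b \<noteq> 0"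
  then obtain N where "w ^ N * inverse b \<in> V" using assms(1) by (auto simp: small_def)
  then have "w ^ N * inverse b * v ^ N \<in> V"
    using subring_mult[OF V_subring] subring_power[OF V_subring assms(2)] by blast
  moreover have "w ^ N * inverse b * v ^ N = (w * v) ^ N * inverse b"
    by (simp add: power_mult_distrib)
  ultimately show "\<exists>N. (w * v) ^ N * inverse b \<in> V" by metis
qed

text \<open>The power \<open>N\<close> brings the quotient into \<open>V\<close>; one more factor
  \<open>w\<close> makes it small.\<close>

lemma small_quotient:
  assumes "small w" "b \<in> qf (E 0)" "b \<noteq> 0"
  obtains N where "w ^ N * inverse b \<in> V" "small (w ^ Suc N * inverse b)"
proof -
  obtain N where N: "w ^ N * inverse b \<in> V" using assms by (auto simp: small_def)
  have "w \<noteq> 0" using assms(1) by (simp add: small_def)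
  then have "small (w * (w ^ N * inverse b))" using small_mult[OF assms(1) N] assms(3) by simp
  then show ?thesis using that[OF N] by (simp add: mult.assoc)
qed

text \<open>Here \<open>1/w\<close> lies in the maximal ideal of every ring chosen so far, so that
  \<open>s = z/(1+z)\<close> with \<open>z = b/w^(N+1)\<close> is divisible by \<open>b\<close> in each of them and, since
  \<open>s = 1/(1+1/z)\<close>, it is a unit of $V$.\<close>

lemma common_denominator:
  assumes w: "small w" and A: "\<And>\<alpha>. \<alpha> \<in> A \<Longrightarrow> \<alpha> \<in> Qset (E 0) \<and> in_jacobson \<alpha> (inverse w)"
    and f: "f \<in> V"
  shows "\<exists>s\<in>V. s \<notin> mv V \<and> (\<forall>\<alpha>\<in>A. s \<in> \<alpha> \<and> s * f \<in> \<alpha>)"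
proof -
  obtain c b where cb: "c \<in> E 0" "b \<in> E 0" "b \<noteq> 0" "f = c * inverse b"
    using f V_K by (auto simp: qf_def)
  have "b \<in> qf (E 0)" using cb(2) qf_subset[OF E_subring] by blast
  then obtain N where N: "small (w ^ Suc N * inverse b)" using small_quotient[OF w _ cb(3)] by metis
  define v where "v = w ^ Suc N * inverse b"
  have v: "v \<in> mv V" "v \<noteq> 0" using N by (auto simp: small_def v_def)
  have w0: "w \<noteq> 0" using w by (simp add: small_def)
  define s where "s = inverse (1 + v)"
  have v1: "1 + v \<notin> mv V"
  proof
    assume "1 + v \<in> mv V"
    from is_ideal_diff[OF V_subring mv_ideal this v(1)] show False using mv_one by simp
  qed
  have v1V: "1 + v \<in> V" using v subring_closed(2,3)[OF V_subring] by (auto simp: mv_def)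
  have v10: "1 + v \<noteq> 0" using v1 is_ideal_zero[OF mv_ideal] by auto
  have "s \<in> V" using v1 v1V by (simp add: s_def mv_def)
  moreover have "s \<notin> mv V" using v1V v10 by (simp add: s_def mv_def)
  moreover have "s \<in> \<alpha> \<and> s * f \<in> \<alpha>" if \<alpha>: "\<alpha> \<in> A" for \<alpha>
  proof -
    have sr: "subring \<alpha>" and J: "in_jacobson \<alpha> (inverse w)" and D\<alpha>: "E 0 \<subseteq> \<alpha>"
      using A[OF \<alpha>] Qset_subring by (auto simp: Qset_def)
    define u where "u = inverse w ^ N * b"
    define i where "i = inverse (1 + inverse w * u)"
    have z: "inverse w \<in> \<alpha>" using J by (simp add: in_jacobson_def)
    have u: "u \<in> \<alpha>" unfolding u_def using z cb(2) D\<alpha> sr by (intro subring_closed) auto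
    have i: "i \<in> \<alpha>" "1 + inverse w * u \<noteq> 0" using J u by (auto simp: in_jacobson_def i_def)
    have zu: "inverse w * u * v = 1"
      unfolding u_def v_def using w0 cb(3) by (simp add: field_simps)
    have "(inverse w * u * i) * (1 + v) = i * (inverse w * u + inverse w * u * v)"
      by (simp add: algebra_simps)
    also have "\<dots> = 1" unfolding zu using i(2) by (simp add: i_def add.commute)
    finally have s: "s = inverse w * u * i"
      unfolding s_def by (metis inverse_unique mult.commute)
    \<comment> \<open>The factor \<open>b\<close> of \<open>u\<close> cancels the denominator of
      \<open>f\<close>; only powers of \<open>1/w\<close>, the numerator \<open>c\<close> from
      \<open>E 0\<close> and the inverse \<open>i\<close> remain.\<close>
    have "s * f = inverse w * (inverse w ^ N * c) * i"
      unfolding s u_def cb(4) using cb(3) by (simp add: field_simps)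
    moreover have "inverse w * (inverse w ^ N * c) * i \<in> \<alpha>"
      using z cb(1) D\<alpha> i(1) sr by (intro subring_closed) auto
    moreover have "s \<in> \<alpha>" unfolding s using z u i(1) sr by (intro subring_closed) auto
    ultimately show ?thesis by simp
  qed
  ultimately show ?thesis by blast
qed

text \<open>The last clause is what domination of \<open>E n\<close> provides: nonunits of
  \<open>E n\<close> stay nonunits in \<open>\<beta>\<close>. It will keep the intersection inside
  \<open>V\<close>.\<close>

lemma next_ring:
  assumes w: "small w" "w \<in> E n" and A: "\<And>\<alpha>. \<alpha> \<in> A \<Longrightarrow> \<alpha> \<in> Qset (E 0) \<and> in_jacobson \<alpha> (inverse w)"
  shows "\<exists>w' \<beta>. small w' \<and> (\<forall>\<alpha>\<in>insert \<beta> A. \<alpha> \<in> Qset (E 0) \<and> in_jacobson \<alpha> (inverse w'))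
    \<and> E n \<subseteq> \<beta> \<and> (\<forall>a\<in>E n. a \<noteq> 0 \<longrightarrow> a \<in> mv V \<longrightarrow> inverse a \<notin> \<beta>)"
proof -
  have w0: "w \<noteq> 0" using w(1) by (simp add: small_def)
  obtain q y where qy: "rlr2 (E n) q y" "w \<notin> princ (E n) q"
    using rlr2.fresh_parameter[OF rlr2_E w(2) w0] by blast
  interpret Q: rlr2 "E n" q y by (rule qy(1))
  have "q \<in> qf (E 0)" using Q.xD E_V V_K by blast
  \<comment> \<open>Only \<open>c = q * e\<close> is known to lie in the older rings, not
    \<open>q\<close> itself; dividing by \<open>c\<close> therefore keeps \<open>1/w'\<close> a
    multiple of \<open>1/w\<close> there.\<close>
  then obtain c e where ce: "c \<in> E 0" "e \<in> E 0" "e \<noteq> 0" "q = c * inverse e" by (auto simp: qf_def)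
  have c: "c = q * e" using ce(3,4) by simp
  have c0: "c \<noteq> 0" using c ce(3) Q.x_nonzero by simp
  have "c \<in> qf (E 0)" using ce(1) qf_subset[OF E_subring] by blast
  then obtain N where N: "small (w ^ Suc N * inverse c)" using small_quotient[OF w(1) _ c0] by metis
  define w' where "w' = w ^ Suc N * inverse c"
  have z': "inverse w' = q * e * inverse (w ^ Suc N)" unfolding w'_def c by (simp add: mult.commute)
  have wn: "w ^ Suc N \<notin> princ (E n) q"
    using prime_ideal_power[OF Q.subring Q.princ_x_prime w(2)] qy(2) by blast
  have eE: "e \<in> E n" using ce(2) E_mono[of 0 n] by auto
  \<comment> \<open>\<open>1/w'\<close> is \<open>q * e / w ^ Suc N\<close>, and \<open>q\<close>
    does not divide \<open>w\<close>.\<close>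
  have "inverse w' \<in> mv Q.W"
    unfolding z' by (rule Q.loc_prime_mv[OF eE Q.closed(7)[OF w(2)] wn])
  from dominating_regular_ring[OF Q.regular Q.loc_prime_valuation this]
  obtain \<beta> V' where *: "minval (E n) V'" "regular_local_2 \<beta>" "E n \<subseteq> \<beta>" "\<beta> \<subseteq> V'" "inverse w' \<in> \<beta>"
    "inverse w' \<in> mv V'" and unit: "\<And>v. v \<in> \<beta> \<Longrightarrow> v \<notin> mv V' \<Longrightarrow> inverse v \<in> \<beta>" by blast
  interpret V': minval "E n" V' by (rule *(1))
  have "\<beta> \<in> Qset (E 0)"
    using * E_mono[of 0 n] valuation_sub[OF V'.val] qf_E[of n] by (auto simp: Qset_def)
  moreover have "in_jacobson \<beta> (inverse w')"
    unfolding in_jacobson_def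
  proof (intro conjI ballI)
    fix u assume u: "u \<in> \<beta>"
    have sr: "subring \<beta>" by (rule Qset_subring[OF \<open>\<beta> \<in> Qset (E 0)\<close>])
    have m: "inverse w' * u \<in> mv V'" using is_ideal_mult2[OF V'.mv_ideal] u *(4,6) by blast
    have n: "1 + inverse w' * u \<notin> mv V'"
    proof
      assume "1 + inverse w' * u \<in> mv V'"
      from is_ideal_diff[OF V'.V_subring V'.mv_ideal this m] show False
        using prime_ideal_one[OF V'.mv_prime] by simp
    qed
    then show "1 + inverse w' * u \<noteq> 0" using is_ideal_zero[OF V'.mv_ideal] by auto
    show "inverse (1 + inverse w' * u) \<in> \<beta>"
      using unit[OF _ n] subring_closed(2,3,5)[OF sr] u *(5) by blast
  qed (rule *(5))
  moreover have "in_jacobson \<alpha> (inverse w')" if \<alpha>: "\<alpha> \<in> A" for \<alpha>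
  proof -
    have sr: "subring \<alpha>" and J: "in_jacobson \<alpha> (inverse w)" and D\<alpha>: "E 0 \<subseteq> \<alpha>"
      using A[OF \<alpha>] Qset_subring by (auto simp: Qset_def)
    have "inverse w ^ N * c \<in> \<alpha>"
      using J ce(1) D\<alpha> subring_mult[OF sr] subring_power[OF sr] unfolding in_jacobson_def by blast
    moreover have "inverse w' = inverse w * (inverse w ^ N * c)"
      unfolding w'_def by (simp add: power_inverse mult.commute mult.left_commute)
    ultimately show ?thesis using in_jacobson_mult[OF sr J] by simp
  qed
  moreover have "inverse a \<notin> \<beta>" if "a \<in> E n" "a \<noteq> 0" "a \<in> mv V" for a
  proof -
    have "a \<in> mv V'" using V'.dominates[OF rlr2_E] E_max that by blast
    then show ?thesis using *(4) that(2) by (auto simp: mv_def)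
  qed
  ultimately show ?thesis using N *(3) A unfolding w'_def by blast
qed


text \<open>The denominator \<open>s\<close> for \<open>T k\<close> is placed in the rings already
  chosen by \<open>common_denominator\<close>, and in \<open>E (N (Suc k))\<close>, which all rings
  chosen afterwards contain. So it lies in every ring of the family.\<close>

lemma chain_exists:
  "\<exists>A N. (\<forall>k. \<forall>\<alpha>\<in>A k. \<alpha> \<in> Qset (E 0)) \<and> (\<forall>k. N k < N (Suc k))
    \<and> (\<forall>k. \<exists>s\<in>E (N (Suc k)). s \<notin> mv V \<and> s * T k \<in> E (N (Suc k)) \<and> (\<forall>\<alpha>\<in>A k. s \<in> \<alpha> \<and> s * T k \<in> \<alpha>))
    \<and> (\<forall>k. \<exists>\<beta>. A (Suc k) = insert \<beta> (A k) \<and> E (N (Suc k)) \<subseteq> \<beta>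
          \<and> (\<forall>a\<in>E (N (Suc k)). a \<noteq> 0 \<longrightarrow> a \<in> mv V \<longrightarrow> inverse a \<notin> \<beta>))"
proof -
  define good where "good c \<longleftrightarrow> (case c of (A, n, w) \<Rightarrow>
      small w \<and> (\<forall>\<alpha>\<in>A. \<alpha> \<in> Qset (E 0) \<and> in_jacobson \<alpha> (inverse w)))" for c :: "'a set set \<times> nat \<times> 'a"
  define nxt where "nxt k c c' \<longleftrightarrow> (case c of (A, n, w) \<Rightarrow> case c' of (A', n', w') \<Rightarrow> n < n'
      \<and> (\<exists>s\<in>E n'. s \<notin> mv V \<and> s * T k \<in> E n' \<and> (\<forall>\<alpha>\<in>A. s \<in> \<alpha> \<and> s * T k \<in> \<alpha>))
      \<and> (\<exists>\<beta>. A' = insert \<beta> A \<and> E n' \<subseteq> \<beta> \<and> (\<forall>a\<in>E n'. a \<noteq> 0 \<longrightarrow> a \<in> mv V \<longrightarrow> inverse a \<notin> \<beta>)))"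
    for k and c c' :: "'a set set \<times> nat \<times> 'a"
  obtain w0 where "small w0" using small_exists by blast
  then have g0: "good ({}, 0, w0)" by (simp add: good_def)
  have step: "\<exists>c'. good c' \<and> nxt k c c'" if "good c" for k c
  proof -
    obtain A n w where c: "c = (A, n, w)" by (cases c)
    have w: "small w" and A: "\<And>\<alpha>. \<alpha> \<in> A \<Longrightarrow> \<alpha> \<in> Qset (E 0) \<and> in_jacobson \<alpha> (inverse w)"
      using that by (auto simp: good_def c)
    have TV: "T k \<in> V" using T_in[of k] E_V by blast
    obtain s where s: "s \<in> V" "s \<notin> mv V" "\<forall>\<alpha>\<in>A. s \<in> \<alpha> \<and> s * T k \<in> \<alpha>"
      using common_denominator[OF w A TV] by blast
    have "s * T k \<in> V" "w \<in> V" using s TV subring_mult[OF V_subring] w by (auto simp: small_def mv_def)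
    then obtain i j l where ijl: "s \<in> E i" "s * T k \<in> E j" "w \<in> E l" using s(1) union_eq by blast
    \<comment> \<open>Large enough for \<open>s\<close>, \<open>s * T k\<close> and
      \<open>w\<close>; the summand \<open>Suc n\<close> makes the indices strictly
      increasing.\<close>
    define n' where "n' = Suc n + i + j + l"
    have le: "n < n'" "i \<le> n'" "j \<le> n'" "l \<le> n'" by (auto simp: n'_def)
    have n': "s \<in> E n'" "s * T k \<in> E n'" "w \<in> E n'" using ijl E_mono le by blast+
    obtain w' \<beta> where "small w'" "\<forall>\<alpha>\<in>insert \<beta> A. \<alpha> \<in> Qset (E 0) \<and> in_jacobson \<alpha> (inverse w')"
      "E n' \<subseteq> \<beta>" "\<forall>a\<in>E n'. a \<noteq> 0 \<longrightarrow> a \<in> mv V \<longrightarrow> inverse a \<notin> \<beta>"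
      using next_ring[OF w n'(3) A] by blast
    then have "good (insert \<beta> A, n', w')" "nxt k c (insert \<beta> A, n', w')"
      using s n' le(1) by (auto simp: good_def nxt_def c)
    then show ?thesis by blast
  qed
  obtain F where F: "\<And>k. good (F k)" "\<And>k. nxt k (F k) (F (Suc k))"
    using dependent_nat_choice[of "\<lambda>k. good" nxt] g0 step by metis
  define A N where "A k = fst (F k)" and "N k = fst (snd (F k))" for k
  have Feq: "F k = (A k, N k, snd (snd (F k)))" for k by (simp add: A_def N_def)
  have "\<alpha> \<in> Qset (E 0)" if "\<alpha> \<in> A k" for k \<alpha>
  proof -
    have "good (A k, N k, snd (snd (F k)))" using F(1)[of k] Feq[of k] by simp
    then show ?thesis using that by (simp add: good_def)
  qed
  moreover have "nxt k (A k, N k, snd (snd (F k))) (A (Suc k), N (Suc k), snd (snd (F (Suc k))))" for k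
    using F(2)[of k] Feq[of k] Feq[of "Suc k"] by simp
  ultimately show ?thesis unfolding nxt_def by (intro exI[of _ A] exI[of _ N]) auto
qed

theorem localization_exists:
  "\<exists>U \<subseteq> Qset (E 0). (qf (E 0) \<inter> \<Inter>U) \<subseteq> V
    \<and> V = {c * inverse s | c s. c \<in> qf (E 0) \<inter> \<Inter>U \<and> s \<in> qf (E 0) \<inter> \<Inter>U \<and> s \<notin> mv V}"
proof -
  obtain A N where A: "\<forall>k. \<forall>\<alpha>\<in>A k. \<alpha> \<in> Qset (E 0)" and N: "\<forall>k. N k < N (Suc k)"
    and s: "\<forall>k. \<exists>s\<in>E (N (Suc k)). s \<notin> mv V \<and> s * T k \<in> E (N (Suc k))
      \<and> (\<forall>\<alpha>\<in>A k. s \<in> \<alpha> \<and> s * T k \<in> \<alpha>)"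
    and new: "\<forall>k. \<exists>\<beta>. A (Suc k) = insert \<beta> (A k) \<and> E (N (Suc k)) \<subseteq> \<beta>
      \<and> (\<forall>a\<in>E (N (Suc k)). a \<noteq> 0 \<longrightarrow> a \<in> mv V \<longrightarrow> inverse a \<notin> \<beta>)"
    using chain_exists by (elim exE conjE) (rule that)
  define U where "U = (\<Union>k. A k)"
  define C where "C = qf (E 0) \<inter> \<Inter>U"
  have UQ: "U \<subseteq> Qset (E 0)" using A by (auto simp: U_def)
  have N_mono: "N i \<le> N j" if "i \<le> j" for i j
    using lift_Suc_mono_le[of N] N less_imp_le that by blast
  have N_ge: "k \<le> N k" for k
    by (induction k) (auto intro: le_less_trans[OF _ N[rule_format]] Suc_leI)
  have A_mono: "A i \<subseteq> A j" if "i \<le> j" for i j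
    using lift_Suc_mono_le[of A] new that by (metis subset_insertI)
  have late: "\<alpha> \<in> A k \<or> E (N (Suc k)) \<subseteq> \<alpha>" if "\<alpha> \<in> A j" for \<alpha> j k
    using that
  proof (induction j)
    case 0
    then show ?case using A_mono[of 0 k] by auto
  next
    case (Suc j)
    obtain \<beta> where \<beta>: "A (Suc j) = insert \<beta> (A j)" "E (N (Suc j)) \<subseteq> \<beta>"
      using new[rule_format, of j] by (elim exE conjE) (rule that)
    show ?case
    proof (cases "Suc j \<le> k")
      case True
      then show ?thesis using A_mono Suc.prems by blast
    next
      case False
      then have "E (N (Suc k)) \<subseteq> E (N (Suc j))" by (intro E_mono N_mono) simp
      then show ?thesis using \<beta> Suc by blast
    qed
  qed
  have C: "subring C" unfolding C_def by (rule subring_qf_Inter[OF E_subring UQ])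
  have DC: "E 0 \<subseteq> C"
    using qf_subset[OF E_subring] UQ by (auto simp: C_def Qset_def)
  \<comment> \<open>If \<open>c\<close> is not in \<open>V\<close>, then \<open>1/c\<close> is a
    nonunit of \<open>V\<close> and occurs in some \<open>E i\<close>; the ring added at that stage
    does not contain \<open>c\<close>.\<close>
  have CV: "C \<subseteq> V"
  proof
    fix c assume c: "c \<in> C"
    show "c \<in> V"
    proof (rule ccontr)
      assume cV: "c \<notin> V"
      then have c0: "c \<noteq> 0" using subring_zero[OF V_subring] by auto
      have "inverse c \<in> V" using valuation_cases[OF V_val _ c0] c cV by (auto simp: C_def)
      then have m: "inverse c \<in> mv V" using cV by (simp add: mv_def)
      obtain i where "inverse c \<in> E i" using \<open>inverse c \<in> V\<close> union_eq by blast
      moreover have "E i \<subseteq> E (N (Suc i))" using N_ge[of "Suc i"] by (intro E_mono) simp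
      ultimately have i: "inverse c \<in> E (N (Suc i))" by blast
      obtain \<beta> where "A (Suc i) = insert \<beta> (A i)"
        "\<forall>a\<in>E (N (Suc i)). a \<noteq> 0 \<longrightarrow> a \<in> mv V \<longrightarrow> inverse a \<notin> \<beta>"
        using new[rule_format, of i] by (elim exE conjE) (rule that)
      then have "inverse (inverse c) \<notin> \<beta>" "\<beta> \<in> U" using i m c0 by (auto simp: U_def)
      then show False using c by (auto simp: C_def)
    qed
  qed
  define L where "L = {c * inverse s | c s. c \<in> C \<and> s \<in> C \<and> s \<notin> mv V}"
  have "L = loc_prime C (mv V \<inter> C)" unfolding L_def loc_prime_def by blast
  then have L: "subring L" and CL: "C \<subseteq> L"
    using subring_loc_prime[OF C prime_ideal_contract[OF C CV mv_prime]] by simp_all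
  have LI: "c * inverse s \<in> L" if "c \<in> C" "s \<in> C" "s \<notin> mv V" for c s using that unfolding L_def by blast
  have nz: "s \<noteq> 0" if "s \<notin> mv V" for s using that is_ideal_zero[OF mv_ideal] by auto
  have LV: "L \<subseteq> V"
  proof
    fix a assume "a \<in> L"
    then obtain c s where "c \<in> C" "s \<in> C" "s \<notin> mv V" "a = c * inverse s" unfolding L_def by blast
    moreover have "inverse s \<in> V" using calculation CV by (auto simp: mv_def)
    ultimately show "a \<in> V" using CV subring_mult[OF V_subring] by blast
  qed
  \<comment> \<open>\<open>E (Suc i)\<close> arises from \<open>E i\<close> by adjoining
    \<open>T i\<close> and inverting elements outside \<open>mv V\<close>. With this closure
    property and \<open>TL\<close>, the inclusion of all \<open>E i\<close> in \<open>L\<close>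
    follows by induction.\<close>
  have L_unit: "inverse a \<in> L" if a: "a \<in> L" "a \<notin> mv V" for a
  proof -
    obtain c s where *: "c \<in> C" "s \<in> C" "s \<notin> mv V" "a = c * inverse s" using a(1) unfolding L_def by blast
    have "c = a * s" using *(4) nz[OF *(3)] by simp
    then have "c \<notin> mv V" using prime_ideal_cases[OF mv_prime, of a s] a LV CV *(2,3) by blast
    then have "s * inverse c \<in> L" using LI * by blast
    then show ?thesis using *(4) by (simp add: mult.commute)
  qed
  have TL: "T k \<in> L" for k
  proof -
    obtain s where s: "s \<in> E (N (Suc k))" "s \<notin> mv V" "s * T k \<in> E (N (Suc k))"
      "\<forall>\<alpha>\<in>A k. s \<in> \<alpha> \<and> s * T k \<in> \<alpha>"
      using s[rule_format, of k] by (elim bexE conjE) (rule that)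
    have "s \<in> \<alpha> \<and> s * T k \<in> \<alpha>" if "\<alpha> \<in> U" for \<alpha>
      using that late s unfolding U_def by blast
    moreover have "s \<in> qf (E 0)" "s * T k \<in> qf (E 0)" using s(1,3) E_V V_K by blast+
    ultimately have "s \<in> C" "s * T k \<in> C" by (auto simp: C_def)
    then have "s * T k * inverse s \<in> L" using LI s(2) by blast
    moreover have "s * T k * inverse s = T k" using nz[OF s(2)] by simp
    ultimately show ?thesis by (simp only:)
  qed
  have "E i \<subseteq> L" for i
  proof (induction i)
    case 0
    then show ?case using DC CL by blast
  next
    case (Suc i)
    show ?case
    proof
      fix a assume "a \<in> E (Suc i)"
      then obtain p q where pq: "p \<in> polys (E i)" "q \<in> polys (E i)" "poly q (T i) \<notin> mv V"
        "a = poly p (T i) * inverse (poly q (T i))" unfolding E_Suc quad_ring_def by blast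
      have "poly p (T i) \<in> L" "poly q (T i) \<in> L"
        using poly_in_subring[OF L TL] pq(1,2) polys_mono[OF Suc] by blast+
      then show "a \<in> L" using pq(3,4) L_unit subring_mult[OF L] by blast
    qed
  qed
  then have "V \<subseteq> L" using union_eq by blast
  then have "V = L" using LV by blast
  then show ?thesis using UQ CV unfolding L_def C_def by blast
qed

end

theorem theorem6p8:
  fixes D V :: "'a::field set"
  assumes "regular_local_2 D"
    and "minimal_valuation_overring D V"
  shows "\<exists>U \<subseteq> Qset D. is_localization_of (qf D \<inter> \<Inter>U) V \<and>
           (\<not> is_DVR V \<longrightarrow> \<not> almost_krull (qf D \<inter> \<Inter>U))"
proof -
  obtain E X Y m where seq: "qseq V E X Y m" and D: "E 0 = D" using qseq_exists[OF assms] by blast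
  interpret qseq V E X Y m by (rule seq)
  obtain U where U: "U \<subseteq> Qset D" "qf D \<inter> \<Inter>U \<subseteq> V"
    and Veq: "V = {c * inverse s | c s. c \<in> qf D \<inter> \<Inter>U \<and> s \<in> qf D \<inter> \<Inter>U \<and> s \<notin> mv V}"
    using localization_exists unfolding D by blast
  define C where "C = qf D \<inter> \<Inter>U"
  have CV: "C \<subseteq> V" using U(2) by (simp add: C_def)
  have C: "subring C" unfolding C_def using subring_qf_Inter[OF E_subring[of 0]] U(1) unfolding D .
  have "is_localization_of C V"
    unfolding is_localization_of_def
  proof (intro exI[of _ "C - mv V"] conjI)
    show "mult_closed C (C - mv V)"
      unfolding mult_closed_def
      using subring_one[OF C] mv_one is_ideal_zero[OF mv_ideal] subring_mult[OF C]
        prime_ideal_cases[OF mv_prime] CV by blast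
    show "V = {c * inverse s | c s. c \<in> C \<and> s \<in> C - mv V}"
      using Veq unfolding C_def[symmetric] by simp
  qed
  \<comment> \<open>\<open>V\<close> is the localization of \<open>C\<close> at the prime
    \<open>mv V \<inter> C\<close>, hence a Krull domain if \<open>C\<close> is almost Krull; the
    parameters \<open>X\<close> provide the nonzero nonunit.\<close>
  moreover have "is_DVR V" if ak: "almost_krull C"
  proof -
    have "prime_ideal C (mv V \<inter> C)" by (rule prime_ideal_contract[OF C CV mv_prime])
    then have "krull_domain (loc_prime C (mv V \<inter> C))" using ak by (simp add: almost_krull_def)
    moreover have "loc_prime C (mv V \<inter> C) = {c * inverse s | c s. c \<in> C \<and> s \<in> C \<and> s \<notin> mv V}"
      unfolding loc_prime_def by blast
    ultimately have krull: "krull_domain V" using Veq unfolding C_def[symmetric] by simp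
    have "qf V = qf D" using qf_eq[OF E_subring[of 0] E_V V_K] unfolding D .
    then have "valuation_ring_of (qf V) V" using V_val unfolding D by simp
    then show ?thesis using krull_valuation_DVR[OF _ X_mv X_nonzero krull] by blast
  qed
  ultimately show ?thesis using U(1) unfolding C_def by blast
qed

end
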